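(* Let $P$ be a probability distribution on $\mathbb{N}$ with finite mean and $P(1)<1$. Let $(\boldsymbol d_n)_{n}$, $\boldsymbol d_n=(d_1(n),\dots,d_n(n))\in\mathbb{N}^n$ with $d_i(n)\le n-2$, be such that the empirical distributions $P_{\boldsymbol d_n}=\frac1n\sum_{i=1}^n\delta_{d_i(n)}$ converge weakly to $P$, and let $N_n\sim\mathcal N(n,\boldsymbol d_n)$ be the random network defined in the context. Then $$\mathbb{E}\,U(N_n)\xrightarrow{\;w\;}\mathrm{Er}(P)\qquad (n\to\infty)$$ weakly in $\mathcal P(G_* )$, i.e. the sequence $N_n$ converges locally weakly (in expectation) to the Erlang Weighted Tree with potential degree distribution $P$.
   Context: $\mathbb N=\{1,2,\dots\}$, $\mathbb Z_+=\{0,1,\dots\}$, $\mathbb R_+=[0,\infty)$. $\mathrm{Erlang}(k)$ has density $e^{-x}x^{k-1}/(k-1)!$ on $\mathbb R_+$. **Space $G_*$.** A network is a graph with a vertex-mark function $w_v:V\to\mathbb N\times\mathbb R_+$ and an edge-mark function $w_e:E\to\mathbb R_+$ (mark spaces with their Euclidean metrics). A rooted network has a distinguished vertex (root). $G_*$ is the set of isomorphism classes $[N]$ of connected locally finite rooted networks, where isomorphisms are bijections of vertices preserving root, edges and marks. For $[N],[N']\in G_*$ put $d_{G_*}([N],[N'])=1/(1+R)$, where $R$ is the supremum of $t\ge 0$ for which there is a root-preserving graph isomorphism $\sigma$ between the (unmarked) subgraphs induced by vertices at distance at most $t$ from the roots, such that the marks of every vertex $v$ and $\sigma(v)$, and of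 every edge $e$ and $\sigma(e)$, in these subgraphs are at distance less than $1/t$. With this metric $G_*$ is Polish; $\mathcal P(G_* )$ is the set of Borel probability measures on $G_*$ with the topology of weak convergence. **Finite model $\mathcal N(n,\boldsymbol d_n)$.** To the edges of the complete graph on $[n]=\{1,\dots,n\}$ assign i.i.d. exponential costs $C_n(\{i,j\})$ with mean $n$ (a.s. distinct). For a vertex $i$ let its threshold $\mathcal T_i$ be the $(d_i(n)+1)$-st smallest value of $\{C_n(\{i,j\}):j\ne i\}$ and let its set of potential neighbours be $\mathcal P_i=\{j\neq i: C_n(\{i,j\})<\mathcal T_i\}$. The edge set $\widetilde E_n$ consists of all $\{i,j\}$ with $i\in\mathcal P_j$ and $j\in\mathcal P_i$. $N_n$ is the network $([n],\widetilde E_n)$ with vertex marks $(d_i(n),\mathcal T_i)$ and edge marks $C_n(\{i,j\})$; $\mathcal N(n,\boldsymbol d_n)$ is its law. $U(N_n)=\frac1n\sum_{i\in[n]}\delta_{[N_{n,\circ}(i)]}$, where $N_{n,\circ}(i)$ is the connected component of $i$ in $N_n$ rooted at $i$, and $\mathbb E\,U(N_n)(A)=\mathbb E[U(N_n)(A)]$, i.e. the law of $[N_{n,\circ}(r)]$ for uniformly random $r\in[n]$. **EWT $\mathrm{Er}(P)$.** Let $\mathbb N^f=\bigcup_{i\ge0}\mathbb N^i$, $\mathbb N^0=\{o\}$, and $\widehat P(k)=P(k+1)$, $k\in\mathbb Z_+$. Independently over $\boldsymbol i\in\mathbb N^f$: $n_o\sim P$, $n_{\boldsymbol i}\sim\widehat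 P$ for $\boldsymbol i\ne o$; given $n_{\boldsymbol i}$, $v_{\boldsymbol i}\sim\mathrm{Erlang}(n_{\boldsymbol i}+1)$; given $(n_{\boldsymbol i},v_{\boldsymbol i})$, the costs $\zeta_{(\boldsymbol i,1)},\dots,\zeta_{(\boldsymbol i,n_{\boldsymbol i})}$ are i.i.d. uniform on $[0,v_{\boldsymbol i}]$. The backbone tree is the component of $o$ in the graph with edges $\{\boldsymbol i,(\boldsymbol i,j)\}$, $1\le j\le n_{\boldsymbol i}$. Keep the edge $\{\boldsymbol i,(\boldsymbol i,j)\}$ iff $\zeta_{(\boldsymbol i,j)}<v_{(\boldsymbol i,j)}$, and take the component of $o$, rooted at $o$, with vertex marks $(n_o,v_o)$ at the root and $(n_{\boldsymbol i}+1,v_{\boldsymbol i})$ at non-root vertices, and edge marks $\zeta_{(\boldsymbol i,j)}$. $\mathrm{Er}(P)\in\mathcal P(G_* )$ is the law of its isomorphism class. *)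

theory Defs
  imports "HOL-Probability.Probability" "HOL-Library.Diagonal_Subsequence"
begin

section \<open>Networks\<close>

text \<open>Graphs are simple and undirected; an edge is the set of its two endpoints.\<close>

record 'a network =
  verts :: "'a set"
  edges :: "'a set set"
  vmark :: "'a \<Rightarrow> nat \<times> real"
  emark :: "'a set \<Rightarrow> real"

record 'a rooted_network = "'a network" +
  root_vertex :: 'a

definition adj :: "('a, 'b) network_scheme \<Rightarrow> ('a \<times> 'a) set" where
  "adj N = {(u, v). u \<in> verts N \<and> v \<in> verts N \<and> {u, v} \<in> edges N}"

definition gdist :: "('a, 'b) network_scheme \<Rightarrow> 'a \<Rightarrow> 'a \<Rightarrow> nat" where
  "gdist N u v = (LEAST k. (u, v) \<in> adj N ^^ k)"

definition is_network :: "('a, 'b) network_scheme \<Rightarrow> bool" where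
  "is_network N \<longleftrightarrow>
     edges N \<subseteq> {{u, v} | u v. u \<in> verts N \<and> v \<in> verts N \<and> u \<noteq> v} \<and>
     (\<forall>v\<in>verts N. 1 \<le> fst (vmark N v) \<and> 0 \<le> snd (vmark N v)) \<and>
     (\<forall>e\<in>edges N. 0 \<le> emark N e)"

definition connected_network :: "('a, 'b) network_scheme \<Rightarrow> bool" where
  "connected_network N \<longleftrightarrow> (\<forall>u\<in>verts N. \<forall>v\<in>verts N. (u, v) \<in> (adj N)\<^sup>*)"

definition locally_finite :: "('a, 'b) network_scheme \<Rightarrow> bool" where
  "locally_finite N \<longleftrightarrow> (\<forall>v\<in>verts N. finite {u. (v, u) \<in> adj N})"

definition clf_network :: "'a rooted_network \<Rightarrow> bool" where
  "clf_network N \<longleftrightarrow>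
     is_network N \<and> root_vertex N \<in> verts N \<and> connected_network N \<and> locally_finite N"

definition network_iso :: "'a rooted_network \<Rightarrow> 'b rooted_network \<Rightarrow> bool" where
  "network_iso N N' \<longleftrightarrow> (\<exists>\<sigma>. bij_betw \<sigma> (verts N) (verts N') \<and> \<sigma> (root_vertex N) = root_vertex N' \<and>
     (\<forall>u\<in>verts N. \<forall>v\<in>verts N. {u, v} \<in> edges N \<longleftrightarrow> {\<sigma> u, \<sigma> v} \<in> edges N') \<and>
     (\<forall>v\<in>verts N. vmark N v = vmark N' (\<sigma> v)) \<and>
     (\<forall>e\<in>edges N. emark N e = emark N' (\<sigma> ` e)))"

text \<open>The connected component of \<open>i\<close>, rooted at \<open>i\<close>.\<close>

definition component :: "('a, 'b) network_scheme \<Rightarrow> 'a \<Rightarrow> 'a rooted_network" where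
  "component N i =
     (let V = {v. (i, v) \<in> (adj N)\<^sup>*}
      in \<lparr>verts = V, edges = {e \<in> edges N. e \<subseteq> V}, vmark = vmark N, emark = emark N, root_vertex = i\<rparr>)"


section \<open>The local metric\<close>

definition nball :: "'a rooted_network \<Rightarrow> real \<Rightarrow> 'a set" where
  "nball N t = {v \<in> verts N. real (gdist N (root_vertex N) v) \<le> t}"

text \<open>The Euclidean distance of vertex marks.\<close>

definition vmark_dist :: "nat \<times> real \<Rightarrow> nat \<times> real \<Rightarrow> real" where
  "vmark_dist a b = dist (real (fst a), snd a) (real (fst b), snd b)"

text \<open>
  \<open>ball_iso t \<epsilon> N N'\<close>: the subgraphs of radius \<open>t\<close> around the roots are isomorphic as rooted
  unmarked graphs, by an isomorphism that moves every mark by less than \<open>\<epsilon>\<close>.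
  In \<open>agree\<close> the bound is \<open>1 / t\<close>, computed in the extended reals so that it is
  \<open>\<infinity>\<close> at \<open>t = 0\<close>.
\<close>

definition ball_iso :: "real \<Rightarrow> ereal \<Rightarrow> 'a rooted_network \<Rightarrow> 'b rooted_network \<Rightarrow> bool" where
  "ball_iso t \<epsilon> N N' \<longleftrightarrow>
     (\<exists>\<sigma>. bij_betw \<sigma> (nball N t) (nball N' t) \<and> \<sigma> (root_vertex N) = root_vertex N' \<and>
       (\<forall>u\<in>nball N t. \<forall>v\<in>nball N t. {u, v} \<in> edges N \<longleftrightarrow> {\<sigma> u, \<sigma> v} \<in> edges N') \<and>
       (\<forall>v\<in>nball N t. ereal (vmark_dist (vmark N v) (vmark N' (\<sigma> v))) < \<epsilon>) \<and>
       (\<forall>e\<in>edges N. e \<subseteq> nball N t \<longrightarrow> ereal (dist (emark N e) (emark N' (\<sigma> ` e))) < \<epsilon>))"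

definition agree :: "real \<Rightarrow> 'a rooted_network \<Rightarrow> 'b rooted_network \<Rightarrow> bool" where
  "agree t N N' \<longleftrightarrow> ball_iso t (1 / ereal t) N N'"


section \<open>The space of isomorphism classes\<close>

text \<open>
  Connected locally finite networks are countable, so every isomorphism class has a
  representative whose vertices are natural numbers; a class is represented by the set of
  all these representatives. For \<open>N\<close> that is not a connected locally finite rooted network,
  \<open>gclass N\<close> is a fixed unspecified point.
\<close>

definition nat_reps :: "'a rooted_network \<Rightarrow> nat rooted_network set" where
  "nat_reps N = {M. clf_network N \<and> clf_network M \<and> network_iso N M}"

typedef gstar = "nat_reps ` {N :: nat rooted_network. clf_network N}"
  morphisms reps Abs_gstar
proof -
  define N :: "nat rooted_network" where
    "N = \<lparr>verts = {0}, edges = {}, vmark = (\<lambda>_. (1, 0)), emark = (\<lambda>_. 0), root_vertex = 0\<rparr>"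
  have "clf_network N"
    by (auto simp: N_def clf_network_def is_network_def connected_network_def
        locally_finite_def adj_def)
  then show ?thesis by blast
qed

definition gclass :: "'a rooted_network \<Rightarrow> gstar" where
  "gclass N = Abs_gstar (nat_reps N)"

text \<open>The relation \<open>agree\<close> does not depend on the representatives (\<open>agree_cong\<close>).\<close>

definition agree_radius :: "gstar \<Rightarrow> gstar \<Rightarrow> ereal" where
  "agree_radius x y = (SUP t\<in>{t. 0 \<le> t \<and> (\<exists>N\<in>reps x. \<exists>N'\<in>reps y. agree t N N')}. ereal t)"

subsection \<open>Isomorphisms and balls\<close>

lemma vmark_dist_refl [simp]: "vmark_dist a a = 0"
  by (simp add: vmark_dist_def)

lemma vmark_dist_commute: "vmark_dist a b = vmark_dist b a"
  by (simp add: vmark_dist_def dist_commute)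

lemma vmark_dist_triangle: "vmark_dist a c \<le> vmark_dist a b + vmark_dist b c"
  unfolding vmark_dist_def by (rule dist_triangle)

lemma adj_sym: "(u, v) \<in> adj N \<Longrightarrow> (v, u) \<in> adj N"
  by (auto simp: adj_def insert_commute)

lemma network_iso_refl: "network_iso N N"
  unfolding network_iso_def by (rule exI[of _ id]) auto

lemma edge_cases:
  assumes "is_network N" "e \<in> edges N"
  obtains u v where "e = {u, v}" "u \<in> verts N" "v \<in> verts N" "u \<noteq> v"
  using assms unfolding is_network_def by blast

lemma gdist_le:
  assumes "(u, v) \<in> adj N ^^ k" shows "gdist N u v \<le> k"
  unfolding gdist_def using assms by (rule Least_le)

lemma gdist_walk:
  assumes "(u, v) \<in> (adj N)\<^sup>*" shows "(u, v) \<in> adj N ^^ gdist N u v"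
  using assms unfolding gdist_def rtrancl_power by (rule LeastI_ex)

lemma clf_walk:
  assumes "clf_network N" "v \<in> verts N"
  shows "(root_vertex N, v) \<in> adj N ^^ gdist N (root_vertex N) v"
  using assms by (intro gdist_walk) (auto simp: clf_network_def connected_network_def)

lemma walk_verts: "(u, v) \<in> adj N ^^ k \<Longrightarrow> u \<in> verts N \<Longrightarrow> v \<in> verts N"
  by (cases k) (auto simp: adj_def)

lemma nball_iff:
  assumes "clf_network N"
  shows "v \<in> nball N t \<longleftrightarrow> (\<exists>k. real k \<le> t \<and> (root_vertex N, v) \<in> adj N ^^ k)"
proof
  assume "v \<in> nball N t"
  then show "\<exists>k. real k \<le> t \<and> (root_vertex N, v) \<in> adj N ^^ k"
    using clf_walk[OF assms, of v] unfolding nball_def by blast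
next
  assume "\<exists>k. real k \<le> t \<and> (root_vertex N, v) \<in> adj N ^^ k"
  then obtain k where k: "real k \<le> t" "(root_vertex N, v) \<in> adj N ^^ k" by blast
  have "v \<in> verts N" using walk_verts[OF k(2)] assms by (auto simp: clf_network_def)
  with k gdist_le[OF k(2)] show "v \<in> nball N t" unfolding nball_def by auto
qed

lemma root_in_nball: "clf_network N \<Longrightarrow> 0 \<le> t \<Longrightarrow> root_vertex N \<in> nball N t"
  by (subst nball_iff) (auto intro: exI[of _ 0])

lemma nball_mono: "s \<le> t \<Longrightarrow> nball N s \<subseteq> nball N t"
  by (auto simp: nball_def)

lemma nball_subset: "nball N t \<subseteq> verts N"
  by (auto simp: nball_def)

lemma finite_nball:
  assumes "clf_network N" shows "finite (nball N t)"
proof -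
  have fin: "finite {v. (root_vertex N, v) \<in> adj N ^^ k}" for k
  proof (induction k)
    case (Suc k)
    have "{v. (root_vertex N, v) \<in> adj N ^^ Suc k} =
        (\<Union>u\<in>{u. (root_vertex N, u) \<in> adj N ^^ k}. {v. (u, v) \<in> adj N})" by auto
    moreover have "finite {v. (u, v) \<in> adj N}" if "(root_vertex N, u) \<in> adj N ^^ k" for u
      using assms walk_verts[OF that] by (auto simp: clf_network_def locally_finite_def)
    ultimately show ?case using Suc by simp
  qed simp
  have "nball N t \<subseteq> (\<Union>k\<in>{..nat \<lfloor>t\<rfloor>}. {v. (root_vertex N, v) \<in> adj N ^^ k})"
    unfolding nball_iff[OF assms] subset_iff
    by (auto simp: le_nat_floor)
  with fin show ?thesis by (meson finite_UN_I finite_atMost finite_subset)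
qed

text \<open>Walks from the root that stay in the domain of a local isomorphism are transported.\<close>

lemma walk_transport:
  assumes N: "clf_network N" and "\<sigma> (root_vertex N) = root_vertex N'"
    and "\<sigma> ` nball N t \<subseteq> verts N'"
    and E: "\<forall>u\<in>nball N t. \<forall>v\<in>nball N t. {u, v} \<in> edges N \<longrightarrow> {\<sigma> u, \<sigma> v} \<in> edges N'"
  shows "real k \<le> t \<Longrightarrow> (root_vertex N, v) \<in> adj N ^^ k \<Longrightarrow> (root_vertex N', \<sigma> v) \<in> adj N' ^^ k"
proof (induction k arbitrary: v)
  case 0
  then show ?case using assms(2) by simp
next
  case (Suc k)
  then obtain u where u: "(root_vertex N, u) \<in> adj N ^^ k" "(u, v) \<in> adj N" by auto
  have "u \<in> nball N t" using Suc.prems u nball_iff[OF N, of u t]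
    by (auto intro!: exI[of _ k])
  moreover have "v \<in> nball N t" using Suc.prems nball_iff[OF N, of v t] by blast
  ultimately have "(\<sigma> u, \<sigma> v) \<in> adj N'" using u(2) E assms(3) unfolding adj_def by blast
  with Suc.IH[OF _ u(1)] Suc.prems show ?case by auto
qed

lemma local_iso_nball:
  assumes N: "clf_network N" and N': "clf_network N'"
    and bij: "bij_betw \<sigma> (nball N t) (nball N' t)" and r: "\<sigma> (root_vertex N) = root_vertex N'"
    and E: "\<forall>u\<in>nball N t. \<forall>v\<in>nball N t. {u, v} \<in> edges N \<longleftrightarrow> {\<sigma> u, \<sigma> v} \<in> edges N'"
    and st: "s \<le> t" and t: "0 \<le> t"
  shows "bij_betw \<sigma> (nball N s) (nball N' s)"
proof -
  define \<tau> where "\<tau> = inv_into (nball N t) \<sigma>"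
  have \<tau>: "bij_betw \<tau> (nball N' t) (nball N t)"
    unfolding \<tau>_def by (rule bij_betw_inv_into[OF bij])
  have \<tau>\<sigma>: "\<tau> (\<sigma> v) = v" if "v \<in> nball N t" for v
    unfolding \<tau>_def using bij that by (rule bij_betw_inv_into_left)
  have \<sigma>\<tau>: "\<sigma> (\<tau> v) = v" if "v \<in> nball N' t" for v
    unfolding \<tau>_def using bij that by (rule bij_betw_inv_into_right)
  have r': "\<tau> (root_vertex N') = root_vertex N" using \<tau>\<sigma>[OF root_in_nball[OF N t]] r by simp
  have E': "\<forall>u\<in>nball N' t. \<forall>v\<in>nball N' t. {u, v} \<in> edges N' \<longrightarrow> {\<tau> u, \<tau> v} \<in> edges N"
  proof (intro ballI impI)
    fix u v assume uv: "u \<in> nball N' t" "v \<in> nball N' t" "{u, v} \<in> edges N'"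
    then have "\<tau> u \<in> nball N t" "\<tau> v \<in> nball N t" using \<tau> by (auto dest: bij_betwE)
    from E[rule_format, OF this] uv show "{\<tau> u, \<tau> v} \<in> edges N" by (simp add: \<sigma>\<tau>)
  qed
  have im: "\<sigma> ` nball N t \<subseteq> verts N'" "\<tau> ` nball N' t \<subseteq> verts N"
    using bij_betw_imp_surj_on[OF bij] bij_betw_imp_surj_on[OF \<tau>]
      nball_subset[of N t] nball_subset[of N' t] by simp_all
  have E1: "\<forall>u\<in>nball N t. \<forall>v\<in>nball N t. {u, v} \<in> edges N \<longrightarrow> {\<sigma> u, \<sigma> v} \<in> edges N'"
    using E by blast
  have 1: "\<sigma> v \<in> nball N' s" if "v \<in> nball N s" for v
  proof -
    from that obtain k where k: "real k \<le> s" "(root_vertex N, v) \<in> adj N ^^ k"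
      unfolding nball_iff[OF N] by blast
    with st have "real k \<le> t" by simp
    from walk_transport[OF N r im(1) E1 this k(2)] k(1) show ?thesis
      unfolding nball_iff[OF N'] by blast
  qed
  have 2: "\<tau> v \<in> nball N s" if "v \<in> nball N' s" for v
  proof -
    from that obtain k where k: "real k \<le> s" "(root_vertex N', v) \<in> adj N' ^^ k"
      unfolding nball_iff[OF N'] by blast
    with st have "real k \<le> t" by simp
    from walk_transport[OF N' r' im(2) E' this k(2)] k(1) show ?thesis
      unfolding nball_iff[OF N] by blast
  qed
  show ?thesis
  proof (rule bij_betw_byWitness[where f' = \<tau>])
    show "\<forall>a\<in>nball N s. \<tau> (\<sigma> a) = a" "\<forall>a'\<in>nball N' s. \<sigma> (\<tau> a') = a'"
      using \<tau>\<sigma> \<sigma>\<tau> nball_mono[OF st, of N] nball_mono[OF st, of N']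
      by (auto simp: subset_iff)
  qed (use 1 2 in auto)
qed

lemma network_iso_nball:
  assumes N: "clf_network N" and N': "clf_network N'"
    and bij: "bij_betw \<sigma> (verts N) (verts N')" and r: "\<sigma> (root_vertex N) = root_vertex N'"
    and E: "\<forall>u\<in>verts N. \<forall>v\<in>verts N. {u, v} \<in> edges N \<longleftrightarrow> {\<sigma> u, \<sigma> v} \<in> edges N'"
  shows "bij_betw \<sigma> (nball N t) (nball N' t)"
proof -
  define \<tau> where "\<tau> = inv_into (verts N) \<sigma>"
  have \<tau>: "bij_betw \<tau> (verts N') (verts N)"
    unfolding \<tau>_def by (rule bij_betw_inv_into[OF bij])
  have \<tau>\<sigma>: "\<tau> (\<sigma> v) = v" if "v \<in> verts N" for v
    unfolding \<tau>_def using bij that by (rule bij_betw_inv_into_left)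
  have \<sigma>\<tau>: "\<sigma> (\<tau> v) = v" if "v \<in> verts N'" for v
    unfolding \<tau>_def using bij that by (rule bij_betw_inv_into_right)
  have r': "\<tau> (root_vertex N') = root_vertex N" using \<tau>\<sigma>[of "root_vertex N"] r N by (simp add: clf_network_def)
  have E1: "\<forall>u\<in>nball N t. \<forall>v\<in>nball N t. {u, v} \<in> edges N \<longrightarrow> {\<sigma> u, \<sigma> v} \<in> edges N'"
    using E nball_subset[of N t] by (simp add: subset_iff)
  have E2: "\<forall>u\<in>nball N' t. \<forall>v\<in>nball N' t. {u, v} \<in> edges N' \<longrightarrow> {\<tau> u, \<tau> v} \<in> edges N"
  proof (intro ballI impI)
    fix u v assume uv: "u \<in> nball N' t" "v \<in> nball N' t" "{u, v} \<in> edges N'"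
    then have *: "u \<in> verts N'" "v \<in> verts N'" using nball_subset[of N' t] by (auto simp: subset_iff)
    then have "\<tau> u \<in> verts N" "\<tau> v \<in> verts N" using \<tau> by (auto dest: bij_betwE)
    from E[rule_format, OF this] uv(3) * show "{\<tau> u, \<tau> v} \<in> edges N" by (simp add: \<sigma>\<tau>)
  qed
  have im: "\<sigma> ` nball N t \<subseteq> verts N'" "\<tau> ` nball N' t \<subseteq> verts N"
    using bij_betwE[OF bij] bij_betwE[OF \<tau>] nball_subset[of N t] nball_subset[of N' t]
    by (auto simp: subset_iff)
  have 1: "\<sigma> v \<in> nball N' t" if "v \<in> nball N t" for v
  proof -
    from that obtain k where k: "real k \<le> t" "(root_vertex N, v) \<in> adj N ^^ k"
      unfolding nball_iff[OF N] by blast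
    from walk_transport[OF N r im(1) E1 k] k(1) show ?thesis
      unfolding nball_iff[OF N'] by blast
  qed
  have 2: "\<tau> v \<in> nball N t" if "v \<in> nball N' t" for v
  proof -
    from that obtain k where k: "real k \<le> t" "(root_vertex N', v) \<in> adj N' ^^ k"
      unfolding nball_iff[OF N'] by blast
    from walk_transport[OF N' r' im(2) E2 k] k(1) show ?thesis
      unfolding nball_iff[OF N] by blast
  qed
  show ?thesis
  proof (rule bij_betw_byWitness[where f' = \<tau>])
    show "\<forall>a\<in>nball N t. \<tau> (\<sigma> a) = a" "\<forall>a'\<in>nball N' t. \<sigma> (\<tau> a') = a'"
      using \<tau>\<sigma> \<sigma>\<tau> nball_subset[of N t] nball_subset[of N' t] by (auto simp: subset_iff)
  qed (use 1 2 in auto)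
qed

lemma network_iso_sym:
  assumes N': "is_network N'" and r: "root_vertex N \<in> verts N" and i: "network_iso N N'"
  shows "network_iso N' N"
proof -
  obtain \<sigma> where bij: "bij_betw \<sigma> (verts N) (verts N')" and s: "\<sigma> (root_vertex N) = root_vertex N'"
    and E: "\<forall>u\<in>verts N. \<forall>v\<in>verts N. {u, v} \<in> edges N \<longleftrightarrow> {\<sigma> u, \<sigma> v} \<in> edges N'"
    and V: "\<forall>v\<in>verts N. vmark N v = vmark N' (\<sigma> v)"
    and M: "\<forall>e\<in>edges N. emark N e = emark N' (\<sigma> ` e)"
    using i unfolding network_iso_def by blast
  define \<tau> where "\<tau> = inv_into (verts N) \<sigma>"
  have \<tau>: "bij_betw \<tau> (verts N') (verts N)"
    unfolding \<tau>_def by (rule bij_betw_inv_into[OF bij])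
  have \<tau>\<sigma>: "\<tau> (\<sigma> v) = v" if "v \<in> verts N" for v
    unfolding \<tau>_def using bij that by (rule bij_betw_inv_into_left)
  have \<sigma>\<tau>: "\<sigma> (\<tau> v) = v" if "v \<in> verts N'" for v
    unfolding \<tau>_def using bij that by (rule bij_betw_inv_into_right)
  have \<tau>v: "\<tau> v \<in> verts N" if "v \<in> verts N'" for v using \<tau> that by (auto dest: bij_betwE)
  show ?thesis unfolding network_iso_def
  proof (intro exI[of _ \<tau>] conjI ballI)
    show "bij_betw \<tau> (verts N') (verts N)" by fact
    show "\<tau> (root_vertex N') = root_vertex N" using \<tau>\<sigma>[OF r] s by simp
    show "{u, v} \<in> edges N' \<longleftrightarrow> {\<tau> u, \<tau> v} \<in> edges N" if "u \<in> verts N'" "v \<in> verts N'" for u v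
      using E[rule_format, OF \<tau>v[OF that(1)] \<tau>v[OF that(2)]] that by (simp add: \<sigma>\<tau>)
    show "vmark N' v = vmark N (\<tau> v)" if "v \<in> verts N'" for v
      using V[rule_format, OF \<tau>v[OF that]] that by (simp add: \<sigma>\<tau>)
    show "emark N' e = emark N (\<tau> ` e)" if e: "e \<in> edges N'" for e
    proof -
      obtain u v where uv: "e = {u, v}" "u \<in> verts N'" "v \<in> verts N'"
        using edge_cases[OF N' e] by metis
      then have "{\<tau> u, \<tau> v} \<in> edges N"
        using E[rule_format, OF \<tau>v[OF uv(2)] \<tau>v[OF uv(3)]] e by (simp add: \<sigma>\<tau>)
      with M have "emark N {\<tau> u, \<tau> v} = emark N' (\<sigma> ` {\<tau> u, \<tau> v})" by blast
      with uv show ?thesis by (simp add: \<sigma>\<tau>)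
    qed
  qed
qed

lemma network_iso_imp_ball_iso:
  assumes N: "clf_network N" and N': "clf_network N'" and i: "network_iso N N'" and \<epsilon>: "0 < \<epsilon>"
  shows "ball_iso t \<epsilon> N N'"
proof -
  obtain \<sigma> where bij: "bij_betw \<sigma> (verts N) (verts N')" and s: "\<sigma> (root_vertex N) = root_vertex N'"
    and E: "\<forall>u\<in>verts N. \<forall>v\<in>verts N. {u, v} \<in> edges N \<longleftrightarrow> {\<sigma> u, \<sigma> v} \<in> edges N'"
    and V: "\<forall>v\<in>verts N. vmark N v = vmark N' (\<sigma> v)"
    and M: "\<forall>e\<in>edges N. emark N e = emark N' (\<sigma> ` e)"
    using i unfolding network_iso_def by blast
  show ?thesis unfolding ball_iso_def
  proof (intro exI[of _ \<sigma>] conjI)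
    show "bij_betw \<sigma> (nball N t) (nball N' t)" by (rule network_iso_nball[OF N N' bij s E])
    show "\<forall>u\<in>nball N t. \<forall>v\<in>nball N t. {u, v} \<in> edges N \<longleftrightarrow> {\<sigma> u, \<sigma> v} \<in> edges N'"
      using E nball_subset[of N t] by (simp add: subset_iff)
    show "\<forall>v\<in>nball N t. ereal (vmark_dist (vmark N v) (vmark N' (\<sigma> v))) < \<epsilon>"
      using V[rule_format, OF subsetD[OF nball_subset]] \<epsilon> by (simp flip: zero_ereal_def)
    show "\<forall>e\<in>edges N. e \<subseteq> nball N t \<longrightarrow> ereal (dist (emark N e) (emark N' (\<sigma> ` e))) < \<epsilon>"
      using M[rule_format] \<epsilon> by (simp flip: zero_ereal_def)
  qed fact
qed

lemma ball_iso_trans: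
  assumes "ball_iso t \<epsilon> N1 N2" "ball_iso t \<delta> N2 N3" and N1: "is_network N1"
  shows "ball_iso t (\<epsilon> + \<delta>) N1 N3"
proof -
  obtain \<sigma> where bij: "bij_betw \<sigma> (nball N1 t) (nball N2 t)" and s: "\<sigma> (root_vertex N1) = root_vertex N2"
    and E: "\<forall>u\<in>nball N1 t. \<forall>v\<in>nball N1 t. {u, v} \<in> edges N1 \<longleftrightarrow> {\<sigma> u, \<sigma> v} \<in> edges N2"
    and V: "\<forall>v\<in>nball N1 t. ereal (vmark_dist (vmark N1 v) (vmark N2 (\<sigma> v))) < \<epsilon>"
    and M: "\<forall>e\<in>edges N1. e \<subseteq> nball N1 t \<longrightarrow> ereal (dist (emark N1 e) (emark N2 (\<sigma> ` e))) < \<epsilon>"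
    using assms(1) unfolding ball_iso_def by blast
  obtain \<tau> where bij': "bij_betw \<tau> (nball N2 t) (nball N3 t)" and s': "\<tau> (root_vertex N2) = root_vertex N3"
    and E': "\<forall>u\<in>nball N2 t. \<forall>v\<in>nball N2 t. {u, v} \<in> edges N2 \<longleftrightarrow> {\<tau> u, \<tau> v} \<in> edges N3"
    and V': "\<forall>v\<in>nball N2 t. ereal (vmark_dist (vmark N2 v) (vmark N3 (\<tau> v))) < \<delta>"
    and M': "\<forall>e\<in>edges N2. e \<subseteq> nball N2 t \<longrightarrow> ereal (dist (emark N2 e) (emark N3 (\<tau> ` e))) < \<delta>"
    using assms(2) unfolding ball_iso_def by blast
  have add: "ereal c < \<epsilon> + \<delta>" if "ereal a < \<epsilon>" "ereal b < \<delta>" "c \<le> a + b" for a b c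
  proof -
    have "ereal c \<le> ereal a + ereal b" using that by simp
    also have "\<dots> < \<epsilon> + \<delta>" using that(1,2) by (cases \<epsilon>; cases \<delta>) auto
    finally show ?thesis .
  qed
  have \<sigma>v: "\<sigma> v \<in> nball N2 t" if "v \<in> nball N1 t" for v using bij that by (auto dest: bij_betwE)
  show ?thesis unfolding ball_iso_def
  proof (intro exI[of _ "\<tau> \<circ> \<sigma>"] conjI ballI impI)
    show "bij_betw (\<tau> \<circ> \<sigma>) (nball N1 t) (nball N3 t)" by (rule bij_betw_trans[OF bij bij'])
    show "(\<tau> \<circ> \<sigma>) (root_vertex N1) = root_vertex N3" using s s' by simp
    show "{u, v} \<in> edges N1 \<longleftrightarrow> {(\<tau> \<circ> \<sigma>) u, (\<tau> \<circ> \<sigma>) v} \<in> edges N3"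
      if "u \<in> nball N1 t" "v \<in> nball N1 t" for u v
      using E E' \<sigma>v that by simp
    show "ereal (vmark_dist (vmark N1 v) (vmark N3 ((\<tau> \<circ> \<sigma>) v))) < \<epsilon> + \<delta>" if "v \<in> nball N1 t" for v
    proof (rule add)
      show "vmark_dist (vmark N1 v) (vmark N3 ((\<tau> \<circ> \<sigma>) v))
          \<le> vmark_dist (vmark N1 v) (vmark N2 (\<sigma> v)) + vmark_dist (vmark N2 (\<sigma> v)) (vmark N3 (\<tau> (\<sigma> v)))"
        unfolding comp_apply by (rule vmark_dist_triangle)
    qed (use V V' \<sigma>v that in auto)
    show "ereal (dist (emark N1 e) (emark N3 ((\<tau> \<circ> \<sigma>) ` e))) < \<epsilon> + \<delta>"
      if e: "e \<in> edges N1" "e \<subseteq> nball N1 t" for e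
    proof (rule add)
      obtain u v where uv: "e = {u, v}" using edge_cases[OF N1 e(1)] by metis
      with e E have "\<sigma> ` e \<in> edges N2" by auto
      moreover have "\<sigma> ` e \<subseteq> nball N2 t" using e(2) \<sigma>v by auto
      ultimately show "ereal (dist (emark N2 (\<sigma> ` e)) (emark N3 (\<tau> ` \<sigma> ` e))) < \<delta>"
        using M' by blast
      show "ereal (dist (emark N1 e) (emark N2 (\<sigma> ` e))) < \<epsilon>" using M e by blast
      show "dist (emark N1 e) (emark N3 ((\<tau> \<circ> \<sigma>) ` e))
          \<le> dist (emark N1 e) (emark N2 (\<sigma> ` e)) + dist (emark N2 (\<sigma> ` e)) (emark N3 (\<tau> ` \<sigma> ` e))"
        unfolding image_comp[symmetric] by (rule dist_triangle)
    qed
  qed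
qed

lemma ball_iso_sym:
  assumes i: "ball_iso t \<epsilon> N N'" and N: "clf_network N" and N': "is_network N'" and t: "0 \<le> t"
  shows "ball_iso t \<epsilon> N' N"
proof -
  obtain \<sigma> where bij: "bij_betw \<sigma> (nball N t) (nball N' t)" and s: "\<sigma> (root_vertex N) = root_vertex N'"
    and E: "\<forall>u\<in>nball N t. \<forall>v\<in>nball N t. {u, v} \<in> edges N \<longleftrightarrow> {\<sigma> u, \<sigma> v} \<in> edges N'"
    and V: "\<forall>v\<in>nball N t. ereal (vmark_dist (vmark N v) (vmark N' (\<sigma> v))) < \<epsilon>"
    and M: "\<forall>e\<in>edges N. e \<subseteq> nball N t \<longrightarrow> ereal (dist (emark N e) (emark N' (\<sigma> ` e))) < \<epsilon>"
    using i unfolding ball_iso_def by blast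
  define \<tau> where "\<tau> = inv_into (nball N t) \<sigma>"
  have \<tau>: "bij_betw \<tau> (nball N' t) (nball N t)"
    unfolding \<tau>_def by (rule bij_betw_inv_into[OF bij])
  have \<tau>\<sigma>: "\<tau> (\<sigma> v) = v" if "v \<in> nball N t" for v
    unfolding \<tau>_def using bij that by (rule bij_betw_inv_into_left)
  have \<sigma>\<tau>: "\<sigma> (\<tau> v) = v" if "v \<in> nball N' t" for v
    unfolding \<tau>_def using bij that by (rule bij_betw_inv_into_right)
  have \<tau>v: "\<tau> v \<in> nball N t" if "v \<in> nball N' t" for v using \<tau> that by (auto dest: bij_betwE)
  show ?thesis unfolding ball_iso_def
  proof (intro exI[of _ \<tau>] conjI ballI impI)
    show "bij_betw \<tau> (nball N' t) (nball N t)" by fact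
    show "\<tau> (root_vertex N') = root_vertex N" using \<tau>\<sigma>[OF root_in_nball[OF N t]] s by simp
    show "{u, v} \<in> edges N' \<longleftrightarrow> {\<tau> u, \<tau> v} \<in> edges N" if "u \<in> nball N' t" "v \<in> nball N' t" for u v
      using E[rule_format, OF \<tau>v[OF that(1)] \<tau>v[OF that(2)]] that by (simp add: \<sigma>\<tau>)
    show "ereal (vmark_dist (vmark N' v) (vmark N (\<tau> v))) < \<epsilon>" if "v \<in> nball N' t" for v
      using V[rule_format, OF \<tau>v[OF that]] that by (simp add: \<sigma>\<tau> vmark_dist_commute)
    show "ereal (dist (emark N' e) (emark N (\<tau> ` e))) < \<epsilon>" if e: "e \<in> edges N'" "e \<subseteq> nball N' t" for e
    proof -
      obtain u v where uv: "e = {u, v}" using edge_cases[OF N' e(1)] by metis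
      then have *: "u \<in> nball N' t" "v \<in> nball N' t" using e by auto
      then have "{\<tau> u, \<tau> v} \<in> edges N"
        using E[rule_format, OF \<tau>v[OF *(1)] \<tau>v[OF *(2)]] e(1) uv by (simp add: \<sigma>\<tau>)
      moreover have "{\<tau> u, \<tau> v} \<subseteq> nball N t" using \<tau>v * by auto
      ultimately have "ereal (dist (emark N {\<tau> u, \<tau> v}) (emark N' (\<sigma> ` {\<tau> u, \<tau> v}))) < \<epsilon>"
        using M by blast
      with uv * show ?thesis by (simp add: \<sigma>\<tau> dist_commute)
    qed
  qed
qed

lemma ball_iso_mono:
  assumes i: "ball_iso t \<epsilon> N N'" and N: "clf_network N" and N': "clf_network N'"
    and t: "0 \<le> t" and st: "s \<le> t" and \<epsilon>: "\<epsilon> \<le> \<delta>"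
  shows "ball_iso s \<delta> N N'"
proof -
  obtain \<sigma> where bij: "bij_betw \<sigma> (nball N t) (nball N' t)" and s: "\<sigma> (root_vertex N) = root_vertex N'"
    and E: "\<forall>u\<in>nball N t. \<forall>v\<in>nball N t. {u, v} \<in> edges N \<longleftrightarrow> {\<sigma> u, \<sigma> v} \<in> edges N'"
    and V: "\<forall>v\<in>nball N t. ereal (vmark_dist (vmark N v) (vmark N' (\<sigma> v))) < \<epsilon>"
    and M: "\<forall>e\<in>edges N. e \<subseteq> nball N t \<longrightarrow> ereal (dist (emark N e) (emark N' (\<sigma> ` e))) < \<epsilon>"
    using i unfolding ball_iso_def by blast
  have sub: "nball N s \<subseteq> nball N t" by (rule nball_mono[OF st])
  show ?thesis unfolding ball_iso_def
  proof (intro exI[of _ \<sigma>] conjI)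
    show "bij_betw \<sigma> (nball N s) (nball N' s)" by (rule local_iso_nball[OF N N' bij s E st t])
    show "\<forall>u\<in>nball N s. \<forall>v\<in>nball N s. {u, v} \<in> edges N \<longleftrightarrow> {\<sigma> u, \<sigma> v} \<in> edges N'"
      using E sub by blast
    show "\<forall>v\<in>nball N s. ereal (vmark_dist (vmark N v) (vmark N' (\<sigma> v))) < \<delta>"
      using V sub \<epsilon> by (meson order_less_le_trans subsetD)
    show "\<forall>e\<in>edges N. e \<subseteq> nball N s \<longrightarrow> ereal (dist (emark N e) (emark N' (\<sigma> ` e))) < \<delta>"
      using M sub \<epsilon> by (meson order_less_le_trans subset_trans)
  qed fact
qed

lemma ball_iso_cong:
  assumes "clf_network N" "clf_network N'" "clf_network M" "clf_network M'"
    and "network_iso N M" "network_iso N' M'" and "ball_iso t \<epsilon> N N'" and "0 \<le> t"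
  shows "ball_iso t \<epsilon> M M'"
proof -
  obtain \<sigma> where bij: "bij_betw \<sigma> (nball N t) (nball N' t)" and s: "\<sigma> (root_vertex N) = root_vertex N'"
    and E: "\<forall>u\<in>nball N t. \<forall>v\<in>nball N t. {u, v} \<in> edges N \<longleftrightarrow> {\<sigma> u, \<sigma> v} \<in> edges N'"
    and V: "\<forall>v\<in>nball N t. ereal (vmark_dist (vmark N v) (vmark N' (\<sigma> v))) < \<epsilon>"
    and M: "\<forall>e\<in>edges N. e \<subseteq> nball N t \<longrightarrow> ereal (dist (emark N e) (emark N' (\<sigma> ` e))) < \<epsilon>"
    using assms(7) unfolding ball_iso_def by blast
  define A where "A = (\<lambda>v. vmark_dist (vmark N v) (vmark N' (\<sigma> v))) ` nball N t
    \<union> (\<lambda>e. dist (emark N e) (emark N' (\<sigma> ` e))) ` {e \<in> edges N. e \<subseteq> nball N t}"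
  have "finite {e \<in> edges N. e \<subseteq> nball N t}"
    by (rule finite_subset[of _ "Pow (nball N t)"]) (auto simp: finite_nball[OF assms(1)])
  then have fin: "finite A" unfolding A_def by (simp add: finite_nball[OF assms(1)])
  have ne: "A \<noteq> {}" using root_in_nball[OF assms(1,8)] by (auto simp: A_def)
  have "ereal a < \<epsilon>" if "a \<in> A" for a using that V M unfolding A_def by blast
  then have "ereal (Max A) < \<epsilon>" using Max_in[OF fin ne] by blast
  then obtain c where c: "ereal (Max A) < ereal c" "ereal c < \<epsilon>"
    using ereal_dense2 by blast
  have lt: "ereal a < ereal c" if "a \<in> A" for a
    using Max_ge[OF fin that] c(1) by simp
  have 1: "ball_iso t (ereal c) N N'"
    unfolding ball_iso_def
  proof (intro exI[of _ \<sigma>] conjI)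
    show "\<forall>v\<in>nball N t. ereal (vmark_dist (vmark N v) (vmark N' (\<sigma> v))) < ereal c"
      by (intro ballI lt) (simp add: A_def)
    show "\<forall>e\<in>edges N. e \<subseteq> nball N t \<longrightarrow> ereal (dist (emark N e) (emark N' (\<sigma> ` e))) < ereal c"
      by (intro ballI impI lt) (simp add: A_def)
  qed fact+
  obtain \<eta> where \<eta>: "0 < \<eta>" "ereal (\<eta> + (c + \<eta>)) \<le> \<epsilon>"
  proof -
    obtain b where b: "c < b" "ereal b < \<epsilon>" using ereal_dense2[OF c(2)] by auto
    have "(b - c) / 2 + (c + (b - c) / 2) = b" by (simp add: field_simps)
    with b that[of "(b - c) / 2"] show ?thesis by (simp add: less_imp_le)
  qed
  have net: "is_network N" "is_network M" "root_vertex N \<in> verts N"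
    using assms(1,3) by (auto simp: clf_network_def)
  have pos: "0 < ereal \<eta>" using \<eta>(1) by simp
  have 2: "ball_iso t (ereal \<eta>) M N"
    by (rule network_iso_imp_ball_iso[OF assms(3,1) network_iso_sym[OF net(2,3) assms(5)] pos])
  have 3: "ball_iso t (ereal \<eta>) N' M'"
    by (rule network_iso_imp_ball_iso[OF assms(2,4,6) pos])
  have "ball_iso t (ereal \<eta> + (ereal c + ereal \<eta>)) M M'"
    by (rule ball_iso_trans[OF 2 ball_iso_trans[OF 1 3 net(1)] net(2)])
  then show ?thesis
    by (rule ball_iso_mono[OF _ assms(3,4,8) order_refl]) (use \<eta>(2) in simp)
qed

lemma agree_cong:
  assumes "clf_network N" "clf_network N'" "clf_network M" "clf_network M'"
    and "network_iso N M" "network_iso N' M'" and "agree t N N'" and "0 \<le> t"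
  shows "agree t M M'"
  using assms unfolding agree_def by (rule ball_iso_cong)

lemma network_iso_trans:
  assumes "network_iso N1 N2" "network_iso N2 N3" and N1: "is_network N1"
  shows "network_iso N1 N3"
proof -
  obtain \<sigma> where bij: "bij_betw \<sigma> (verts N1) (verts N2)" and s: "\<sigma> (root_vertex N1) = root_vertex N2"
    and E: "\<forall>u\<in>verts N1. \<forall>v\<in>verts N1. {u, v} \<in> edges N1 \<longleftrightarrow> {\<sigma> u, \<sigma> v} \<in> edges N2"
    and V: "\<forall>v\<in>verts N1. vmark N1 v = vmark N2 (\<sigma> v)"
    and M: "\<forall>e\<in>edges N1. emark N1 e = emark N2 (\<sigma> ` e)"
    using assms(1) unfolding network_iso_def by blast
  obtain \<tau> where bij': "bij_betw \<tau> (verts N2) (verts N3)" and s': "\<tau> (root_vertex N2) = root_vertex N3"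
    and E': "\<forall>u\<in>verts N2. \<forall>v\<in>verts N2. {u, v} \<in> edges N2 \<longleftrightarrow> {\<tau> u, \<tau> v} \<in> edges N3"
    and V': "\<forall>v\<in>verts N2. vmark N2 v = vmark N3 (\<tau> v)"
    and M': "\<forall>e\<in>edges N2. emark N2 e = emark N3 (\<tau> ` e)"
    using assms(2) unfolding network_iso_def by blast
  have \<sigma>v: "\<sigma> v \<in> verts N2" if "v \<in> verts N1" for v using bij that by (auto dest: bij_betwE)
  show ?thesis unfolding network_iso_def
  proof (intro exI[of _ "\<tau> \<circ> \<sigma>"] conjI ballI)
    show "bij_betw (\<tau> \<circ> \<sigma>) (verts N1) (verts N3)" by (rule bij_betw_trans[OF bij bij'])
    show "(\<tau> \<circ> \<sigma>) (root_vertex N1) = root_vertex N3" using s s' by simp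
    show "{u, v} \<in> edges N1 \<longleftrightarrow> {(\<tau> \<circ> \<sigma>) u, (\<tau> \<circ> \<sigma>) v} \<in> edges N3"
      if "u \<in> verts N1" "v \<in> verts N1" for u v
      using E E' \<sigma>v that by simp
    show "vmark N1 v = vmark N3 ((\<tau> \<circ> \<sigma>) v)" if "v \<in> verts N1" for v
      using V V' \<sigma>v that by simp
    show "emark N1 e = emark N3 ((\<tau> \<circ> \<sigma>) ` e)" if e: "e \<in> edges N1" for e
    proof -
      obtain u v where "e = {u, v}" "u \<in> verts N1" "v \<in> verts N1"
        using edge_cases[OF N1 e] by metis
      with e E have "\<sigma> ` e \<in> edges N2" by auto
      then show ?thesis using M M' e by (simp add: image_comp)
    qed
  qed
qed

lemma eq_if_dist_less:
  fixes a b :: "'c::metric_space" and q :: "nat \<Rightarrow> nat"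
  assumes ge: "\<And>k. k \<le> q k"
    and less: "\<And>k. m \<le> k \<Longrightarrow> ereal (dist a b) < 1 / ereal (real (q k))"
  shows "a = b"
proof (rule ccontr)
  assume "a \<noteq> b"
  then obtain n where n: "inverse (real (Suc n)) < dist a b"
    using reals_Archimedean[of "dist a b"] by auto
  define k where "k = max m (Suc n)"
  have k: "m \<le> k" "Suc n \<le> q k" using ge[of k] by (auto simp: k_def)
  then have "dist a b < 1 / real (q k)" using less[OF k(1)] by (simp add: one_ereal_def)
  also have "\<dots> \<le> inverse (real (Suc n))"
    using k(2) unfolding inverse_eq_divide by (intro divide_left_mono) auto
  finally show False using n by simp
qed

lemma eq_if_vmark_dist_less:
  assumes "\<And>k. k \<le> q k"
    and "\<And>k. m \<le> k \<Longrightarrow> ereal (vmark_dist a b) < 1 / ereal (real (q k))"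
  shows "a = b"
proof -
  have "(real (fst a), snd a) = (real (fst b), snd b)"
    by (rule eq_if_dist_less[OF assms(1)]) (rule assms(2)[unfolded vmark_dist_def])
  then show ?thesis by (simp add: prod_eq_iff)
qed

lemma ball_iso_all_imp_iso:
  assumes N: "clf_network N" and N': "clf_network N'"
    and all: "\<And>t. 0 \<le> t \<Longrightarrow> agree t N N'"
  shows "network_iso N N'"
proof -
  define G where "G k \<sigma> \<longleftrightarrow>
       bij_betw \<sigma> (nball N (real k)) (nball N' (real k)) \<and> \<sigma> (root_vertex N) = root_vertex N' \<and>
       (\<forall>u\<in>nball N (real k). \<forall>v\<in>nball N (real k). {u, v} \<in> edges N \<longleftrightarrow> {\<sigma> u, \<sigma> v} \<in> edges N') \<and>
       (\<forall>v\<in>nball N (real k). ereal (vmark_dist (vmark N v) (vmark N' (\<sigma> v))) < 1 / ereal (real k)) \<and>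
       (\<forall>e\<in>edges N. e \<subseteq> nball N (real k) \<longrightarrow>
          ereal (dist (emark N e) (emark N' (\<sigma> ` e))) < 1 / ereal (real k))" for k \<sigma>
  have "\<exists>\<sigma>. G k \<sigma>" for k
    using all[of "real k"] unfolding agree_def ball_iso_def G_def by simp
  then obtain \<sigma> where G: "\<And>k. G k (\<sigma> k)" by metis
  have bij: "bij_betw (\<sigma> k) (nball N (real k)) (nball N' (real k))" for k
    using G[of k] unfolding G_def by blast
  have r: "\<sigma> k (root_vertex N) = root_vertex N'" for k
    using G[of k] unfolding G_def by blast
  have E: "\<forall>u\<in>nball N (real k). \<forall>v\<in>nball N (real k).
        {u, v} \<in> edges N \<longleftrightarrow> {\<sigma> k u, \<sigma> k v} \<in> edges N'" for k
    using G[of k] unfolding G_def by blast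
  have V: "\<forall>v\<in>nball N (real k).
        ereal (vmark_dist (vmark N v) (vmark N' (\<sigma> k v))) < 1 / ereal (real k)" for k
    using G[of k] unfolding G_def by blast
  have M: "\<forall>e\<in>edges N. e \<subseteq> nball N (real k) \<longrightarrow>
        ereal (dist (emark N e) (emark N' (\<sigma> k ` e))) < 1 / ereal (real k)" for k
    using G[of k] unfolding G_def by blast
  have bij': "bij_betw (\<sigma> k) (nball N (real m)) (nball N' (real m))" if "m \<le> k" for m k
    by (rule local_iso_nball[OF N N' bij r E]) (use that in auto)
  \<comment> \<open>a diagonal subsequence along which the restriction to every ball is constant\<close>
  define Q where "Q m s \<longleftrightarrow> (\<exists>c. \<forall>k. \<forall>v\<in>nball N (real m). \<sigma> (s k) v = c v)"
    for m and s :: "nat \<Rightarrow> nat"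
  have ex: "\<exists>r'. strict_mono r' \<and> Q m (s \<circ> r')" if s: "strict_mono s" for m and s :: "nat \<Rightarrow> nat"
  proof -
    let ?f = "\<lambda>k. restrict (\<sigma> (s (k + m))) (nball N (real m))"
    have "?f k \<in> nball N (real m) \<rightarrow>\<^sub>E nball N' (real m)" for k
    proof -
      have "m \<le> s (k + m)" using strict_mono_imp_increasing[OF s, of "k + m"] by linarith
      from bij'[OF this] show ?thesis by (auto dest: bij_betwE)
    qed
    then have "range ?f \<subseteq> nball N (real m) \<rightarrow>\<^sub>E nball N' (real m)" by blast
    then have "finite (range ?f)"
      by (rule finite_subset) (intro finite_PiE finite_nball N N')
    then obtain k0 where inf: "infinite {k. ?f k = ?f k0}"
      using pigeonhole_infinite[of UNIV ?f] by auto
    define q where "q = enumerate {k. ?f k = ?f k0}"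
    have q: "strict_mono q" "\<And>k. ?f (q k) = ?f k0"
      using enumerate_in_set[OF inf] strict_mono_enumerate[OF inf] unfolding q_def by blast+
    have "strict_mono (\<lambda>k. q k + m)" using q(1) by (auto simp: strict_mono_def)
    moreover have "Q m (s \<circ> (\<lambda>k. q k + m))" unfolding Q_def
    proof (intro exI allI ballI)
      fix k v assume "v \<in> nball N (real m)"
      then show "\<sigma> ((s \<circ> (\<lambda>k. q k + m)) k) v = ?f k0 v"
        using fun_cong[OF q(2)[of k], of v] by simp
    qed
    ultimately show ?thesis by blast
  qed
  interpret subseqs Q
    by (standard, rule ex)
  have Qd: "\<exists>c. \<forall>k. \<forall>v\<in>nball N (real m). \<sigma> (diagseq (k + Suc m)) v = c v" for m
  proof -
    have "Q m (diagseq \<circ> (+) (Suc m))"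
      by (rule diagseq_holds) (auto simp: Q_def)
    then show ?thesis by (simp add: Q_def add.commute)
  qed
  then obtain c where c: "\<And>m k v. v \<in> nball N (real m) \<Longrightarrow> \<sigma> (diagseq (k + Suc m)) v = c m v"
    by metis
  define \<rho> where "\<rho> v = c (gdist N (root_vertex N) v) v" for v
  have \<rho>: "\<sigma> (diagseq k) v = \<rho> v" if v: "v \<in> nball N (real m)" and k: "Suc m \<le> k" for v m k
  proof -
    let ?g = "gdist N (root_vertex N) v"
    have "?g \<le> m" "v \<in> nball N (real ?g)" using v by (auto simp: nball_def)
    then show ?thesis using c[of v ?g "k - Suc ?g"] k by (simp add: \<rho>_def)
  qed
  have ge: "k \<le> diagseq k" for k by (rule strict_mono_imp_increasing[OF subseq_diagseq])
  have inb: "v \<in> nball N (real m)" if "v \<in> verts N" "gdist N (root_vertex N) v \<le> m" for v m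
    using that by (simp add: nball_def)
  have bij\<rho>: "bij_betw \<rho> (nball N (real m)) (nball N' (real m))" for m
  proof -
    have "bij_betw (\<sigma> (diagseq (Suc m))) (nball N (real m)) (nball N' (real m))"
      by (rule bij') (use ge[of "Suc m"] in simp)
    then show ?thesis using \<rho>[of _ m "Suc m"] by (subst (asm) bij_betw_cong) auto
  qed
  show ?thesis unfolding network_iso_def
  proof (intro exI[of _ \<rho>] conjI ballI)
    show "bij_betw \<rho> (verts N) (verts N')" unfolding bij_betw_def
    proof
      show "inj_on \<rho> (verts N)"
      proof (rule inj_onI)
        fix u v assume uv: "u \<in> verts N" "v \<in> verts N" "\<rho> u = \<rho> v"
        define m where "m = max (gdist N (root_vertex N) u) (gdist N (root_vertex N) v)"
        have "u \<in> nball N (real m)" by (rule inb[OF uv(1)]) (simp add: m_def)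
        moreover have "v \<in> nball N (real m)" by (rule inb[OF uv(2)]) (simp add: m_def)
        ultimately show "u = v" by (rule inj_onD[OF bij_betw_imp_inj_on[OF bij\<rho>] uv(3)])
      qed
      show "\<rho> ` verts N = verts N'"
      proof
        show "\<rho> ` verts N \<subseteq> verts N'"
        proof
          fix w assume "w \<in> \<rho> ` verts N"
          then obtain v where v: "v \<in> verts N" "w = \<rho> v" by blast
          have "v \<in> nball N (real (gdist N (root_vertex N) v))" by (rule inb[OF v(1) order_refl])
          with bij_betwE[OF bij\<rho>] have "\<rho> v \<in> nball N' (real (gdist N (root_vertex N) v))" by blast
          then show "w \<in> verts N'" unfolding v(2) by (rule subsetD[OF nball_subset])
        qed
        show "verts N' \<subseteq> \<rho> ` verts N"
        proof
          fix w assume "w \<in> verts N'"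
          then have "w \<in> nball N' (real (gdist N' (root_vertex N') w))" by (simp add: nball_def)
          then have "w \<in> \<rho> ` nball N (real (gdist N' (root_vertex N') w))"
            by (simp only: bij_betw_imp_surj_on[OF bij\<rho>])
          then show "w \<in> \<rho> ` verts N" by (rule subsetD[OF image_mono[OF nball_subset]])
        qed
      qed
    qed
    have "root_vertex N \<in> nball N (real 0)" by (rule root_in_nball[OF N]) simp
    from \<rho>[OF this order_refl] r show "\<rho> (root_vertex N) = root_vertex N'" by simp
    show "{u, v} \<in> edges N \<longleftrightarrow> {\<rho> u, \<rho> v} \<in> edges N'" if uv: "u \<in> verts N" "v \<in> verts N" for u v
    proof -
      define m where "m = max (gdist N (root_vertex N) u) (gdist N (root_vertex N) v)"
      have u: "u \<in> nball N (real m)" by (rule inb[OF uv(1)]) (simp add: m_def)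
      have v: "v \<in> nball N (real m)" by (rule inb[OF uv(2)]) (simp add: m_def)
      have "nball N (real m) \<subseteq> nball N (real (diagseq (Suc m)))"
        using ge[of "Suc m"] by (intro nball_mono) simp
      from E[rule_format, OF subsetD[OF this u] subsetD[OF this v]] show ?thesis
        by (simp only: \<rho>[OF u order_refl] \<rho>[OF v order_refl])
    qed
    show "vmark N v = vmark N' (\<rho> v)" if v: "v \<in> verts N" for v
    proof (rule eq_if_vmark_dist_less[OF ge])
      fix k assume k: "Suc (gdist N (root_vertex N) v) \<le> k"
      have "v \<in> nball N (real (gdist N (root_vertex N) v))" by (rule inb[OF v order_refl])
      from \<rho>[OF this k] have *: "\<sigma> (diagseq k) v = \<rho> v" .
      have "v \<in> nball N (real (diagseq k))" by (rule inb[OF v]) (use k ge[of k] in linarith)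
      from V[rule_format, OF this]
      show "ereal (vmark_dist (vmark N v) (vmark N' (\<rho> v))) < 1 / ereal (real (diagseq k))"
        unfolding * .
    qed
    show "emark N e = emark N' (\<rho> ` e)" if e: "e \<in> edges N" for e
    proof -
      obtain u v where uv: "e = {u, v}" "u \<in> verts N" "v \<in> verts N"
        using edge_cases[OF _ e] N unfolding clf_network_def by metis
      define m where "m = max (gdist N (root_vertex N) u) (gdist N (root_vertex N) v)"
      have "u \<in> nball N (real m)" by (rule inb[OF uv(2)]) (simp add: m_def)
      moreover have "v \<in> nball N (real m)" by (rule inb[OF uv(3)]) (simp add: m_def)
      ultimately have em: "e \<subseteq> nball N (real m)" unfolding uv(1) by simp
      show ?thesis
      proof (rule eq_if_dist_less[OF ge])
        fix k assume k: "Suc m \<le> k"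
        have *: "\<sigma> (diagseq k) ` e = \<rho> ` e" by (rule image_cong[OF refl \<rho>[OF subsetD[OF em] k]])
        have "e \<subseteq> nball N (real (diagseq k))"
          by (rule subset_trans[OF em nball_mono]) (use k ge[of k] in linarith)
        from M[rule_format, OF e this]
        show "ereal (dist (emark N e) (emark N' (\<rho> ` e))) < 1 / ereal (real (diagseq k))"
          unfolding * .
      qed
    qed
  qed
qed

subsection \<open>The metric space\<close>

lemma clf_iso_sym: "clf_network N \<Longrightarrow> clf_network N' \<Longrightarrow> network_iso N N' \<Longrightarrow> network_iso N' N"
  by (rule network_iso_sym) (auto simp: clf_network_def)

lemma clf_iso_trans:
  "clf_network N1 \<Longrightarrow> network_iso N1 N2 \<Longrightarrow> network_iso N2 N3 \<Longrightarrow> network_iso N1 N3"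
  by (rule network_iso_trans) (auto simp: clf_network_def)

lemma reps_obtain:
  obtains K :: "nat rooted_network"
  where "clf_network K" "reps x = {M. clf_network M \<and> network_iso K M}"
proof -
  obtain K :: "nat rooted_network" where K: "K \<in> {N. clf_network N}" "reps x = nat_reps K"
    using reps[of x] unfolding image_iff by blast
  show thesis by (rule that[of K]) (use K in \<open>auto simp: nat_reps_def\<close>)
qed

lemma reps_clf: "N \<in> reps x \<Longrightarrow> clf_network N"
  by (rule reps_obtain[of x]) auto

lemma reps_iso:
  assumes "N \<in> reps x" "N' \<in> reps x" shows "network_iso N N'"
proof -
  obtain K :: "nat rooted_network"
    where K: "clf_network K" "reps x = {M. clf_network M \<and> network_iso K M}"
    by (rule reps_obtain)
  with assms have c: "clf_network N" "network_iso K N" "network_iso K N'" by auto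
  have "network_iso N K" using K(1) c(1,2) by (rule clf_iso_sym)
  from clf_iso_trans[OF c(1) this c(3)] show ?thesis .
qed

lemma reps_ex: "\<exists>N. N \<in> reps x"
  by (rule reps_obtain[of x]) (auto intro: network_iso_refl)

lemma reps_eq:
  assumes N: "N \<in> reps x" "N' \<in> reps y" "network_iso N N'" shows "x = y"
proof -
  have reps_mem: "reps z = {K. clf_network K \<and> network_iso M K}" if M: "M \<in> reps z" for z M
  proof -
    obtain K :: "nat rooted_network"
    where K: "clf_network K" "reps z = {M. clf_network M \<and> network_iso K M}"
      by (rule reps_obtain)
    with M have c: "clf_network M" "network_iso K M" by auto
    have "network_iso M K" using K(1) c by (rule clf_iso_sym)
    with K c show ?thesis using clf_iso_trans[of K M] clf_iso_trans[of M K] by blast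
  qed
  note c = N(1,2)[THEN reps_clf]
  have "network_iso N' N" using c N(3) by (rule clf_iso_sym)
  with c N(3) have "reps x = reps y"
    unfolding reps_mem[OF N(1)] reps_mem[OF N(2)]
    using clf_iso_trans[of N N'] clf_iso_trans[of N' N] by blast
  then show ?thesis by (simp add: reps_inject)
qed

definition cagree :: "real \<Rightarrow> gstar \<Rightarrow> gstar \<Rightarrow> bool" where
  "cagree t x y \<longleftrightarrow> (\<exists>N\<in>reps x. \<exists>N'\<in>reps y. agree t N N')"

lemma cagree_iff:
  assumes "N \<in> reps x" "N' \<in> reps y" "0 \<le> t"
  shows "cagree t x y \<longleftrightarrow> agree t N N'"
  using assms agree_cong reps_clf reps_iso unfolding cagree_def by metis

lemma cagree_sym: "0 \<le> t \<Longrightarrow> cagree t x y \<Longrightarrow> cagree t y x"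
  unfolding cagree_def agree_def by (meson ball_iso_sym reps_clf clf_network_def)

lemma one_div_ereal_mono: "0 \<le> s \<Longrightarrow> s \<le> t \<Longrightarrow> 1 / ereal t \<le> 1 / ereal s"
  by (auto simp: one_ereal_def frac_le divide_ereal_def)

lemma cagree_mono: "0 \<le> s \<Longrightarrow> s \<le> t \<Longrightarrow> cagree t x y \<Longrightarrow> cagree s x y"
  unfolding cagree_def agree_def
  by (meson ball_iso_mono reps_clf one_div_ereal_mono order_trans)

lemma cagree_0: "cagree 0 x y"
proof -
  obtain N N' where N: "N \<in> reps x" "N' \<in> reps y" using reps_ex by metis
  have b: "nball M 0 = {root_vertex M}" if "clf_network M" for M :: "nat rooted_network"
    using that by (auto simp: nball_iff)
  have noloop: "{u} \<notin> edges M" if "clf_network M" for M :: "nat rooted_network" and u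
    using that by (auto simp: clf_network_def is_network_def doubleton_eq_iff subset_iff)
  have "agree 0 N N'" unfolding agree_def ball_iso_def
    using N[THEN reps_clf]
    by (intro exI[of _ "\<lambda>_. root_vertex N'"]) (auto simp: b noloop bij_betw_def divide_ereal_def)
  with N show ?thesis unfolding cagree_def by blast
qed

lemma cagree_trans:
  assumes "0 < s" "0 < t" "cagree s x y" "cagree t y z"
  shows "cagree (s * t / (s + t)) x z"
proof -
  define h where "h = s * t / (s + t)"
  have h: "0 < h" "h \<le> s" "h \<le> t" "1 / h = 1 / s + 1 / t"
    using assms(1,2) by (auto simp: h_def field_simps)
  obtain N1 N2 N3 where N: "N1 \<in> reps x" "N2 \<in> reps y" "N3 \<in> reps z" using reps_ex by metis
  note c = N[THEN reps_clf]
  have "ball_iso s (1 / ereal s) N1 N2" "ball_iso t (1 / ereal t) N2 N3"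
    using assms N by (auto simp: cagree_iff agree_def)
  then have "ball_iso h (1 / ereal s) N1 N2" "ball_iso h (1 / ereal t) N2 N3"
    using c h assms by (auto intro: ball_iso_mono)
  then have "ball_iso h (1 / ereal s + 1 / ereal t) N1 N3"
    using c by (auto intro: ball_iso_trans simp: clf_network_def)
  also have "1 / ereal s + 1 / ereal t = 1 / ereal h"
    using h assms(1,2) by (simp add: one_ereal_def)
  finally show ?thesis using N unfolding h_def[symmetric] cagree_def agree_def by blast
qed

instantiation gstar :: metric_space
begin

definition dist_gstar :: "gstar \<Rightarrow> gstar \<Rightarrow> real" where
  "dist_gstar x y = real_of_ereal (1 / (1 + agree_radius x y))"

definition uniformity_gstar :: "(gstar \<times> gstar) filter" where
  "uniformity_gstar = (INF \<epsilon>\<in>{0 <..}. principal {(x, y). dist x y < \<epsilon>})"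

definition open_gstar :: "gstar set \<Rightarrow> bool" where
  "open_gstar U \<longleftrightarrow> (\<forall>x\<in>U. \<forall>\<^sub>F (x', y) in uniformity. x' = x \<longrightarrow> y \<in> U)"

instance
proof
  have R: "agree_radius x y = (SUP t\<in>{t. 0 \<le> t \<and> cagree t x y}. ereal t)" for x y
    by (simp add: agree_radius_def cagree_def)
  have R0: "0 \<le> agree_radius x y" for x y
    unfolding R by (rule SUP_upper2[of 0]) (auto simp: cagree_0)
  have cases_R: "(agree_radius x y = \<infinity> \<and> dist x y = 0) \<or>
      (\<exists>r\<ge>0. agree_radius x y = ereal r \<and> dist x y = 1 / (1 + r))" for x y :: gstar
    using R0[of x y] by (cases "agree_radius x y") (auto simp: dist_gstar_def one_ereal_def)
  have nonneg: "0 \<le> dist x y" and le1: "dist x y \<le> 1" for x y :: gstar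
    using cases_R[of x y] by auto
  have le: "dist x y \<le> 1 / (1 + t)" if "0 \<le> t" "cagree t x y" for x y :: gstar and t
  proof -
    have "ereal t \<le> agree_radius x y" unfolding R using that by (intro SUP_upper) auto
    then show ?thesis using cases_R[of x y] that(1) by (auto simp: frac_le)
  qed
  have less: "\<exists>t>0. cagree t x y \<and> 1 / (1 + t) < c" if c: "dist x y < c" "c \<le> 1" for x y :: gstar and c
  proof -
    have c0: "0 < c" using c nonneg[of x y] by linarith
    have "ereal (1 / c - 1) < agree_radius x y"
      using cases_R[of x y] c c0 by (auto simp: field_simps)
    then obtain t where t: "0 \<le> t" "cagree t x y" "1 / c - 1 < t"
      unfolding R less_SUP_iff by auto
    have "0 < t" using t(3) c c0 by (smt (verit) le_divide_eq_1_pos)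
    moreover have "1 / (1 + t) < c" using t c0 by (simp add: field_simps)
    ultimately show ?thesis using t by blast
  qed
  have sym: "dist x y = dist y x" for x y :: gstar
  proof -
    have "{t. 0 \<le> t \<and> cagree t x y} = {t. 0 \<le> t \<and> cagree t y x}" using cagree_sym by blast
    then show ?thesis by (simp add: dist_gstar_def R)
  qed
  have tri: "dist x z \<le> dist x y + dist y z" for x y z :: gstar
  proof (rule field_le_epsilon)
    fix e :: real assume e: "0 < e"
    define a where "a = dist x y + e / 2"
    define b where "b = dist y z + e / 2"
    have ab: "dist x y < a" "dist y z < b" "0 < a" "0 < b" using e nonneg[of x y] nonneg[of y z]
      unfolding a_def b_def by linarith+
    show "dist x z \<le> dist x y + dist y z + e"
    proof (cases "a \<le> 1 \<and> b \<le> 1")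
      case False
      then have "dist x z \<le> a + b" using le1[of x z] ab by linarith
      then show ?thesis by (simp add: a_def b_def)
    next
      case True
      then obtain s t where st: "0 < s" "cagree s x y" "1 / (1 + s) < a"
          "0 < t" "cagree t y z" "1 / (1 + t) < b"
        using less ab by meson
      have "dist x z \<le> 1 / (1 + s * t / (s + t))"
        using st by (intro le cagree_trans) auto
      also have "\<dots> \<le> 1 / (1 + s) + 1 / (1 + t)"
      proof -
        have p: "0 < s * t" "0 < s + t" "0 < s + t + s * t" using st by (auto intro: add_pos_pos)
        have "1 / (1 + s * t / (s + t)) = (s + t) / (s + t + s * t)"
          using p by (simp add: field_simps)
        also have "\<dots> = s / (s + t + s * t) + t / (s + t + s * t)" by (simp add: add_divide_distrib)
        also have "s / (s + t + s * t) \<le> 1 / (1 + t)" using st p by (simp add: field_simps)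
        also have "t / (s + t + s * t) \<le> 1 / (1 + s)" using st p by (simp add: field_simps)
        finally show ?thesis by linarith
      qed
      also have "\<dots> \<le> a + b" using st by linarith
      finally show ?thesis by (simp add: a_def b_def)
    qed
  qed
  show "dist x y = 0 \<longleftrightarrow> x = y" for x y :: gstar
  proof
    assume "dist x y = 0"
    then have inf: "agree_radius x y = \<infinity>" using cases_R[of x y] by auto
    obtain N N' where N: "N \<in> reps x" "N' \<in> reps y" using reps_ex by metis
    have "agree t N N'" if "0 \<le> t" for t
    proof -
      have "ereal t < agree_radius x y" using inf by simp
      then obtain t' where "0 \<le> t'" "cagree t' x y" "t < t'" unfolding R less_SUP_iff by auto
      then show ?thesis using cagree_mono[of t t' x y] that cagree_iff[OF N] by auto
    qed
    then have "network_iso N N'" using N by (intro ball_iso_all_imp_iso reps_clf)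
    with N show "x = y" by (rule reps_eq)
  next
    assume "x = y"
    obtain N where N: "N \<in> reps x" using reps_ex by metis
    have c: "cagree t x x" if "0 \<le> t" for t
      unfolding cagree_def agree_def using that
      by (intro bexI[OF _ N] network_iso_imp_ball_iso reps_clf[OF N] network_iso_refl)
        (auto simp: one_ereal_def divide_ereal_def)
    have "dist x x \<le> e" if "0 < e" for e
    proof -
      have "dist x x \<le> 1 / (1 + 1 / e)" using that by (intro le c) auto
      also have "\<dots> \<le> e" using that by (simp add: field_simps)
      finally show ?thesis .
    qed
    then have "dist x x \<le> 0" by (rule dense_ge)
    with nonneg[of x x] \<open>x = y\<close> show "dist x y = 0" by simp
  qed
  show "dist x y \<le> dist x z + dist y z" for x y z :: gstar
    using tri[of x y z] sym[of y z] tri[of x z y] by simp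
qed (simp_all add: uniformity_gstar_def open_gstar_def)

end


section \<open>Weak convergence\<close>

definition borel_prob :: "'a::topological_space measure set" where
  "borel_prob = {\<mu>. prob_space \<mu> \<and> sets \<mu> = sets borel}"

text \<open>
  Convergence in the space of Borel probability measures, so in particular the limit and
  all but finitely many terms are required to be Borel probability measures.
\<close>

definition weakly_converges :: "(nat \<Rightarrow> 'a::topological_space measure) \<Rightarrow> 'a measure \<Rightarrow> bool" where
  "weakly_converges \<mu> \<nu> \<longleftrightarrow>
     \<nu> \<in> borel_prob \<and> (\<forall>\<^sub>F n in sequentially. \<mu> n \<in> borel_prob) \<and>
     (\<forall>f :: 'a \<Rightarrow> real. continuous_on UNIV f \<and> bounded (range f) \<longrightarrow>
        (\<lambda>n. integral\<^sup>L (\<mu> n) f) \<longlonglongrightarrow> integral\<^sup>L \<nu> f)"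


section \<open>The finite model\<close>

definition pairs :: "nat \<Rightarrow> nat set set" where
  "pairs n = {{i, j} | i j. i \<in> {1..n} \<and> j \<in> {1..n} \<and> i \<noteq> j}"

text \<open>The library parametrises the exponential distribution by its rate, so mean \<open>n\<close> is rate \<open>1 / n\<close>.\<close>

definition cost_law :: "nat \<Rightarrow> (nat set \<Rightarrow> real) measure" where
  "cost_law n =
     PiM (pairs n) (\<lambda>_. density lborel (\<lambda>x. ennreal (exponential_density (1 / real n) x)))"

text \<open>List positions start at 0, so position \<open>d i\<close> holds the \<open>(d i + 1)\<close>-st smallest value;
  ties, a null event, are counted with multiplicity.\<close>

definition threshold :: "nat \<Rightarrow> (nat \<Rightarrow> nat) \<Rightarrow> (nat set \<Rightarrow> real) \<Rightarrow> nat \<Rightarrow> real" where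
  "threshold n d C i = sort (map (\<lambda>j. C {i, j}) (filter (\<lambda>j. j \<noteq> i) [1..<Suc n])) ! d i"

definition potential_nbrs :: "nat \<Rightarrow> (nat \<Rightarrow> nat) \<Rightarrow> (nat set \<Rightarrow> real) \<Rightarrow> nat \<Rightarrow> nat set" where
  "potential_nbrs n d C i = {j \<in> {1..n}. j \<noteq> i \<and> C {i, j} < threshold n d C i}"

definition finite_model :: "nat \<Rightarrow> (nat \<Rightarrow> nat) \<Rightarrow> (nat set \<Rightarrow> real) \<Rightarrow> nat network" where
  "finite_model n d C =
     \<lparr>verts = {1..n},
      edges = {{i, j} | i j. i \<in> {1..n} \<and> j \<in> {1..n} \<and>
                 i \<in> potential_nbrs n d C j \<and> j \<in> potential_nbrs n d C i},
      vmark = (\<lambda>i. (d i, threshold n d C i)),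
      emark = C\<rparr>"

text \<open>\<open>U_measure n N\<close> is the law of the component of a uniform vertex of the network \<open>N\<close> on \<open>{1..n}\<close>.\<close>

definition U_measure :: "nat \<Rightarrow> nat network \<Rightarrow> gstar measure" where
  "U_measure n N = distr (measure_pmf (pmf_of_set {1..n})) borel (\<lambda>i. gclass (component N i))"

text \<open>The measure \<open>A \<mapsto> E[U(N\<^sub>n)(A)]\<close>; this is what the monadic bind of measures computes.\<close>

definition expected_U :: "nat \<Rightarrow> (nat \<Rightarrow> nat) \<Rightarrow> gstar measure" where
  "expected_U n d = cost_law n \<bind> (\<lambda>C. U_measure n (finite_model n d C))"

definition empirical :: "nat \<Rightarrow> (nat \<Rightarrow> nat) \<Rightarrow> nat pmf" where
  "empirical n d = map_pmf d (pmf_of_set {1..n})"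


section \<open>The Erlang weighted tree\<close>

text \<open>The library's \<open>erlang_density k 1\<close> is the density of \<open>Erlang(k + 1)\<close>.\<close>

definition Erlang :: "nat \<Rightarrow> real measure" where
  "Erlang k = density lborel (\<lambda>x. ennreal (erlang_density (k - 1) 1 x))"

definition indices :: "nat list set" where
  "indices = {i. 0 \<notin> set i}"

type_synonym node_data = "nat \<times> real \<times> (nat \<Rightarrow> real)"

definition node_space :: "node_data measure" where
  "node_space = count_space UNIV \<Otimes>\<^sub>M borel \<Otimes>\<^sub>M PiM UNIV (\<lambda>_. borel)"

text \<open>
  The data of a node \<open>i\<close>: the number \<open>n\<^sub>i\<close> with law \<open>Q\<close>, then \<open>v\<^sub>i\<close>, then the costs \<open>z j\<close>
  of the edges to the children \<open>(i, j)\<close> for \<open>j\<close> in \<open>{1..n\<^sub>i}\<close>.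
  On the null event \<open>v \<le> 0\<close> the library's uniform measure on \<open>{0..v}\<close> is the zero measure.
\<close>

definition node_law :: "nat pmf \<Rightarrow> node_data measure" where
  "node_law Q =
     measure_pmf Q \<bind> (\<lambda>n.
     Erlang (n + 1) \<bind> (\<lambda>v.
     distr (PiM {1..n} (\<lambda>_. uniform_measure lborel {0..v})) node_space (\<lambda>z. (n, v, z))))"

text \<open>For \<open>P\<close> with \<open>P(0) = 0\<close>, \<open>map_pmf (\<lambda>k. k - 1) P\<close> has mass \<open>P(k + 1)\<close> at \<open>k\<close>.\<close>

definition ewt_data_law :: "nat pmf \<Rightarrow> (nat list \<Rightarrow> node_data) measure" where
  "ewt_data_law P =
     PiM indices (\<lambda>i. if i = [] then node_law P else node_law (map_pmf (\<lambda>k. k - 1) P))"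

definition ewt_n :: "(nat list \<Rightarrow> node_data) \<Rightarrow> nat list \<Rightarrow> nat" where
  "ewt_n \<omega> i = fst (\<omega> i)"

definition ewt_v :: "(nat list \<Rightarrow> node_data) \<Rightarrow> nat list \<Rightarrow> real" where
  "ewt_v \<omega> i = fst (snd (\<omega> i))"

definition ewt_cost :: "(nat list \<Rightarrow> node_data) \<Rightarrow> nat list \<Rightarrow> nat \<Rightarrow> real" where
  "ewt_cost \<omega> i j = snd (snd (\<omega> i)) j"

definition ewt_graph :: "(nat list \<Rightarrow> node_data) \<Rightarrow> nat list network" where
  "ewt_graph \<omega> =
     \<lparr>verts = indices,
      edges = {{i, i @ [j]} | i j. i \<in> indices \<and> j \<in> {1..ewt_n \<omega> i}},
      vmark = (\<lambda>i. (if i = [] then ewt_n \<omega> i else ewt_n \<omega> i + 1, ewt_v \<omega> i)),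
      emark = (\<lambda>e. THE x. \<exists>i j. e = {i, i @ [j]} \<and> x = ewt_cost \<omega> i j)\<rparr>"

definition backbone :: "(nat list \<Rightarrow> node_data) \<Rightarrow> nat list rooted_network" where
  "backbone \<omega> = component (ewt_graph \<omega>) []"

definition thinned_backbone :: "(nat list \<Rightarrow> node_data) \<Rightarrow> nat list rooted_network" where
  "thinned_backbone \<omega> = (backbone \<omega>)
     \<lparr>edges := {{i, i @ [j]} | i j.
        {i, i @ [j]} \<in> edges (backbone \<omega>) \<and> ewt_cost \<omega> i j < ewt_v \<omega> (i @ [j])}\<rparr>"

definition ewt :: "(nat list \<Rightarrow> node_data) \<Rightarrow> nat list rooted_network" where
  "ewt \<omega> = component (thinned_backbone \<omega>) []"

definition Er :: "nat pmf \<Rightarrow> gstar measure" where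
  "Er P = distr (ewt_data_law P) borel (\<lambda>\<omega>. gclass (ewt \<omega>))"

end

theory Submission
  imports Defs
begin

text \<open>
  Explore the finite model from its root, vertex by vertex, looking at each vertex \<open>w\<close> only at the costs
  to vertices other than its parent: its children are the vertices with the \<open>d\<^sub>w - 1\<close> smallest of them
  (\<open>d\<^sub>w\<close> at the root) and the next smallest cost \<open>v\<^sub>w\<close> is its threshold. The edge to the parent belongs to
  the network iff its cost is less than \<open>v\<^sub>w\<close>, which is exactly the rule that thins the backbone tree.

  Fix a tree shape with \<open>m\<^sub>w\<close> children at \<open>w\<close> and an injective labelling by vertices of the right degrees.
  The marks of this exploration have a density, which for every \<open>n\<close> is at least \<open>n\<close> to the minus number of
  edges times the product of \<open>exp (- v\<^sub>w)\<close> over the explored \<open>w\<close>, on the set where all child costs lie below the thresholds.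
  The proportion of labellings tends to the product of the \<open>P\<close>-masses of the degrees, and orderings of the children
  account for a factor \<open>1/m\<^sub>w!\<close>. The limit of these lower bounds is precisely the law of the tree data.
  As the latter has total mass one, lower bounds suffice: applied to \<open>f\<close> and \<open>B - f\<close> for Lipschitz \<open>0 \<le> f \<le> B\<close>
  they give convergence of expectations, with no upper bound on any probability in the finite model.
\<close>

section \<open>Measurability and weak convergence on the space of networks\<close>

text \<open>A threshold depends on all edges at its vertex, so the exact finite law of an
  exploration is unwieldy. Demanding that every unrevealed edge exceed the sum of the thresholds at
  its explored ends gives a bound that still factorises over the nodes. Labellings are injective
  even on the vertices realising thresholds: coincidences, short cycles and ties are simply left out
  of the lower bound. The same costs are met once for each ordering of the children; the weights
  bring the total over all explorations from one root down to at most 1, and this turns a sum of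
  separate estimates into a bound for the integral of \<open>f\<close>. Radius \<open>t\<close>
  requires \<open>t + 2\<close> explored generations, because an edge between levels
  \<open>t\<close> and \<open>t + 1\<close> survives or not according to the threshold at level
  \<open>t + 1\<close>. A node whose edge to the parent is thinned may have a true threshold
  different from the explored one; this is harmless, as it is then not adjacent to its parent.
  Tightness comes from the limit alone: finitely many shapes carry almost all its mass.\<close>

lemma ex_nat_representative:
  fixes N :: "'a::countable rooted_network"
  assumes N: "clf_network N"
  shows "\<exists>K :: nat rooted_network. clf_network K \<and> network_iso N K"
proof -
  define K :: "nat rooted_network" where
    "K = \<lparr>verts = to_nat ` verts N, edges = (`) to_nat ` edges N,
      vmark = (\<lambda>x. vmark N (from_nat x)), emark = (\<lambda>e. emark N (from_nat ` e)),
      root_vertex = to_nat (root_vertex N)\<rparr>"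
  have inj: "inj (to_nat :: 'a \<Rightarrow> nat)" by simp
  have [simp]: "(to_nat ` e = to_nat ` e') = (e = e')" for e e' :: "'a set"
    by (rule inj_image_eq_iff[OF inj])
  have im: "{to_nat u, to_nat v} = to_nat ` {u, v}" for u v :: 'a by simp
  have adjK: "(to_nat u, to_nat v) \<in> adj K \<longleftrightarrow> (u, v) \<in> adj N" for u v
    unfolding adj_def K_def by (auto simp: im simp del: image_insert image_empty)
  have adjK': "\<exists>v. x = to_nat v \<and> (u, v) \<in> adj N" if "(to_nat u, x) \<in> adj K" for u x
  proof -
    from that have "x \<in> verts K" by (auto simp: adj_def)
    then obtain v :: 'a where "x = to_nat v" by (auto simp: K_def)
    with that adjK show ?thesis by blast
  qed
  have net: "is_network N" and r: "root_vertex N \<in> verts N" and con: "connected_network N"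
    and lf: "locally_finite N" using N by (auto simp: clf_network_def)
  have walk: "(u, v) \<in> (adj N)\<^sup>* \<Longrightarrow> (to_nat u, to_nat v) \<in> (adj K)\<^sup>*" for u v
    by (induction rule: rtrancl_induct) (auto intro: rtrancl_into_rtrancl simp: adjK)
  have "is_network K" unfolding is_network_def
  proof (intro conjI ballI)
    show "edges K \<subseteq> {{u, v} |u v. u \<in> verts K \<and> v \<in> verts K \<and> u \<noteq> v}"
    proof
      fix e assume "e \<in> edges K"
      then obtain e' where e': "e' \<in> edges N" "e = to_nat ` e'" by (auto simp: K_def)
      from edge_cases[OF net e'(1)] obtain u v where
        "e' = {u, v}" "u \<in> verts N" "v \<in> verts N" "u \<noteq> v" by metis
      then show "e \<in> {{u, v} |u v. u \<in> verts K \<and> v \<in> verts K \<and> u \<noteq> v}"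
        using e'(2) by (intro CollectI exI[of _ "to_nat u"] exI[of _ "to_nat v"]) (auto simp: K_def)
    qed
  qed (use net in \<open>auto simp: is_network_def K_def image_image\<close>)
  moreover have "connected_network K"
    using con walk by (auto simp: connected_network_def K_def)
  moreover have "locally_finite K" unfolding locally_finite_def
  proof
    fix x assume "x \<in> verts K"
    then obtain v where v: "v \<in> verts N" "x = to_nat v" by (auto simp: K_def)
    have "{u. (x, u) \<in> adj K} \<subseteq> to_nat ` {u. (v, u) \<in> adj N}" using adjK' v(2) by blast
    moreover have "finite (to_nat ` {u. (v, u) \<in> adj N})"
      using lf v(1) by (auto simp: locally_finite_def)
    ultimately show "finite {u. (x, u) \<in> adj K}" by (rule finite_subset)
  qed
  moreover have "network_iso N K" unfolding network_iso_def
    by (rule exI[of _ to_nat])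
      (auto simp: K_def bij_betw_def inj_on_def im image_image simp del: image_insert image_empty)
  ultimately show ?thesis using r unfolding clf_network_def by (auto simp: K_def)
qed

text \<open>\<open>Abs_gstar\<close> can be inverted only on the carrier of the typedef. The copy of
  \<open>N\<close> on natural numbers shows that \<open>nat_reps N\<close> belongs to it, because
  isomorphic networks have the same set of representatives.\<close>

lemma reps_gclass:
  fixes N :: "'a::countable rooted_network"
  assumes N: "clf_network N"
  shows "reps (gclass N) = nat_reps N"
proof -
  obtain K :: "nat rooted_network" where K: "clf_network K" "network_iso N K"
    using ex_nat_representative[OF N] by blast
  have "nat_reps N = nat_reps K"
    unfolding nat_reps_def
    using N K clf_iso_trans[OF N K(2)] clf_iso_trans[OF K(1) clf_iso_sym[OF N K]] by blast
  then have "nat_reps N \<in> nat_reps ` {N :: nat rooted_network. clf_network N}" using K(1) by blast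
  then show ?thesis unfolding gclass_def by (rule Abs_gstar_inverse)
qed

text \<open>Every distance estimate below passes through this lemma: it suffices to exhibit one
  isomorphism of balls, possibly between networks on different vertex types.\<close>

lemma dist_gclass_le:
  fixes N :: "'a::countable rooted_network" and N' :: "'b::countable rooted_network"
  assumes N: "clf_network N" "clf_network N'" and a: "agree t N N'" and t: "0 \<le> t"
  shows "dist (gclass N) (gclass N') \<le> 1 / (1 + t)"
proof -
  obtain K where K: "K \<in> reps (gclass N)" using reps_ex by blast
  obtain K' where K': "K' \<in> reps (gclass N')" using reps_ex by blast
  have k: "clf_network K" "network_iso N K" "clf_network K'" "network_iso N' K'"
    using K K' N by (auto simp: reps_gclass nat_reps_def)
  have "agree t K K'" by (rule agree_cong[OF N k(1,3,2,4) a t])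
  then have "ereal t \<le> agree_radius (gclass N) (gclass N')"
    unfolding agree_radius_def using K K' t by (intro SUP_upper) auto
  then show ?thesis using t
    by (cases "agree_radius (gclass N) (gclass N')")
      (auto simp: dist_gstar_def one_ereal_def frac_le)
qed

text \<open>Walks lift in both directions, so it suffices to match neighbourhoods.\<close>

lemma agree_local:
  assumes N: "clf_network N" "clf_network N'" and t: "0 \<le> t"
    and r: "\<sigma> (root_vertex N) = root_vertex N'"
    and inj: "inj_on \<sigma> Y" and Y: "nball N t \<subseteq> Y"
    and Yn: "\<And>w x. w \<in> nball N t \<Longrightarrow> (w, x) \<in> adj N \<Longrightarrow> x \<in> Y"
    and nb: "\<And>w. w \<in> nball N t \<Longrightarrow> \<sigma> w \<in> verts N' \<Longrightarrow>
      {x'. (\<sigma> w, x') \<in> adj N'} = \<sigma> ` {x. (w, x) \<in> adj N}"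
    and vm: "\<And>w. w \<in> nball N t \<Longrightarrow> \<sigma> w \<in> verts N' \<Longrightarrow> vmark N' (\<sigma> w) = vmark N w"
    and em: "\<And>w x. w \<in> nball N t \<Longrightarrow> (w, x) \<in> adj N \<Longrightarrow> emark N' {\<sigma> w, \<sigma> x} = emark N {w, x}"
  shows "agree t N N'"
proof -
  have r': "root_vertex N' \<in> verts N'" and rN: "root_vertex N \<in> verts N"
    using N by (auto simp: clf_network_def)
  have up: "real k \<le> t \<Longrightarrow> (root_vertex N, v) \<in> adj N ^^ k \<Longrightarrow> (root_vertex N', \<sigma> v) \<in> adj N' ^^ k"
    for k v
  proof (induction k arbitrary: v)
    case (Suc k)
    then obtain u where u: "(root_vertex N, u) \<in> adj N ^^ k" "(u, v) \<in> adj N" by auto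
    have ub: "u \<in> nball N t" using nball_iff[OF N(1)] u Suc.prems by (auto intro!: exI[of _ k])
    have IH: "(root_vertex N', \<sigma> u) \<in> adj N' ^^ k" using Suc u by simp
    \<comment> \<open>Membership of \<open>\<sigma> u\<close> results from the lifted walk, which is
      why \<open>nb\<close> and \<open>vm\<close> may assume it: when the target is a component, its
      vertices are known only through walks.\<close>
    then have "\<sigma> u \<in> verts N'" using walk_verts r' by metis
    from nb[OF ub this] u(2) IH show ?case by (auto intro: relpow_Suc_I)
  qed (use r in auto)
  have ver: "\<sigma> v \<in> verts N'" if "v \<in> nball N t" for v
    using that up nball_iff[OF N(1)] walk_verts r' by metis
  have down: "real k \<le> t \<Longrightarrow> (root_vertex N', x) \<in> adj N' ^^ k \<Longrightarrow>
      \<exists>v. x = \<sigma> v \<and> (root_vertex N, v) \<in> adj N ^^ k" for k x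
  proof (induction k arbitrary: x)
    case (Suc k)
    then obtain x' where x': "(root_vertex N', x') \<in> adj N' ^^ k" "(x', x) \<in> adj N'" by auto
    with Suc obtain u where u: "x' = \<sigma> u" "(root_vertex N, u) \<in> adj N ^^ k" by force
    have ub: "u \<in> nball N t" using nball_iff[OF N(1)] u Suc.prems by (auto intro!: exI[of _ k])
    from nb[OF ub ver[OF ub]] x'(2) u(1) obtain v where "x = \<sigma> v" "(u, v) \<in> adj N" by blast
    with u(2) show ?case by (auto intro: relpow_Suc_I)
  qed (use r in auto)
  have "inj_on \<sigma> (nball N t)" using inj Y by (rule inj_on_subset)
  moreover have "\<sigma> ` nball N t = nball N' t"
  proof
    show "\<sigma> ` nball N t \<subseteq> nball N' t" using up nball_iff[OF N(1)] nball_iff[OF N(2)] by blast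
    show "nball N' t \<subseteq> \<sigma> ` nball N t" using down nball_iff[OF N(1)] nball_iff[OF N(2)] by blast
  qed
  ultimately have bij: "bij_betw \<sigma> (nball N t) (nball N' t)" by (simp add: bij_betw_def)
  have adjE: "(u, v) \<in> adj N \<longleftrightarrow> {u, v} \<in> edges N" if "u \<in> nball N t" "v \<in> nball N t" for u v
    using that nball_subset[of N t] by (auto simp: adj_def)
  have adjE': "(\<sigma> u, \<sigma> v) \<in> adj N' \<longleftrightarrow> {\<sigma> u, \<sigma> v} \<in> edges N'"
    if "u \<in> nball N t" "v \<in> nball N t" for u v
    using that ver by (auto simp: adj_def)
  have ed: "{u, v} \<in> edges N \<longleftrightarrow> {\<sigma> u, \<sigma> v} \<in> edges N'"
    if uv: "u \<in> nball N t" "v \<in> nball N t" for u v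
  proof -
    have "(\<sigma> u, \<sigma> v) \<in> adj N' \<longleftrightarrow> \<sigma> v \<in> \<sigma> ` {x. (u, x) \<in> adj N}"
      using nb[OF uv(1) ver[OF uv(1)]] by blast
    \<comment> \<open>A neighbour of a ball vertex may lie one step outside the ball; injectivity on
      the larger set \<open>Y\<close> rules out that it has the same image as
      \<open>v\<close>.\<close>
    also have "\<dots> \<longleftrightarrow> (u, v) \<in> adj N"
      using inj_on_eq_iff[OF inj] Yn[OF uv(1)] uv(2) Y by blast
    finally show ?thesis using adjE[OF uv] adjE'[OF uv] by blast
  qed
  have pos: "0 < 1 / ereal t" using t by (auto simp: one_ereal_def divide_ereal_def)
  show ?thesis unfolding agree_def ball_iso_def
  proof (intro exI[of _ \<sigma>] conjI ballI impI)
    show "bij_betw \<sigma> (nball N t) (nball N' t)" by fact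
    show "\<sigma> (root_vertex N) = root_vertex N'" by fact
    show "{u, v} \<in> edges N \<longleftrightarrow> {\<sigma> u, \<sigma> v} \<in> edges N'" if "u \<in> nball N t" "v \<in> nball N t" for u v
      using ed that .
    show "ereal (vmark_dist (vmark N v) (vmark N' (\<sigma> v))) < 1 / ereal t" if "v \<in> nball N t" for v
      using vm[OF that ver[OF that]] pos by (simp add: zero_ereal_def)
    show "ereal (dist (emark N e) (emark N' (\<sigma> ` e))) < 1 / ereal t"
      if e: "e \<in> edges N" "e \<subseteq> nball N t" for e
    proof -
      obtain u v where uv: "e = {u, v}"
        using edge_cases[OF _ e(1)] N(1) unfolding clf_network_def by metis
      then have "(u, v) \<in> adj N" using adjE e by auto
      then have "emark N' (\<sigma> ` e) = emark N e" using em[of u v] e uv by simp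
      then show ?thesis using pos by (simp add: zero_ereal_def)
    qed
  qed
qed

text \<open>This needs no separability of the target.\<close>

lemma borel_measurable_countable_codes:
  fixes f :: "'a \<Rightarrow> 'b::metric_space" and c :: "nat \<Rightarrow> 'a \<Rightarrow> 'c"
  assumes D: "countable D" and c: "\<And>k \<omega>. \<omega> \<in> space M \<Longrightarrow> c k \<omega> \<in> D"
    and meas: "\<And>k x. {\<omega> \<in> space M. c k \<omega> = x} \<in> sets M"
    and close: "\<And>k \<omega> \<omega>'. \<omega> \<in> space M \<Longrightarrow> \<omega>' \<in> space M \<Longrightarrow> c k \<omega> = c k \<omega>' \<Longrightarrow>
      dist (f \<omega>) (f \<omega>') \<le> 1 / (1 + real k)"
  shows "f \<in> borel_measurable M"
proof -
  \<comment> \<open>The value of \<open>f\<close> at one chosen point of each code class. Since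
    \<open>f\<close> moves by at most \<open>1 / (1 + real k)\<close> on a class, these functions of
    the code converge pointwise to \<open>f\<close>.\<close>
  define g where "g k x = f (SOME \<omega>'. \<omega>' \<in> space M \<and> c k \<omega>' = x)" for k x
  have cm: "c k \<in> measurable M (count_space D)" for k
  proof (rule measurable_count_space_eq_countable[THEN iffD2, OF D], intro conjI ballI)
    show "c k \<in> space M \<rightarrow> D" using c by blast
    fix x assume "x \<in> D"
    have "c k -` {x} \<inter> space M = {\<omega> \<in> space M. c k \<omega> = x}" by blast
    then show "c k -` {x} \<inter> space M \<in> sets M" using meas by simp
  qed
  have "(\<lambda>\<omega>. g k (c k \<omega>)) \<in> borel_measurable M" for k
    using measurable_comp[OF cm, of "g k" borel k] by (simp add: comp_def)
  moreover have "(\<lambda>k. g k (c k \<omega>)) \<longlonglongrightarrow> f \<omega>" if \<omega>: "\<omega> \<in> space M" for \<omega>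
  proof -
    have le: "dist (g k (c k \<omega>)) (f \<omega>) \<le> 1 / (1 + real k)" for k
    proof -
      have "\<exists>\<omega>'. \<omega>' \<in> space M \<and> c k \<omega>' = c k \<omega>" using \<omega> by blast
      from someI_ex[OF this] show ?thesis unfolding g_def by (intro close \<omega>) auto
    qed
    have lim: "(\<lambda>k. 1 / (1 + real k)) \<longlonglongrightarrow> 0"
      using LIMSEQ_inverse_real_of_nat by (simp add: inverse_eq_divide add.commute)
    have "(\<lambda>k. dist (g k (c k \<omega>)) (f \<omega>)) \<longlonglongrightarrow> 0"
      by (rule tendsto_sandwich[OF always_eventually[of "\<lambda>k. 0 \<le> dist (g k (c k \<omega>)) (f \<omega>)"]
            always_eventually[of "\<lambda>k. dist (g k (c k \<omega>)) (f \<omega>) \<le> 1 / (1 + real k)"] tendsto_const lim])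
        (simp_all add: le)
    then show ?thesis by (subst tendsto_dist_iff)
  qed
  ultimately show ?thesis by (rule borel_measurable_LIMSEQ_metric)
qed


section \<open>Measurability of the class of a random network\<close>

lemma measurable_relpow:
  fixes R :: "'b \<Rightarrow> ('a::countable \<times> 'a) set"
  assumes [measurable]: "\<And>u v. Measurable.pred M (\<lambda>\<omega>. (u, v) \<in> R \<omega>)"
  shows "Measurable.pred M (\<lambda>\<omega>. (r, v) \<in> R \<omega> ^^ j)"
proof (induction j arbitrary: v)
  case (Suc j)
  have "Measurable.pred M (\<lambda>\<omega>. \<exists>u. (r, u) \<in> R \<omega> ^^ j \<and> (u, v) \<in> R \<omega>)"
    using Suc[measurable] by measurable
  then show ?case by (simp add: relcomp_unfold)
qed simp

lemma measurable_rtrancl: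
  fixes R :: "'b \<Rightarrow> ('a::countable \<times> 'a) set"
  assumes "\<And>u v. Measurable.pred M (\<lambda>\<omega>. (u, v) \<in> R \<omega>)"
  shows "Measurable.pred M (\<lambda>\<omega>. (r, v) \<in> (R \<omega>)\<^sup>*)"
  unfolding rtrancl_power using measurable_relpow[OF assms, measurable] by measurable

text \<open>The code at level \<open>k\<close> is the ball of radius \<open>k\<close> with its real
  marks rounded down to multiples of \<open>1 / (k + 1)\<close>. Equal codes make the identity an
  admissible isomorphism, and codes are finite subsets of countable sets.\<close>

lemma borel_measurable_gclass:
  fixes N :: "'b \<Rightarrow> 'a::countable rooted_network"
  assumes root: "\<And>\<omega>. \<omega> \<in> space M \<Longrightarrow> root_vertex (N \<omega>) = r"
    and clf [measurable]: "Measurable.pred M (\<lambda>\<omega>. clf_network (N \<omega>))"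
    and adj [measurable]: "\<And>u v. Measurable.pred M (\<lambda>\<omega>. (u, v) \<in> adj (N \<omega>))"
    and vm1 [measurable]: "\<And>v. (\<lambda>\<omega>. fst (vmark (N \<omega>) v)) \<in> measurable M (count_space UNIV)"
    and vm2 [measurable]: "\<And>v. (\<lambda>\<omega>. snd (vmark (N \<omega>) v)) \<in> borel_measurable M"
    and em [measurable]: "\<And>u v. (\<lambda>\<omega>. emark (N \<omega>) {u, v}) \<in> borel_measurable M"
  shows "(\<lambda>\<omega>. gclass (N \<omega>)) \<in> borel_measurable M"
proof -
  \<comment> \<open>\<open>B\<close> includes the test whether the network is admissible: the root
    belongs to \<open>B k \<omega>\<close> exactly in that case. So equal codes agree on
    admissibility, and all inadmissible networks share one class.\<close>
  define B where "B k \<omega> v \<longleftrightarrow> clf_network (N \<omega>) \<and> v \<in> nball (N \<omega>) (real k)" for k \<omega> v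
  define V where "V k \<omega> = {(v, p, i). B k \<omega> v \<and> p = fst (vmark (N \<omega>) v) \<and>
      i = \<lfloor>(real k + 1) * snd (vmark (N \<omega>) v)\<rfloor>}" for k \<omega>
  define E where "E k \<omega> = {(u, v, i). B k \<omega> u \<and> B k \<omega> v \<and> (u, v) \<in> adj (N \<omega>) \<and>
      i = \<lfloor>(real k + 1) * emark (N \<omega>) {u, v}\<rfloor>}" for k \<omega>
  have relp: "Measurable.pred M (\<lambda>\<omega>. (r, v) \<in> adj (N \<omega>) ^^ j)" for j v
    by (rule measurable_relpow) (rule adj)
  have B [measurable]: "Measurable.pred M (\<lambda>\<omega>. B k \<omega> v)" for k v
  proof -
    have "Measurable.pred M (\<lambda>\<omega>. clf_network (N \<omega>) \<and> (\<exists>j. real j \<le> real k \<and> (r, v) \<in> adj (N \<omega>) ^^ j))"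
      using relp[measurable] by measurable
    moreover have "B k \<omega> v \<longleftrightarrow> clf_network (N \<omega>) \<and> (\<exists>j. real j \<le> real k \<and> (r, v) \<in> adj (N \<omega>) ^^ j)"
      if "\<omega> \<in> space M" for \<omega>
      unfolding B_def using nball_iff[of "N \<omega>" v "real k"] root[OF that] by auto
    ultimately show ?thesis by (subst measurable_cong)
  qed
  have Bfin: "finite {v. B k \<omega> v}" for k \<omega>
    unfolding B_def by (cases "clf_network (N \<omega>)") (simp_all add: finite_nball)
  have Vfin: "finite (V k \<omega>)" for k \<omega>
    by (rule finite_subset[of _ "(\<lambda>v. (v, fst (vmark (N \<omega>) v), \<lfloor>(real k + 1) * snd (vmark (N \<omega>) v)\<rfloor>)) ` {v. B k \<omega> v}"])
      (auto simp: V_def Bfin)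
  have Efin: "finite (E k \<omega>)" for k \<omega>
    by (rule finite_subset[of _ "(\<lambda>(u, v). (u, v, \<lfloor>(real k + 1) * emark (N \<omega>) {u, v}\<rfloor>)) ` ({v. B k \<omega> v} \<times> {v. B k \<omega> v})"])
      (auto simp: E_def Bfin)
  have floor_close: "\<bar>x - y\<bar> < 1 / (real k + 1)" if "\<lfloor>(real k + 1) * x\<rfloor> = \<lfloor>(real k + 1) * y\<rfloor>" for x y k
  proof -
    have "\<bar>(real k + 1) * x - (real k + 1) * y\<bar> < 1" using that by linarith
    then have "(real k + 1) * \<bar>x - y\<bar> < 1"
      by (simp add: abs_mult flip: right_diff_distrib)
    then show ?thesis by (simp add: field_simps)
  qed
  show ?thesis
  proof (rule borel_measurable_countable_codes[where c = "\<lambda>k \<omega>. (V k \<omega>, E k \<omega>)"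
      and D = "Collect finite \<times> Collect finite"])
    show "countable (Collect finite \<times> Collect finite :: (('a \<times> nat \<times> int) set \<times> ('a \<times> 'a \<times> int) set) set)"
      by (intro countable_SIGMA countable_Collect_finite)
    show "(V k \<omega>, E k \<omega>) \<in> Collect finite \<times> Collect finite" for k \<omega>
      by (simp add: Vfin Efin)
    fix k :: nat and x :: "('a \<times> nat \<times> int) set \<times> ('a \<times> 'a \<times> int) set"
    have mem: "(v, p, i) \<in> V k \<omega> \<longleftrightarrow> B k \<omega> v \<and> p = fst (vmark (N \<omega>) v) \<and>
        i = \<lfloor>(real k + 1) * snd (vmark (N \<omega>) v)\<rfloor>"
      "(u, v, i) \<in> E k \<omega> \<longleftrightarrow> B k \<omega> u \<and> B k \<omega> v \<and> (u, v) \<in> adj (N \<omega>) \<and>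
        i = \<lfloor>(real k + 1) * emark (N \<omega>) {u, v}\<rfloor>" for u v p i \<omega>
      by (simp_all add: V_def E_def)
    \<comment> \<open>Equality of sets over a countable type is a countable conjunction of
      membership conditions.\<close>
    have "Measurable.pred M (\<lambda>\<omega>. (\<forall>v p i. (v, p, i) \<in> fst x \<longleftrightarrow> (v, p, i) \<in> V k \<omega>) \<and>
        (\<forall>u v i. (u, v, i) \<in> snd x \<longleftrightarrow> (u, v, i) \<in> E k \<omega>))"
      unfolding mem by measurable
    also have "?this \<longleftrightarrow> Measurable.pred M (\<lambda>\<omega>. (V k \<omega>, E k \<omega>) = x)"
      by (intro arg_cong[of _ _ "Measurable.pred M"] ext) (auto simp: prod_eq_iff set_eq_iff)
    finally show "{\<omega> \<in> space M. (V k \<omega>, E k \<omega>) = x} \<in> sets M" by (simp add: pred_def)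
  next
    fix k :: nat and \<omega> \<omega>' assume \<omega>: "\<omega> \<in> space M" "\<omega>' \<in> space M" and eq: "(V k \<omega>, E k \<omega>) = (V k \<omega>', E k \<omega>')"
    have Veq: "(v, p, i) \<in> V k \<omega> \<longleftrightarrow> (v, p, i) \<in> V k \<omega>'" and Eeq: "(u, v, i) \<in> E k \<omega> \<longleftrightarrow> (u, v, i) \<in> E k \<omega>'"
      for u v p i using eq by auto
    have Beq: "B k \<omega> v \<longleftrightarrow> B k \<omega>' v" for v
      using Veq[of v] unfolding V_def by auto
    have Br: "clf_network (N \<omega>) \<longleftrightarrow> B k \<omega> r" if "\<omega> \<in> space M" for \<omega>
      using root_in_nball[of "N \<omega>" "real k"] root[OF that] unfolding B_def by auto
    show "dist (gclass (N \<omega>)) (gclass (N \<omega>')) \<le> 1 / (1 + real k)"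
    proof (cases "clf_network (N \<omega>)")
      case False
      then have "\<not> clf_network (N \<omega>')" using Br \<omega> Beq by blast
      with False show ?thesis by (simp add: gclass_def nat_reps_def)
    next
      case True
      then have c': "clf_network (N \<omega>')" using Br \<omega> Beq by blast
      have nb: "nball (N \<omega>) (real k) = nball (N \<omega>') (real k)"
        using Beq True c' by (auto simp: B_def)
      have adjeq: "(u, v) \<in> adj (N \<omega>) \<longleftrightarrow> {u, v} \<in> edges (N \<omega>)"
        "(u, v) \<in> adj (N \<omega>') \<longleftrightarrow> {u, v} \<in> edges (N \<omega>')"
        if "u \<in> nball (N \<omega>) (real k)" "v \<in> nball (N \<omega>) (real k)" for u v
        using that nb nball_subset[of "N \<omega>" "real k"] nball_subset[of "N \<omega>'" "real k"]
        by (auto simp: adj_def)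
      \<comment> \<open>Rounding leaves an error below \<open>1 / (k + 1)\<close>, strictly inside
        the bound \<open>1 / k\<close> of \<open>agree\<close>, which is infinite at
        \<open>k = 0\<close>.\<close>
      have pos: "ereal (1 / (real k + 1)) < 1 / ereal (real k)"
        by (cases "k = 0") (auto simp: one_ereal_def divide_ereal_def field_simps)
      have "agree (real k) (N \<omega>) (N \<omega>')" unfolding agree_def ball_iso_def
      proof (intro exI[of _ id] conjI ballI impI)
        show "bij_betw id (nball (N \<omega>) (real k)) (nball (N \<omega>') (real k))" by (simp add: nb)
        show "id (root_vertex (N \<omega>)) = root_vertex (N \<omega>')" using root \<omega> by simp
        show "{u, v} \<in> edges (N \<omega>) \<longleftrightarrow> {id u, id v} \<in> edges (N \<omega>')"
          if uv: "u \<in> nball (N \<omega>) (real k)" "v \<in> nball (N \<omega>) (real k)" for u v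
        proof -
          have "B k \<omega> u" "B k \<omega> v" "B k \<omega>' u" "B k \<omega>' v" using uv nb True c' by (auto simp: B_def)
          with Eeq[of u v] have "(u, v) \<in> adj (N \<omega>) \<longleftrightarrow> (u, v) \<in> adj (N \<omega>')"
            unfolding E_def by auto
          then show ?thesis using adjeq uv by simp
        qed
        show "ereal (vmark_dist (vmark (N \<omega>) v) (vmark (N \<omega>') (id v))) < 1 / ereal (real k)"
          if v: "v \<in> nball (N \<omega>) (real k)" for v
        proof -
          have "B k \<omega> v" using v True by (simp add: B_def)
          then have "(v, fst (vmark (N \<omega>) v), \<lfloor>(real k + 1) * snd (vmark (N \<omega>) v)\<rfloor>) \<in> V k \<omega>'"
            unfolding Veq[symmetric] by (simp add: V_def)
          then have *: "fst (vmark (N \<omega>) v) = fst (vmark (N \<omega>') v)"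
              "\<lfloor>(real k + 1) * snd (vmark (N \<omega>) v)\<rfloor> = \<lfloor>(real k + 1) * snd (vmark (N \<omega>') v)\<rfloor>"
            by (auto simp: V_def)
          then have "vmark_dist (vmark (N \<omega>) v) (vmark (N \<omega>') v) < 1 / (real k + 1)"
            using floor_close[OF *(2)] by (simp add: vmark_dist_def dist_Pair_Pair dist_real_def)
          then show ?thesis using pos by (simp add: less_trans[of _ "ereal (1 / (real k + 1))"])
        qed
        show "ereal (dist (emark (N \<omega>) e) (emark (N \<omega>') (id ` e))) < 1 / ereal (real k)"
          if e: "e \<in> edges (N \<omega>)" "e \<subseteq> nball (N \<omega>) (real k)" for e
        proof -
          obtain u v where uv: "e = {u, v}"
            using edge_cases[OF _ e(1)] True unfolding clf_network_def by metis
          then have "B k \<omega> u" "B k \<omega> v" "(u, v) \<in> adj (N \<omega>)"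
            using e True adjeq(1) by (auto simp: B_def)
          then have "(u, v, \<lfloor>(real k + 1) * emark (N \<omega>) {u, v}\<rfloor>) \<in> E k \<omega>'"
            unfolding Eeq[symmetric] by (simp add: E_def)
          then have "\<lfloor>(real k + 1) * emark (N \<omega>) e\<rfloor> = \<lfloor>(real k + 1) * emark (N \<omega>') e\<rfloor>"
            by (auto simp: E_def uv)
          then have "dist (emark (N \<omega>) e) (emark (N \<omega>') e) < 1 / (real k + 1)"
            using floor_close by (simp add: dist_real_def)
          then show ?thesis using pos by (simp add: less_trans[of _ "ereal (1 / (real k + 1))"])
        qed
      qed
      then show ?thesis by (rule dist_gclass_le[OF True c']) simp
    qed
  qed
qed

section \<open>Weak convergence from one-sided Lipschitz bounds\<close>

text \<open>This is the Pasch-Hausdorff envelope, the largest \<open>k\<close>-Lipschitz minorant of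
  \<open>g\<close>. It approximates from below, as one-sided bounds require.\<close>

lemma inf_convolution:
  fixes g :: "'a::metric_space \<Rightarrow> real"
  assumes g: "continuous_on UNIV g" and g0: "\<And>x. 0 \<le> g x"
  defines "f k x \<equiv> INF y. g y + real k * dist x y"
  shows "0 \<le> f k x" "f k x \<le> g x" "\<bar>f k x - f k y\<bar> \<le> real k * dist x y"
    and "(\<lambda>k. f k x) \<longlonglongrightarrow> g x"
proof -
  have bdd: "bdd_below (range (\<lambda>y. g y + real k * dist x y))" for k x
    by (intro bdd_belowI2[where m = 0]) (simp add: g0)
  show f0: "0 \<le> f k x" for k x unfolding f_def by (rule cINF_greatest) (auto simp: g0)
  show fg: "f k x \<le> g x" for k x
    unfolding f_def by (rule order_trans[OF cINF_lower[OF bdd, of x]]) auto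
  have le: "f k x \<le> f k y + real k * dist x y" for k x y
  proof -
    have "f k x - real k * dist x y \<le> f k y"
    proof (unfold f_def[of k y], rule cINF_greatest)
      fix z
      have "f k x \<le> g z + real k * dist x z" unfolding f_def by (rule cINF_lower[OF bdd]) simp
      also have "\<dots> \<le> g z + real k * (dist x y + dist y z)"
        by (intro add_left_mono mult_left_mono dist_triangle) simp
      finally show "f k x - real k * dist x y \<le> g z + real k * dist y z" by (simp add: algebra_simps)
    qed simp
    then show ?thesis by simp
  qed
  show "\<bar>f k x - f k y\<bar> \<le> real k * dist x y" for k x y
    using le[of k x y] le[of k y x] by (simp add: dist_commute abs_le_iff)
  show "(\<lambda>k. f k x) \<longlonglongrightarrow> g x" for x
  proof (rule LIMSEQ_I)
    fix e :: real assume e: "0 < e"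
    obtain \<delta> where \<delta>: "0 < \<delta>" "\<And>y. dist y x < \<delta> \<Longrightarrow> dist (g y) (g x) < e / 2"
      using g[unfolded continuous_on_iff, rule_format, of x "e / 2"] e by auto
    \<comment> \<open>Beyond distance \<open>\<delta>\<close> the penalty
      \<open>real k * dist x y\<close> alone exceeds \<open>g x\<close>; nearer points have
      \<open>g\<close> within \<open>e / 2\<close> of \<open>g x\<close>.\<close>
    obtain k0 where k0: "g x / \<delta> < real k0" using reals_Archimedean2 by blast
    have "norm (f k x - g x) < e" if k: "k0 \<le> k" for k
    proof -
      have "g x - e / 2 \<le> f k x" unfolding f_def
      proof (rule cINF_greatest)
        fix y
        show "g x - e / 2 \<le> g y + real k * dist x y"
        proof (cases "dist y x < \<delta>")
          case True
          then have "\<bar>g y - g x\<bar> < e / 2" using \<delta>(2)[of y] by (simp only: dist_real_def)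
          then have "g x - e / 2 \<le> g y" by linarith
          moreover have "0 \<le> real k * dist x y" by simp
          ultimately show ?thesis by linarith
        next
          case False
          have "g x < real k0 * \<delta>" using k0 \<delta>(1) by (simp add: field_simps)
          also have "\<dots> \<le> real k * dist x y"
            using False k \<delta>(1) by (intro mult_mono) (auto simp: dist_commute)
          finally show ?thesis using g0[of y] e by linarith
        qed
      qed simp
      then show ?thesis using fg[of k x] e by (simp add: abs_if)
    qed
    then show "\<exists>k0. \<forall>k\<ge>k0. norm (f k x - g x) < e" by blast
  qed
qed

text \<open>A lower bound for a Lipschitz minorant is one for the function itself, and dominated
  convergence under \<open>\<nu>\<close> makes the loss on the limit side small. Lower bounds for
  \<open>f + B\<close> and for \<open>B - f\<close> together give convergence.\<close>

lemma weakly_converges_lipschitz_lower: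
  fixes \<nu> :: "'a::metric_space measure"
  assumes \<nu>: "\<nu> \<in> borel_prob" and \<mu>: "\<forall>\<^sub>F n in sequentially. \<mu> n \<in> borel_prob"
    and lower: "\<And>f :: 'a \<Rightarrow> real. \<And>L B e. (\<And>x y. \<bar>f x - f y\<bar> \<le> L * dist x y) \<Longrightarrow> (\<And>x. 0 \<le> f x) \<Longrightarrow>
      (\<And>x. f x \<le> B) \<Longrightarrow> 0 < e \<Longrightarrow> \<forall>\<^sub>F n in sequentially. integral\<^sup>L \<nu> f - e \<le> integral\<^sup>L (\<mu> n) f"
  shows "weakly_converges \<mu> \<nu>"
proof -
  have int: "integrable M f" if "M \<in> borel_prob" "continuous_on UNIV f" "\<And>x. \<bar>f x\<bar> \<le> B"
    for M and f :: "'a \<Rightarrow> real" and B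
  proof -
    interpret prob_space M using that by (simp add: borel_prob_def)
    have [measurable_cong]: "sets M = sets borel" using that by (simp add: borel_prob_def)
    have "f \<in> borel_measurable M" using borel_measurable_continuous_onI[OF that(2)] by simp
    then show ?thesis by (rule integrable_const_bound[where B = B, rotated]) (use that in simp)
  qed
  have cont: "\<forall>\<^sub>F n in sequentially. integral\<^sup>L \<nu> g - e \<le> integral\<^sup>L (\<mu> n) g"
    if g: "continuous_on UNIV g" "\<And>x. 0 \<le> g x" "\<And>x. g x \<le> B" and e: "0 < e"
    for g :: "'a \<Rightarrow> real" and B e
  proof -
    define f where "f k x = (INF y. g y + real k * dist x y)" for k x
    note f = inf_convolution[OF g(1,2), folded f_def]
    have fc: "continuous_on UNIV (f k)" for k
    proof -
      have "(real k)-lipschitz_on UNIV (f k)"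
        by (rule lipschitz_onI) (use f(3) in \<open>auto simp: dist_real_def\<close>)
      then show ?thesis by (rule lipschitz_on_continuous_on)
    qed
    have fB: "\<bar>f k x\<bar> \<le> B" "f k x \<le> B" for k x using f(1,2)[of k x] g(3)[of x] by auto
    have [measurable_cong]: "sets \<nu> = sets borel" using \<nu> by (simp add: borel_prob_def)
    have "(\<lambda>k. integral\<^sup>L \<nu> (f k)) \<longlonglongrightarrow> integral\<^sup>L \<nu> g"
    proof (rule integral_dominated_convergence[where w = "\<lambda>_. B"])
      show "g \<in> borel_measurable \<nu>" "f k \<in> borel_measurable \<nu>" for k
        using borel_measurable_continuous_onI[OF g(1)] borel_measurable_continuous_onI[OF fc] by simp_all
      show "integrable \<nu> (\<lambda>_. B)" by (rule int[OF \<nu>, where B = "\<bar>B\<bar>"]) auto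
    qed (use f fB in auto)
    from LIMSEQ_D[OF this, of "e / 2"] e obtain k where "norm (integral\<^sup>L \<nu> (f k) - integral\<^sup>L \<nu> g) < e / 2"
      by auto
    then have k: "integral\<^sup>L \<nu> g - e \<le> integral\<^sup>L \<nu> (f k) - e / 2" by (simp add: abs_if split: if_splits)
    have "\<forall>\<^sub>F n in sequentially. integral\<^sup>L \<nu> (f k) - e / 2 \<le> integral\<^sup>L (\<mu> n) (f k)"
      by (rule lower[where L = "real k" and B = B]) (use f fB e in auto)
    then show ?thesis using \<mu>
    proof eventually_elim
      case (elim n)
      have "integral\<^sup>L (\<mu> n) (f k) \<le> integral\<^sup>L (\<mu> n) g"
        using elim(2) f fB g fc by (intro integral_mono int[where B = B]) auto
      with elim k show ?case by linarith
    qed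
  qed
  show ?thesis unfolding weakly_converges_def
  proof (intro conjI allI impI \<nu> \<mu>)
    fix f :: "'a \<Rightarrow> real" assume f: "continuous_on UNIV f \<and> bounded (range f)"
    then obtain B where B: "\<bar>f x\<bar> \<le> B" for x by (auto simp: bounded_iff)
    have B': "0 \<le> f x + B" "0 \<le> B - f x" "f x + B \<le> 2 * B" "B - f x \<le> 2 * B" for x
      using B[of x] by (auto simp: abs_le_iff)
    \<comment> \<open>Total mass one on both sides is what converts the lower bound for
      \<open>B - f\<close> into an upper bound for \<open>f\<close>.\<close>
    have eq: "integral\<^sup>L M (\<lambda>x. f x + B) = integral\<^sup>L M f + B" "integral\<^sup>L M (\<lambda>x. B - f x) = B - integral\<^sup>L M f"
      if M: "M \<in> borel_prob" for M
    proof -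
      interpret prob_space M using M by (simp add: borel_prob_def)
      have "integrable M f" using int[OF M] f B by blast
      then show "integral\<^sup>L M (\<lambda>x. f x + B) = integral\<^sup>L M f + B" "integral\<^sup>L M (\<lambda>x. B - f x) = B - integral\<^sup>L M f"
        by (simp_all add: prob_space)
    qed
    show "(\<lambda>n. integral\<^sup>L (\<mu> n) f) \<longlonglongrightarrow> integral\<^sup>L \<nu> f"
    proof (rule tendstoI)
      fix e :: real assume e: "0 < e"
      then have e2: "0 < e / 2" by simp
      have "\<forall>\<^sub>F n in sequentially. integral\<^sup>L \<nu> (\<lambda>x. f x + B) - e / 2 \<le> integral\<^sup>L (\<mu> n) (\<lambda>x. f x + B)"
        by (rule cont[OF _ B'(1,3) e2]) (use f in \<open>auto intro!: continuous_intros\<close>)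
      moreover have "\<forall>\<^sub>F n in sequentially. integral\<^sup>L \<nu> (\<lambda>x. B - f x) - e / 2 \<le> integral\<^sup>L (\<mu> n) (\<lambda>x. B - f x)"
        by (rule cont[OF _ B'(2,4) e2]) (use f in \<open>auto intro!: continuous_intros\<close>)
      ultimately show "\<forall>\<^sub>F n in sequentially. dist (integral\<^sup>L (\<mu> n) f) (integral\<^sup>L \<nu> f) < e" using \<mu>
      proof eventually_elim
        case (elim n)
        then show ?case using eq[OF \<nu>] eq[OF elim(3)] e by (simp add: dist_real_def abs_if)
      qed
    qed
  qed
qed

section \<open>The Erlang weighted tree as a network\<close>

lemma component_simps [simp]:
  "verts (component N i) = {v. (i, v) \<in> (adj N)\<^sup>*}"
  "edges (component N i) = {e \<in> edges N. e \<subseteq> {v. (i, v) \<in> (adj N)\<^sup>*}}"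
  "vmark (component N i) = vmark N" "emark (component N i) = emark N"
  "root_vertex (component N i) = i"
  by (simp_all add: component_def Let_def)

lemma adj_component:
  "(u, v) \<in> adj (component N i) \<longleftrightarrow> (i, u) \<in> (adj N)\<^sup>* \<and> (u, v) \<in> adj N" if "i \<in> verts N"
proof -
  have "x \<in> verts N" if "(i, x) \<in> (adj N)\<^sup>*" for x
    using that \<open>i \<in> verts N\<close> by (induction rule: rtrancl_induct) (auto simp: adj_def)
  moreover have "(i, v) \<in> (adj N)\<^sup>*" if "(i, u) \<in> (adj N)\<^sup>*" "(u, v) \<in> adj N"
    using that by (rule rtrancl_into_rtrancl)
  moreover have "(u, v) \<in> adj (component N i) \<longleftrightarrow>
      (i, u) \<in> (adj N)\<^sup>* \<and> (i, v) \<in> (adj N)\<^sup>* \<and> {u, v} \<in> edges N"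
    by (simp add: adj_def[of "component N i"]) blast
  moreover have "(u, v) \<in> adj N \<longleftrightarrow> u \<in> verts N \<and> v \<in> verts N \<and> {u, v} \<in> edges N"
    by (simp add: adj_def)
  ultimately show ?thesis by blast
qed

lemma connected_component:
  assumes "i \<in> verts N" shows "connected_network (component N i)"
proof -
  have 1: "(i, v) \<in> (adj (component N i))\<^sup>*" if "(i, v) \<in> (adj N)\<^sup>*" for v
    using that
  proof (induction rule: rtrancl_induct)
    case (step y z)
    then show ?case by (intro rtrancl_into_rtrancl[OF step(3)]) (simp add: adj_component[OF assms])
  qed simp
  have "sym ((adj (component N i))\<^sup>*)" by (intro sym_rtrancl symI) (rule adj_sym)
  then have 2: "(v, i) \<in> (adj (component N i))\<^sup>*" if "(i, v) \<in> (adj N)\<^sup>*" for v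
    using 1[OF that] by (rule symD)
  show ?thesis unfolding connected_network_def
    by (intro ballI rtrancl_trans[OF 2 1]) simp_all
qed

section \<open>The backbone and the thinned tree as sets of lists\<close>

inductive_set nodes :: "(nat list \<Rightarrow> nat) \<Rightarrow> nat list set" for m where
  nodes_root: "[] \<in> nodes m"
| nodes_child: "w \<in> nodes m \<Longrightarrow> 1 \<le> j \<Longrightarrow> j \<le> m w \<Longrightarrow> w @ [j] \<in> nodes m"

text \<open>Removing an edge of a tree cuts off everything below it, so the component of the root
  after thinning obeys a recursion from parent to child.\<close>

inductive_set kept :: "(nat list \<Rightarrow> node_data) \<Rightarrow> nat list set" for \<omega> where
  kept_root: "[] \<in> kept \<omega>"
| kept_child: "w \<in> kept \<omega> \<Longrightarrow> 1 \<le> j \<Longrightarrow> j \<le> ewt_n \<omega> w \<Longrightarrow> ewt_cost \<omega> w j < ewt_v \<omega> (w @ [j])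
    \<Longrightarrow> w @ [j] \<in> kept \<omega>"

lemma nodes_snoc: "w @ [j] \<in> nodes m \<longleftrightarrow> w \<in> nodes m \<and> 1 \<le> j \<and> j \<le> m w"
  by (subst nodes.simps) auto

lemma kept_snoc: "w @ [j] \<in> kept \<omega> \<longleftrightarrow>
    w \<in> kept \<omega> \<and> 1 \<le> j \<and> j \<le> ewt_n \<omega> w \<and> ewt_cost \<omega> w j < ewt_v \<omega> (w @ [j])"
  by (subst kept.simps) auto

lemma kept_subset_nodes: "kept \<omega> \<subseteq> nodes (ewt_n \<omega>)"
proof
  show "w \<in> nodes (ewt_n \<omega>)" if "w \<in> kept \<omega>" for w
    using that by induction (auto intro: nodes.intros)
qed

lemma nodes_subset_indices: "nodes m \<subseteq> indices"
proof
  show "w \<in> indices" if "w \<in> nodes m" for w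
    using that by induction (auto simp: indices_def)
qed

text \<open>Edges only join a list to its one-step extensions, and the last assumption on
  \<open>K\<close> works in both directions: it adds children and forces parents into
  \<open>K\<close>. Hence no walk from the root leaves \<open>K\<close>. This serves for the
  backbone and for the thinned tree.\<close>

lemma reachable_tree:
  assumes adj: "\<And>u v. (u, v) \<in> adj N \<longleftrightarrow> (\<exists>j. (v = u @ [j] \<and> Q u j) \<or> (u = v @ [j] \<and> Q v j))"
    and K: "[] \<in> K" "\<And>w j. w @ [j] \<in> K \<longleftrightarrow> w \<in> K \<and> Q w j"
  shows "([], v) \<in> (adj N)\<^sup>* \<longleftrightarrow> v \<in> K"
proof
  show "v \<in> K" if "([], v) \<in> (adj N)\<^sup>*"
    using that by (induction rule: rtrancl_induct) (use K adj in auto)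
  show "([], v) \<in> (adj N)\<^sup>*" if "v \<in> K"
    using that
  proof (induction v rule: rev_induct)
    case (snoc j w)
    then have "w \<in> K" "(w, w @ [j]) \<in> adj N" using K adj by auto
    then show ?case using snoc by (auto intro: rtrancl_into_rtrancl)
  qed simp
qed

text \<open>The two ends have different lengths, so an edge determines its parent end. This makes
  the definite description in the edge marks of \<open>ewt_graph\<close> unique.\<close>

lemma edge_snoc_eq [simp]: "{i, i @ [j]} = {i', i' @ [j']} \<longleftrightarrow> i = i' \<and> j = (j' :: nat)"
  by (auto simp: doubleton_eq_iff dest: arg_cong[of _ _ length])

lemma verts_backbone: "verts (backbone \<omega>) = nodes (ewt_n \<omega>)"
proof -
  have adj: "(u, v) \<in> adj (ewt_graph \<omega>) \<longleftrightarrow> (\<exists>j. (v = u @ [j] \<and> (u \<in> indices \<and> j \<in> {1..ewt_n \<omega> u})) \<or>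
      (u = v @ [j] \<and> (v \<in> indices \<and> j \<in> {1..ewt_n \<omega> v})))" for u v
    by (auto simp: adj_def ewt_graph_def doubleton_eq_iff indices_def)
  have "([], v) \<in> (adj (ewt_graph \<omega>))\<^sup>* \<longleftrightarrow> v \<in> nodes (ewt_n \<omega>)" for v
    by (rule reachable_tree[OF adj nodes_root])
      (use nodes_subset_indices in \<open>auto simp: nodes_snoc\<close>)
  then show ?thesis by (simp add: backbone_def)
qed

lemma edges_thinned_backbone:
  "{u, v} \<in> edges (thinned_backbone \<omega>) \<longleftrightarrow>
     (\<exists>i j. {u, v} = {i, i @ [j]} \<and> i \<in> nodes (ewt_n \<omega>) \<and> 1 \<le> j \<and> j \<le> ewt_n \<omega> i \<and>
        ewt_cost \<omega> i j < ewt_v \<omega> (i @ [j]))"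
proof -
  have "{i, i @ [j]} \<in> edges (backbone \<omega>) \<longleftrightarrow> i \<in> nodes (ewt_n \<omega>) \<and> 1 \<le> j \<and> j \<le> ewt_n \<omega> i" for i j
  proof -
    have "{i, i @ [j]} \<in> edges (backbone \<omega>) \<longleftrightarrow>
        {i, i @ [j]} \<in> edges (ewt_graph \<omega>) \<and> {i, i @ [j]} \<subseteq> verts (backbone \<omega>)"
      by (simp add: backbone_def)
    also have "\<dots> \<longleftrightarrow> i \<in> nodes (ewt_n \<omega>) \<and> 1 \<le> j \<and> j \<le> ewt_n \<omega> i"
      unfolding verts_backbone using nodes_subset_indices[of "ewt_n \<omega>"]
      by (auto simp: ewt_graph_def nodes_snoc)
    finally show ?thesis .
  qed
  then show ?thesis by (simp add: thinned_backbone_def conj_assoc)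
qed

lemma
  shows verts_ewt: "verts (ewt \<omega>) = kept \<omega>"
    and adj_ewt: "(u, v) \<in> adj (ewt \<omega>) \<longleftrightarrow> u \<in> kept \<omega> \<and> v \<in> kept \<omega> \<and> (\<exists>j. v = u @ [j] \<or> u = v @ [j])"
    and vmark_ewt: "vmark (ewt \<omega>) = (\<lambda>i. (if i = [] then ewt_n \<omega> i else ewt_n \<omega> i + 1, ewt_v \<omega> i))"
    and emark_ewt: "emark (ewt \<omega>) = (\<lambda>e. THE x. \<exists>i j. e = {i, i @ [j]} \<and> x = ewt_cost \<omega> i j)"
    and root_ewt: "root_vertex (ewt \<omega>) = []"
    and edges_ewt: "edges (ewt \<omega>) = {{w, w @ [j]} | w j. w @ [j] \<in> kept \<omega>}"
proof -
  let ?Q = "\<lambda>i j. i \<in> nodes (ewt_n \<omega>) \<and> 1 \<le> j \<and> j \<le> ewt_n \<omega> i \<and> ewt_cost \<omega> i j < ewt_v \<omega> (i @ [j])"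
  have v: "verts (thinned_backbone \<omega>) = nodes (ewt_n \<omega>)"
    by (simp add: thinned_backbone_def verts_backbone)
  have adj: "(u, v) \<in> adj (thinned_backbone \<omega>) \<longleftrightarrow> (\<exists>j. (v = u @ [j] \<and> ?Q u j) \<or> (u = v @ [j] \<and> ?Q v j))" for u v
    unfolding adj_def v
    by (auto simp: edges_thinned_backbone doubleton_eq_iff nodes_snoc)
  have reach: "([], v) \<in> (adj (thinned_backbone \<omega>))\<^sup>* \<longleftrightarrow> v \<in> kept \<omega>" for v
    by (rule reachable_tree[OF adj kept_root]) (use kept_subset_nodes in \<open>auto simp: kept_snoc\<close>)
  show "verts (ewt \<omega>) = kept \<omega>" by (simp add: ewt_def reach)
  have "[] \<in> verts (thinned_backbone \<omega>)" unfolding v by (rule nodes_root)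
  from adj_component[OF this]
  show "(u, v) \<in> adj (ewt \<omega>) \<longleftrightarrow> u \<in> kept \<omega> \<and> v \<in> kept \<omega> \<and> (\<exists>j. v = u @ [j] \<or> u = v @ [j])"
    unfolding ewt_def reach adj using kept_subset_nodes[of \<omega>] by (auto simp: kept_snoc)
  show "vmark (ewt \<omega>) = (\<lambda>i. (if i = [] then ewt_n \<omega> i else ewt_n \<omega> i + 1, ewt_v \<omega> i))"
    "emark (ewt \<omega>) = (\<lambda>e. THE x. \<exists>i j. e = {i, i @ [j]} \<and> x = ewt_cost \<omega> i j)"
    "root_vertex (ewt \<omega>) = []"
    by (simp_all add: ewt_def thinned_backbone_def backbone_def ewt_graph_def)
  show "edges (ewt \<omega>) = {{w, w @ [j]} | w j. w @ [j] \<in> kept \<omega>}"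
  proof -
    have "e \<in> edges (ewt \<omega>) \<longleftrightarrow> e \<in> edges (thinned_backbone \<omega>) \<and> e \<subseteq> kept \<omega>" for e
      by (simp add: ewt_def reach)
    moreover have "e \<in> edges (thinned_backbone \<omega>) \<longleftrightarrow> (\<exists>i j. e = {i, i @ [j]} \<and> ?Q i j)" for e
    proof
      assume "e \<in> edges (thinned_backbone \<omega>)"
      moreover from this obtain i j where "e = {i, i @ [j]}" by (auto simp: thinned_backbone_def)
      ultimately show "\<exists>i j. e = {i, i @ [j]} \<and> ?Q i j" using edges_thinned_backbone by simp
    next
      assume "\<exists>i j. e = {i, i @ [j]} \<and> ?Q i j"
      then obtain i j where "e = {i, i @ [j]}" "?Q i j" by blast
      then show "e \<in> edges (thinned_backbone \<omega>)" by (simp only: edges_thinned_backbone) blast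
    qed
    ultimately show ?thesis using kept_subset_nodes[of \<omega>] by (auto simp: kept_snoc)
  qed
qed

lemma emark_ewt_snoc: "emark (ewt \<omega>) {w, w @ [j]} = ewt_cost \<omega> w j"
  unfolding emark_ewt by (rule the_equality) auto

text \<open>Connectedness and local finiteness hold for every outcome, so only sign conditions on
  the marks remain, and these form a measurable event.\<close>

lemma clf_ewt_iff:
  "clf_network (ewt \<omega>) \<longleftrightarrow>
     (\<forall>w\<in>kept \<omega>. 1 \<le> (if w = [] then ewt_n \<omega> w else ewt_n \<omega> w + 1) \<and> 0 \<le> ewt_v \<omega> w) \<and>
     (\<forall>w j. w @ [j] \<in> kept \<omega> \<longrightarrow> 0 \<le> ewt_cost \<omega> w j)" (is "_ \<longleftrightarrow> ?R")
proof -
  have "is_network (ewt \<omega>) \<longleftrightarrow> ?R"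
  proof -
    have "edges (ewt \<omega>) \<subseteq> {{u, v} | u v. u \<in> kept \<omega> \<and> v \<in> kept \<omega> \<and> u \<noteq> v}"
      unfolding edges_ewt by (force simp: kept_snoc)
    moreover have "(\<forall>e\<in>edges (ewt \<omega>). 0 \<le> emark (ewt \<omega>) e) \<longleftrightarrow> (\<forall>w j. w @ [j] \<in> kept \<omega> \<longrightarrow> 0 \<le> ewt_cost \<omega> w j)"
      unfolding edges_ewt by (auto simp: emark_ewt_snoc) (metis emark_ewt_snoc)
    ultimately show ?thesis unfolding is_network_def verts_ewt vmark_ewt by auto
  qed
  moreover have "connected_network (ewt \<omega>)"
    unfolding ewt_def
    by (rule connected_component) (simp add: thinned_backbone_def verts_backbone nodes_root)
  moreover have "locally_finite (ewt \<omega>)" unfolding locally_finite_def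
  proof
    fix w
    have "{u. (w, u) \<in> adj (ewt \<omega>)} \<subseteq> insert (butlast w) ((\<lambda>j. w @ [j]) ` {1..ewt_n \<omega> w})"
      by (auto simp: adj_ewt kept_snoc)
    then show "finite {u. (w, u) \<in> adj (ewt \<omega>)}" by (rule finite_subset) simp
  qed
  ultimately show ?thesis by (auto simp: clf_network_def verts_ewt root_ewt kept_root)
qed

lemma nball_ewt:
  assumes c: "clf_network (ewt \<omega>)" and w: "w \<in> nball (ewt \<omega>) (real t)"
  shows "w \<in> kept \<omega>" "length w \<le> t"
proof -
  show "w \<in> kept \<omega>" using w nball_subset[of "ewt \<omega>" "real t"] by (auto simp: verts_ewt)
  have "([], v) \<in> adj (ewt \<omega>) ^^ k \<Longrightarrow> length v \<le> k" for v k
    by (induction k arbitrary: v) (fastforce simp: adj_ewt)+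
  then show "length w \<le> t" using w nball_iff[OF c, of w "real t"] by (fastforce simp: root_ewt)
qed

text \<open>Radius \<open>t\<close> calls for data down to depth \<open>Suc t\<close>: the edge from
  a node at depth \<open>t\<close> to a child survives only if its cost is below the threshold of
  the child.\<close>

lemma ewt_agree:
  assumes c: "clf_network (ewt \<omega>)" "clf_network (ewt \<omega>')"
    and eq: "\<And>w. w \<in> nodes (ewt_n \<omega>) \<Longrightarrow> length w \<le> Suc t \<Longrightarrow> ewt_n \<omega>' w = ewt_n \<omega> w \<and> ewt_v \<omega>' w = ewt_v \<omega> w \<and>
      (\<forall>j. 1 \<le> j \<longrightarrow> j \<le> ewt_n \<omega> w \<longrightarrow> ewt_cost \<omega>' w j = ewt_cost \<omega> w j)"
  shows "agree (real t) (ewt \<omega>) (ewt \<omega>')"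
proof -
  have kept_eq: "w \<in> kept \<omega>' \<longleftrightarrow> w \<in> kept \<omega>" if "length w \<le> Suc t" for w
    using that
  proof (induction w rule: rev_induct)
    case (snoc j w)
    show ?case
    proof (cases "w \<in> kept \<omega> \<and> 1 \<le> j \<and> j \<le> ewt_n \<omega> w")
      case True
      then have "w \<in> nodes (ewt_n \<omega>)" "w @ [j] \<in> nodes (ewt_n \<omega>)"
        using kept_subset_nodes by (auto simp: nodes_snoc)
      from this[THEN eq] snoc True show ?thesis by (auto simp: kept_snoc)
    next
      case False
      have "ewt_n \<omega>' w = ewt_n \<omega> w" if "w \<in> kept \<omega>"
        using eq[of w] that kept_subset_nodes snoc(2) by auto
      with False snoc show ?thesis by (auto simp: kept_snoc)
    qed
  qed (simp add: kept_root)
  show ?thesis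
  proof (rule agree_local[OF c, where \<sigma> = id and Y = UNIV])
    fix w assume w: "w \<in> nball (ewt \<omega>) (real t)"
    note k = nball_ewt[OF c(1) w]
    then have "w \<in> nodes (ewt_n \<omega>)" using kept_subset_nodes by auto
    from eq[OF this] k have e: "ewt_n \<omega>' w = ewt_n \<omega> w" "ewt_v \<omega>' w = ewt_v \<omega> w" by auto
    show "{x'. (id w, x') \<in> adj (ewt \<omega>')} = id ` {x. (w, x) \<in> adj (ewt \<omega>)}"
      using kept_eq k by (auto simp: adj_ewt)
    show "vmark (ewt \<omega>') (id w) = vmark (ewt \<omega>) w" using e by (cases "w = []") (simp_all add: vmark_ewt)
    fix x assume x: "(w, x) \<in> adj (ewt \<omega>)"
    then obtain j where j: "x = w @ [j] \<or> w = x @ [j]" "x \<in> kept \<omega>" by (auto simp: adj_ewt)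
    obtain u where uj: "{w, x} = {u, u @ [j]}" "length u \<le> t" "u @ [j] \<in> kept \<omega>"
    proof (cases "x = w @ [j]")
      case True
      with that[of w] k j show ?thesis by simp
    next
      case False
      with that[of x] k j show ?thesis by (simp add: insert_commute)
    qed
    have "u \<in> nodes (ewt_n \<omega>)" using uj(3) kept_subset_nodes by (auto simp: kept_snoc)
    from eq[OF this] uj have "ewt_cost \<omega>' u j = ewt_cost \<omega> u j" by (auto simp: kept_snoc)
    then show "emark (ewt \<omega>') {id w, id x} = emark (ewt \<omega>) {w, x}"
      by (simp add: uj(1) emark_ewt_snoc)
  qed (auto simp: root_ewt)
qed

section \<open>Measurability of the weighted tree\<close>

abbreviation data_space :: "(nat list \<Rightarrow> node_data) measure" where
  "data_space \<equiv> PiM indices (\<lambda>_. node_space)"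

lemma measurable_ewt_data [measurable]:
  "(\<lambda>\<omega>. ewt_n \<omega> w) \<in> measurable data_space (count_space UNIV)"
  "(\<lambda>\<omega>. ewt_v \<omega> w) \<in> borel_measurable data_space"
  "(\<lambda>\<omega>. ewt_cost \<omega> w j) \<in> borel_measurable data_space"
proof -
  have w: "(\<lambda>\<omega>. \<omega> w) \<in> measurable data_space
      (count_space UNIV \<Otimes>\<^sub>M borel \<Otimes>\<^sub>M PiM UNIV (\<lambda>_. borel))"
  proof (cases "w \<in> indices")
    case True
    then show ?thesis using measurable_component_singleton[OF True, of "\<lambda>_. node_space"]
      by (simp add: node_space_def)
  next
    \<comment> \<open>Points of the product space are extensional, so the coordinate at a list
      outside \<open>indices\<close> is constantly \<open>undefined\<close>.\<close>
    case False
    have "(\<lambda>_. undefined) \<in> measurable data_space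
      (count_space UNIV \<Otimes>\<^sub>M borel \<Otimes>\<^sub>M PiM UNIV (\<lambda>_. borel :: real measure))"
      by (rule measurable_const) (simp add: space_pair_measure space_PiM)
    then show ?thesis
      by (rule measurable_cong[THEN iffD2, rotated]) (use False in \<open>auto simp: space_PiM PiE_def extensional_def\<close>)
  qed
  show "(\<lambda>\<omega>. ewt_n \<omega> w) \<in> measurable data_space (count_space UNIV)"
    unfolding ewt_n_def using w by measurable
  show "(\<lambda>\<omega>. ewt_v \<omega> w) \<in> borel_measurable data_space"
    unfolding ewt_v_def using w by measurable
  have "(\<lambda>x. snd (snd x) j) \<in> borel_measurable
      (count_space (UNIV :: nat set) \<Otimes>\<^sub>M (borel :: real measure) \<Otimes>\<^sub>M PiM UNIV (\<lambda>_. borel :: real measure))"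
    by measurable
  from measurable_compose[OF w this]
  show "(\<lambda>\<omega>. ewt_cost \<omega> w j) \<in> borel_measurable data_space"
    unfolding ewt_cost_def .
qed

lemma measurable_gclass_ewt:
  "(\<lambda>\<omega>. gclass (ewt \<omega>)) \<in> borel_measurable data_space"
proof (rule borel_measurable_gclass[where r = "[]"])
  have K [measurable]: "Measurable.pred data_space (\<lambda>\<omega>. w \<in> kept \<omega>)" for w
  proof (induction w rule: rev_induct)
    case (snoc j w)
    note snoc [measurable]
    show ?case unfolding kept_snoc by measurable
  qed (simp add: kept_root)
  show "Measurable.pred data_space (\<lambda>\<omega>. clf_network (ewt \<omega>))"
    unfolding clf_ewt_iff Ball_def by measurable
  show "Measurable.pred data_space (\<lambda>\<omega>. (u, v) \<in> adj (ewt \<omega>))" for u v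
    unfolding adj_ewt by measurable
  show "(\<lambda>\<omega>. fst (vmark (ewt \<omega>) v)) \<in> measurable data_space (count_space UNIV)"
    "(\<lambda>\<omega>. snd (vmark (ewt \<omega>) v)) \<in> borel_measurable data_space" for v
    unfolding vmark_ewt by simp_all
  show "(\<lambda>\<omega>. emark (ewt \<omega>) {u, v}) \<in> borel_measurable data_space" for u v
  proof (cases "\<exists>w j. {u, v} = {w, w @ [j]}")
    case True
    then obtain w j where "{u, v} = {w, w @ [j]}" by blast
    then show ?thesis by (simp add: emark_ewt_snoc)
  next
    case False
    \<comment> \<open>For two lists that are not parent and child the description has no witness for
      any outcome, so its value, though unspecified, is constant.\<close>
    then have "emark (ewt \<omega>) {u, v} = (THE x. False)" for \<omega>
      unfolding emark_ewt by (intro arg_cong[of _ _ The] ext) auto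
    then show ?thesis by simp
  qed
qed (simp add: root_ewt)

section \<open>Exploring the finite model\<close>

lemma sorted_nth_le_iff:
  "sorted xs \<Longrightarrow> p < length xs \<Longrightarrow> xs ! p \<le> a \<longleftrightarrow> p < length (filter (\<lambda>x. x \<le> a) xs)"
proof (induction xs arbitrary: p)
  case (Cons x xs)
  show ?case
  proof (cases "x \<le> a")
    case True
    then show ?thesis using Cons by (cases p) auto
  next
    case False
    then have "filter (\<lambda>y. y \<le> a) (x # xs) = []" using Cons.prems(1) by (auto simp: filter_empty_conv)
    moreover have "x \<le> (x # xs) ! p" using Cons.prems by (cases p) auto
    with False have "\<not> (x # xs) ! p \<le> a" by simp
    ultimately show ?thesis by simp
  qed
qed simp

text \<open>An order statistic is at most \<open>a\<close> when enough entries are: position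
  \<open>d i\<close>, counted from 0, needs more than \<open>d i\<close> of them. From here on
  \<open>sort\<close> is replaced by cardinalities.\<close>

lemma threshold_le_iff:
  assumes i: "i \<in> {1..n}" and d: "d i < n - 1"
  shows "threshold n d C i \<le> a \<longleftrightarrow> d i < card {j \<in> {1..n}. j \<noteq> i \<and> C {i, j} \<le> a}"
proof -
  let ?L = "filter (\<lambda>j. j \<noteq> i) [1..<Suc n]"
  have len: "length ?L = n - 1"
  proof -
    have "length ?L = card (set ?L)" by (rule distinct_card[symmetric]) simp
    also have "set ?L = {1..n} - {i}" by auto
    finally show ?thesis using i by simp
  qed
  have "length (filter (\<lambda>x. x \<le> a) (sort (map (\<lambda>j. C {i, j}) ?L)))
      = length (filter (\<lambda>j. C {i, j} \<le> a) ?L)"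
    by (simp add: filter_sort filter_map comp_def)
  also have "\<dots> = card (set (filter (\<lambda>j. C {i, j} \<le> a) ?L))"
    by (rule distinct_card[symmetric]) simp
  also have "set (filter (\<lambda>j. C {i, j} \<le> a) ?L) = {j \<in> {1..n}. j \<noteq> i \<and> C {i, j} \<le> a}" by auto
  finally show ?thesis
    unfolding threshold_def using d len by (subst sorted_nth_le_iff) auto
qed

lemma threshold_eqI:
  assumes i: "i \<in> {1..n}" and d: "d i < n - 1"
    and X: "X \<subseteq> {1..n} - {i}" "card X = d i" and k: "k \<in> {1..n} - {i} - X"
    and lt: "\<And>x. x \<in> X \<Longrightarrow> C {i, x} < C {i, k}"
    and gt: "\<And>x. x \<in> {1..n} - {i} - X \<Longrightarrow> C {i, k} \<le> C {i, x}"
  shows "threshold n d C i = C {i, k}" and "potential_nbrs n d C i = X"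
proof -
  have fin: "finite X" using X(1) by (rule finite_subset) simp
  \<comment> \<open>A real number is determined by its set of upper bounds, so the equality is
    proved by counting the costs at most \<open>a\<close>, for arbitrary \<open>a\<close>.\<close>
  have "threshold n d C i \<le> a \<longleftrightarrow> C {i, k} \<le> a" for a
  proof (cases "C {i, k} \<le> a")
    case True
    have "insert k X \<subseteq> {j \<in> {1..n}. j \<noteq> i \<and> C {i, j} \<le> a}"
      using X k True lt by force
    then have "card (insert k X) \<le> card {j \<in> {1..n}. j \<noteq> i \<and> C {i, j} \<le> a}"
      by (rule card_mono[rotated]) simp
    then show ?thesis using True X(2) k fin by (simp add: threshold_le_iff[where n = n and d = d and i = i, OF i d])
  next
    case False
    have "{j \<in> {1..n}. j \<noteq> i \<and> C {i, j} \<le> a} \<subseteq> X"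
      using gt False by force
    then have "card {j \<in> {1..n}. j \<noteq> i \<and> C {i, j} \<le> a} \<le> card X"
      by (rule card_mono[OF fin])
    then show ?thesis using False X(2) by (simp add: threshold_le_iff[where n = n and d = d and i = i, OF i d])
  qed
  from this[of "C {i, k}"] this[of "threshold n d C i"] show t: "threshold n d C i = C {i, k}"
    by (auto intro: antisym)
  show "potential_nbrs n d C i = X"
    unfolding potential_nbrs_def t using X(1) lt gt by (force simp: not_le[symmetric])
qed

lemma adj_finite_model:
  "(u, v) \<in> adj (finite_model n d C) \<longleftrightarrow>
     u \<in> {1..n} \<and> v \<in> {1..n} \<and> u \<in> potential_nbrs n d C v \<and> v \<in> potential_nbrs n d C u"
  by (auto simp: adj_def finite_model_def doubleton_eq_iff)

lemma finite_model_simps [simp]: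
  "verts (finite_model n d C) = {1..n}" "vmark (finite_model n d C) i = (d i, threshold n d C i)"
  "emark (finite_model n d C) e = C e"
  by (simp_all add: finite_model_def)

lemma clf_component_finite_model_iff:
  assumes r: "r \<in> {1..n}"
  shows "clf_network (component (finite_model n d C) r) \<longleftrightarrow>
    (\<forall>v. (r, v) \<in> (adj (finite_model n d C))\<^sup>* \<longrightarrow> 1 \<le> d v \<and> 0 \<le> threshold n d C v) \<and>
    (\<forall>u v. (r, u) \<in> (adj (finite_model n d C))\<^sup>* \<longrightarrow> (u, v) \<in> adj (finite_model n d C) \<longrightarrow> 0 \<le> C {u, v})"
    (is "_ \<longleftrightarrow> ?R")
proof -
  let ?F = "finite_model n d C"
  have adjE: "{u, v} \<in> edges ?F \<longleftrightarrow> (u, v) \<in> adj ?F" for u v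
    by (auto simp: adj_def finite_model_def doubleton_eq_iff)
  have "is_network (component ?F r) \<longleftrightarrow> ?R"
  proof -
    have "edges (component ?F r) \<subseteq>
        {{u, v} | u v. u \<in> verts (component ?F r) \<and> v \<in> verts (component ?F r) \<and> u \<noteq> v}"
      by (fastforce simp: finite_model_def potential_nbrs_def)
    moreover have "(\<forall>e\<in>edges (component ?F r). 0 \<le> emark (component ?F r) e) \<longleftrightarrow>
      (\<forall>u v. (r, u) \<in> (adj ?F)\<^sup>* \<longrightarrow> (u, v) \<in> adj ?F \<longrightarrow> 0 \<le> C {u, v})"
    proof -
      have Eiff: "e \<in> edges (component ?F r) \<longleftrightarrow> (\<exists>u v. e = {u, v} \<and> (r, u) \<in> (adj ?F)\<^sup>* \<and> (u, v) \<in> adj ?F)" for e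
      proof -
        have "e \<in> edges ?F \<longleftrightarrow> (\<exists>u v. e = {u, v} \<and> (u, v) \<in> adj ?F)"
          unfolding adj_finite_model by (auto simp: finite_model_def)
        moreover have "(r, v) \<in> (adj ?F)\<^sup>*" if "(r, u) \<in> (adj ?F)\<^sup>*" "(u, v) \<in> adj ?F" for u v
          using that by (rule rtrancl_into_rtrancl)
        ultimately show ?thesis unfolding component_simps mem_Collect_eq by blast
      qed
      show ?thesis
      proof (intro iffI allI impI ballI)
        fix u v assume "\<forall>e\<in>edges (component ?F r). 0 \<le> emark (component ?F r) e"
          and uv: "(r, u) \<in> (adj ?F)\<^sup>*" "(u, v) \<in> adj ?F"
        moreover have "{u, v} \<in> edges (component ?F r)" using uv Eiff by blast
        ultimately show "0 \<le> C {u, v}" by (metis component_simps(4) finite_model_simps(3))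
      next
        fix e assume *: "\<forall>u v. (r, u) \<in> (adj ?F)\<^sup>* \<longrightarrow> (u, v) \<in> adj ?F \<longrightarrow> 0 \<le> C {u, v}"
          and "e \<in> edges (component ?F r)"
        then obtain u v where "e = {u, v}" "(r, u) \<in> (adj ?F)\<^sup>*" "(u, v) \<in> adj ?F" using Eiff by blast
        with * have "0 \<le> C e" by blast
        then show "0 \<le> emark (component ?F r) e" by simp
      qed
    qed
    ultimately show ?thesis unfolding is_network_def by auto
  qed
  moreover have "connected_network (component ?F r)" by (rule connected_component) (use r in simp)
  moreover have "locally_finite (component ?F r)" unfolding locally_finite_def
  proof
    fix v
    have "{u. (v, u) \<in> adj (component ?F r)} \<subseteq> {1..n}"
      using r by (auto simp: adj_component adj_finite_model)
    then show "finite {u. (v, u) \<in> adj (component ?F r)}" by (rule finite_subset) simp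
  qed
  ultimately show ?thesis by (auto simp: clf_network_def)
qed

section \<open>Measurability of the finite model\<close>

abbreviation cost_space :: "nat \<Rightarrow> (nat set \<Rightarrow> real) measure" where
  "cost_space n \<equiv> PiM (pairs n) (\<lambda>_. borel)"

lemma measurable_cost [measurable]:
  "(\<lambda>C. C e) \<in> borel_measurable (cost_space n)"
proof (cases "e \<in> pairs n")
  case False
  have "(\<lambda>_. undefined :: real) \<in> borel_measurable (cost_space n)" by simp
  then show ?thesis
    by (rule measurable_cong[THEN iffD2, rotated]) (use False in \<open>auto simp: space_PiM PiE_def extensional_def\<close>)
qed simp

text \<open>The threshold is at most \<open>a\<close> iff some set of \<open>Suc (d i)\<close> other
  vertices has all its costs at most \<open>a\<close>, which is a finite union of measurable
  events.\<close>

lemma measurable_threshold: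
  assumes i: "i \<in> {1..n}" and d: "d i < n - 1"
  shows "(\<lambda>C. threshold n d C i) \<in> borel_measurable (cost_space n)"
proof (rule borel_measurableI_le)
  fix a :: real
  have *: "threshold n d C i \<le> a \<longleftrightarrow>
      (\<exists>S\<in>{S. S \<subseteq> {1..n} - {i} \<and> card S = Suc (d i)}. \<forall>j\<in>S. C {i, j} \<le> a)" for C
  proof -
    have "threshold n d C i \<le> a \<longleftrightarrow> Suc (d i) \<le> card {j \<in> {1..n}. j \<noteq> i \<and> C {i, j} \<le> a}"
      by (simp add: threshold_le_iff[where n = n and d = d and i = i, OF i d] Suc_le_eq)
    also have "\<dots> \<longleftrightarrow> (\<exists>S\<in>{S. S \<subseteq> {1..n} - {i} \<and> card S = Suc (d i)}. \<forall>j\<in>S. C {i, j} \<le> a)"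
    proof
      assume "Suc (d i) \<le> card {j \<in> {1..n}. j \<noteq> i \<and> C {i, j} \<le> a}"
      then obtain S where "S \<subseteq> {j \<in> {1..n}. j \<noteq> i \<and> C {i, j} \<le> a}" "card S = Suc (d i)"
        by (meson obtain_subset_with_card_n)
      then show "\<exists>S\<in>{S. S \<subseteq> {1..n} - {i} \<and> card S = Suc (d i)}. \<forall>j\<in>S. C {i, j} \<le> a"
        by (intro bexI[of _ S]) auto
    next
      assume "\<exists>S\<in>{S. S \<subseteq> {1..n} - {i} \<and> card S = Suc (d i)}. \<forall>j\<in>S. C {i, j} \<le> a"
      then obtain S where S: "S \<subseteq> {j \<in> {1..n}. j \<noteq> i \<and> C {i, j} \<le> a}" "card S = Suc (d i)" by blast
      have "card S \<le> card {j \<in> {1..n}. j \<noteq> i \<and> C {i, j} \<le> a}"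
        by (rule card_mono[OF _ S(1)]) simp
      then show "Suc (d i) \<le> card {j \<in> {1..n}. j \<noteq> i \<and> C {i, j} \<le> a}" using S(2) by simp
    qed
    finally show ?thesis .
  qed
  have "Measurable.pred (cost_space n)
      (\<lambda>C. \<exists>S\<in>{S. S \<subseteq> {1..n} - {i} \<and> card S = Suc (d i)}. \<forall>j\<in>S. C {i, j} \<le> a)"
  proof (rule pred_intros_finite)
    show "finite {S. S \<subseteq> {1..n} - {i} \<and> card S = Suc (d i)}"
      by (rule finite_subset[of _ "Pow {1..n}"]) auto
    fix S assume "S \<in> {S. S \<subseteq> {1..n} - {i} \<and> card S = Suc (d i)}"
    then have "finite S" by (auto dest: finite_subset)
    then show "Measurable.pred (cost_space n) (\<lambda>C. \<forall>j\<in>S. C {i, j} \<le> a)"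
      by (rule pred_intros_finite) measurable
  qed
  then show "{C \<in> space (cost_space n). threshold n d C i \<le> a} \<in> sets (cost_space n)"
    unfolding * by (simp add: pred_def)
qed

lemma measurable_gclass_finite_model:
  assumes r: "r \<in> {1..n}" and d: "\<And>i. i \<in> {1..n} \<Longrightarrow> d i < n - 1"
  shows "(\<lambda>C. gclass (component (finite_model n d C) r)) \<in> borel_measurable (cost_space n)"
proof -
  let ?M = "cost_space n"
  let ?F = "finite_model n d"
  have thr [measurable]: "i \<in> {1..n} \<Longrightarrow> (\<lambda>C. threshold n d C i) \<in> borel_measurable ?M" for i
    by (rule measurable_threshold) (use d in auto)
  have adj [measurable]: "Measurable.pred ?M (\<lambda>C. (u, v) \<in> adj (?F C))" for u v
  proof (cases "u \<in> {1..n} \<and> v \<in> {1..n}")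
    case True
    then have [measurable]: "(\<lambda>C. threshold n d C u) \<in> borel_measurable ?M" "(\<lambda>C. threshold n d C v) \<in> borel_measurable ?M"
      using thr by auto
    show ?thesis unfolding adj_finite_model potential_nbrs_def mem_Collect_eq by measurable
  next
    case False
    then have "(u, v) \<notin> adj (?F C)" for C unfolding adj_finite_model by blast
    then show ?thesis by simp
  qed
  have reach [measurable]: "Measurable.pred ?M (\<lambda>C. (r, v) \<in> (adj (?F C))\<^sup>*)" for v
    by (rule measurable_rtrancl) (rule adj)
  have rv: "v \<in> {1..n}" if "(r, v) \<in> (adj (?F C))\<^sup>*" for v C
    using that by (induction rule: rtrancl_induct) (use r in \<open>auto simp: adj_finite_model\<close>)
  \<comment> \<open>\<open>borel_measurable_gclass\<close> asks for measurable marks at every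
    natural number, whereas \<open>threshold\<close> is controlled only on \<open>{1..n}\<close>.
    The value 0 elsewhere leaves the class unchanged, as no such number is a vertex.\<close>
  define thr' where "thr' C v = (if v \<in> {1..n} then threshold n d C v else 0)" for C v
  have thr' [measurable]: "(\<lambda>C. thr' C v) \<in> borel_measurable ?M" for v
    unfolding thr'_def using thr[of v] by (cases "v \<in> {1..n}") auto
  define N where "N C = (component (?F C) r)\<lparr>vmark := (\<lambda>v. (d v, thr' C v))\<rparr>" for C
  have N_simps: "root_vertex (N C) = r" "adj (N C) = adj (component (?F C) r)"
    "vmark (N C) v = (d v, thr' C v)" "emark (N C) = C" for C v
    by (auto simp: N_def adj_def finite_model_def)
  have clf: "clf_network (component (?F C) r) \<longleftrightarrow>
      (\<forall>v. (r, v) \<in> (adj (?F C))\<^sup>* \<longrightarrow> 1 \<le> d v \<and> 0 \<le> thr' C v) \<and>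
      (\<forall>u v. (r, u) \<in> (adj (?F C))\<^sup>* \<longrightarrow> (u, v) \<in> adj (?F C) \<longrightarrow> 0 \<le> C {u, v})" for C
    unfolding clf_component_finite_model_iff[OF r] thr'_def using rv[of _ C] by auto
  have clfN: "clf_network (N C) \<longleftrightarrow> clf_network (component (?F C) r)" for C
  proof -
    have "is_network (N C) \<longleftrightarrow> is_network (component (?F C) r)"
      unfolding is_network_def N_def thr'_def using rv[of _ C] by auto
    then show ?thesis
      unfolding clf_network_def connected_network_def locally_finite_def N_simps(2)
      by (simp add: N_def)
  qed
  have gN: "gclass (N C) = gclass (component (?F C) r)" for C
  proof (cases "clf_network (component (?F C) r)")
    case True
    have iso: "network_iso (N C) (component (?F C) r)" unfolding network_iso_def
      by (rule exI[of _ id]) (use rv[of _ C] in \<open>auto simp: N_def thr'_def\<close>)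
    have "nat_reps (N C) = nat_reps (component (?F C) r)"
      unfolding nat_reps_def using True clfN[of C]
        clf_iso_trans[OF _ iso] clf_iso_trans[OF True clf_iso_sym[OF _ True iso]] by blast
    then show ?thesis by (simp add: gclass_def)
  qed (simp add: gclass_def nat_reps_def clfN)
  have "(\<lambda>C. gclass (N C)) \<in> borel_measurable ?M"
  proof (rule borel_measurable_gclass[where r = r])
    show "Measurable.pred ?M (\<lambda>C. clf_network (N C))"
      unfolding clfN clf by measurable
    show "Measurable.pred ?M (\<lambda>C. (u, v) \<in> adj (N C))" for u v
      unfolding N_simps(2) using r by (simp add: adj_component)
  qed (simp_all add: N_simps)
  then show ?thesis by (simp add: gN)
qed

section \<open>Tree-shaped explorations and their labellings\<close>

text \<open>\<open>T\<close> counts explored generations: nodes at depth below \<open>T\<close>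
  reveal costs, nodes at depth \<open>T\<close> are merely reached.\<close>

definition inner_nodes :: "nat \<Rightarrow> (nat list \<Rightarrow> nat) \<Rightarrow> nat list set" where
  "inner_nodes T m = {w \<in> nodes m. length w < T}"

text \<open>The child index \<open>0\<close>, unused in the tree, stands for the vertex realising the threshold.
  An explored vertex other than the root is identified with the edge to its parent.\<close>

definition explored :: "nat \<Rightarrow> (nat list \<Rightarrow> nat) \<Rightarrow> nat list set" where
  "explored T m = {w @ [j] | w j. w \<in> inner_nodes T m \<and> j \<le> m w}"

abbreviation tree_verts :: "nat \<Rightarrow> (nat list \<Rightarrow> nat) \<Rightarrow> nat list set" where
  "tree_verts T m \<equiv> insert [] (explored T m)"

text \<open>The tree neighbours of \<open>w\<close>, including the parent whether or not its edge
  will survive. If it survives, their labels are exactly the potential neighbours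
  (\<open>explores_kept\<close>).\<close>

definition nbr_nodes :: "(nat list \<Rightarrow> nat) \<Rightarrow> nat list \<Rightarrow> nat list set" where
  "nbr_nodes m w = (\<lambda>j. w @ [j]) ` {1..m w} \<union> (if w = [] then {} else {butlast w})"

text \<open>Only inner nodes have a prescribed degree, in which \<open>+ 1\<close> counts the
  parent. Leaves and the threshold vertices \<open>w @ [0]\<close> may have any degree, but their
  labels must differ from all others.\<close>

definition labellings :: "nat \<Rightarrow> (nat \<Rightarrow> nat) \<Rightarrow> nat \<Rightarrow> (nat list \<Rightarrow> nat) \<Rightarrow> (nat list \<Rightarrow> nat) set" where
  "labellings n d T m = {\<phi> \<in> tree_verts T m \<rightarrow>\<^sub>E {1..n}. inj_on \<phi> (tree_verts T m) \<and>
     (\<forall>w\<in>inner_nodes T m. d (\<phi> w) = (if w = [] then m w else m w + 1))}"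

text \<open>The parent is exempt from both clauses: it lies in \<open>nbr_nodes\<close> but is not a
  child. Its cost may fall on either side of the threshold, which is the freedom that thinning uses.
  Strict inequalities make the children and the threshold vertex unique.\<close>

definition explores :: "nat \<Rightarrow> (nat set \<Rightarrow> real) \<Rightarrow> nat \<Rightarrow> (nat list \<Rightarrow> nat) \<Rightarrow> (nat list \<Rightarrow> nat) \<Rightarrow> bool" where
  "explores n C T m \<phi> \<longleftrightarrow> (\<forall>w\<in>inner_nodes T m.
     (\<forall>j\<in>{1..m w}. C {\<phi> w, \<phi> (w @ [j])} < C {\<phi> w, \<phi> (w @ [0])}) \<and>
     (\<forall>x\<in>{1..n} - {\<phi> w, \<phi> (w @ [0])} - \<phi> ` nbr_nodes m w. C {\<phi> w, \<phi> (w @ [0])} < C {\<phi> w, x}))"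

lemma inner_snoc: "w @ [j] \<in> inner_nodes T m \<longleftrightarrow> w \<in> inner_nodes T m \<and> Suc (length w) < T \<and> 1 \<le> j \<and> j \<le> m w"
  by (auto simp: inner_nodes_def nodes_snoc)

lemma explored_snoc: "w @ [j] \<in> explored T m \<longleftrightarrow> w \<in> inner_nodes T m \<and> j \<le> m w"
  by (auto simp: explored_def)

lemma Nil_inner: "0 < T \<Longrightarrow> [] \<in> inner_nodes T m"
  by (simp add: inner_nodes_def nodes_root)

lemma inner_subset: "inner_nodes T m \<subseteq> tree_verts T m"
proof
  fix w assume "w \<in> inner_nodes T m"
  then show "w \<in> tree_verts T m"
    by (cases w rule: rev_cases) (auto simp: inner_snoc explored_snoc)
qed

lemma butlast_inner: "w \<in> inner_nodes T m \<Longrightarrow> w \<noteq> [] \<Longrightarrow> butlast w \<in> inner_nodes T m"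
  by (cases w rule: rev_cases) (auto simp: inner_snoc)

lemma nbr_nodes_subset: "w \<in> inner_nodes T m \<Longrightarrow> nbr_nodes m w \<subseteq> tree_verts T m"
proof -
  assume w: "w \<in> inner_nodes T m"
  then have "(\<lambda>j. w @ [j]) ` {1..m w} \<subseteq> explored T m"
    by (intro image_subsetI) (use explored_snoc in auto)
  with w show ?thesis
    using inner_subset[of T m] butlast_inner[of w T m] by (auto simp: nbr_nodes_def)
qed

lemma nbr_nodes_notin: "w \<notin> nbr_nodes m w" "w @ [0] \<notin> nbr_nodes m w"
proof -
  have "w \<noteq> butlast w" if "w \<noteq> []" using that by (cases w rule: rev_cases) auto
  then show "w \<notin> nbr_nodes m w" by (auto simp: nbr_nodes_def)
  show "w @ [0] \<notin> nbr_nodes m w" by (auto simp: nbr_nodes_def dest: arg_cong[of _ _ length])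
qed

lemma nbr_nodes_inner:
  "w @ [j] \<in> inner_nodes T m \<Longrightarrow> w @ [j] \<in> nbr_nodes m w \<and> w \<in> nbr_nodes m (w @ [j])"
  unfolding nbr_nodes_def inner_snoc by simp

lemma finite_nbr_nodes: "finite (nbr_nodes m w)"
  by (simp add: nbr_nodes_def)

lemma card_nbr_nodes: "card (nbr_nodes m w) = (if w = [] then m w else m w + 1)"
proof -
  have 1: "card ((\<lambda>j. w @ [j]) ` {1..m w}) = m w" by (subst card_image) (auto simp: inj_on_def)
  have "butlast w \<notin> (\<lambda>j. w @ [j]) ` {1..m w}" by (auto dest: arg_cong[of _ _ length])
  with 1 show ?thesis unfolding nbr_nodes_def by (cases "w = []") (simp_all del: append_Nil)
qed

lemma labellingsD:
  assumes "\<phi> \<in> labellings n d T m"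
  shows "inj_on \<phi> (tree_verts T m)"
    and "x \<in> tree_verts T m \<Longrightarrow> \<phi> x \<in> {1..n}"
    and "w \<in> inner_nodes T m \<Longrightarrow> d (\<phi> w) = (if w = [] then m w else m w + 1)"
  using assms by (auto simp: labellings_def)

lemma labellings_nbr_nodes:
  assumes \<phi>: "\<phi> \<in> labellings n d T m" and w: "w \<in> inner_nodes T m"
  shows "\<phi> w \<in> {1..n}" "\<phi> ` nbr_nodes m w \<subseteq> {1..n} - {\<phi> w}" "card (\<phi> ` nbr_nodes m w) = d (\<phi> w)"
    "\<phi> (w @ [0]) \<in> {1..n} - {\<phi> w} - \<phi> ` nbr_nodes m w"
proof -
  note inj = labellingsD(1)[OF \<phi>] and range = labellingsD(2)[OF \<phi>]
  have V: "w \<in> tree_verts T m" "w @ [0] \<in> tree_verts T m"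
    using w inner_subset by (auto simp: explored_snoc)
  note sub = nbr_nodes_subset[OF w]
  show "\<phi> w \<in> {1..n}" by (rule range[OF V(1)])
  have "\<phi> w \<notin> \<phi> ` nbr_nodes m w" "\<phi> (w @ [0]) \<notin> \<phi> ` nbr_nodes m w"
    using nbr_nodes_notin[of w m] inj_on_image_mem_iff[OF inj V(1) sub] inj_on_image_mem_iff[OF inj V(2) sub]
    by auto
  moreover have "\<phi> (w @ [0]) \<noteq> \<phi> w" using inj_on_eq_iff[OF inj V(2) V(1)] by simp
  moreover have "\<phi> ` nbr_nodes m w \<subseteq> {1..n}" using range sub by blast
  ultimately show "\<phi> ` nbr_nodes m w \<subseteq> {1..n} - {\<phi> w}" "\<phi> (w @ [0]) \<in> {1..n} - {\<phi> w} - \<phi> ` nbr_nodes m w"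
    using range[OF V(2)] by blast+
  show "card (\<phi> ` nbr_nodes m w) = d (\<phi> w)"
    using card_image[OF inj_on_subset[OF inj sub]] card_nbr_nodes[of m w] labellingsD(3)[OF \<phi> w] by simp
qed

section \<open>From an exploration to agreement of balls\<close>

context
  fixes n :: nat and d :: "nat \<Rightarrow> nat" and T m \<phi> C
  assumes d: "\<And>i. i \<in> {1..n} \<Longrightarrow> d i < n - 1"
    and \<phi>: "\<phi> \<in> labellings n d T m" and ex: "explores n C T m \<phi>"
begin

text \<open>With the parent also cheaper than \<open>w @ [0]\<close>, the labels of
  \<open>nbr_nodes m w\<close> are as many as the degree, are the cheapest, and are followed by the
  label of \<open>w @ [0]\<close>; so \<open>threshold_eqI\<close> applies.\<close>

lemma explores_kept:
  assumes w: "w \<in> inner_nodes T m" and k: "w = [] \<or> C {\<phi> (butlast w), \<phi> w} < C {\<phi> w, \<phi> (w @ [0])}"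
  shows "threshold n d C (\<phi> w) = C {\<phi> w, \<phi> (w @ [0])}"
    and "potential_nbrs n d C (\<phi> w) = \<phi> ` nbr_nodes m w"
proof -
  note f = labellings_nbr_nodes[OF \<phi> w]
  have lt: "C {\<phi> w, x} < C {\<phi> w, \<phi> (w @ [0])}" if "x \<in> \<phi> ` nbr_nodes m w" for x
    using that ex w k by (auto simp: explores_def nbr_nodes_def insert_commute split: if_splits)
  have gt: "C {\<phi> w, \<phi> (w @ [0])} \<le> C {\<phi> w, x}" if "x \<in> {1..n} - {\<phi> w} - \<phi> ` nbr_nodes m w" for x
    using that ex w by (cases "x = \<phi> (w @ [0])") (auto simp: explores_def intro: less_imp_le)
  show "threshold n d C (\<phi> w) = C {\<phi> w, \<phi> (w @ [0])}"
    by (rule threshold_eqI(1)[where n = n and d = d and C = C and i = "\<phi> w" and k = "\<phi> (w @ [0])" and X = "\<phi> ` nbr_nodes m w",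
        OF f(1) d[OF f(1)] f(2,3,4) lt gt])
  show "potential_nbrs n d C (\<phi> w) = \<phi> ` nbr_nodes m w"
    by (rule threshold_eqI(2)[where n = n and d = d and C = C and i = "\<phi> w" and k = "\<phi> (w @ [0])" and X = "\<phi> ` nbr_nodes m w",
        OF f(1) d[OF f(1)] f(2,3,4) lt gt])
qed

text \<open>Children, threshold vertex and parent are together one more than the degree, and none
  costs more than the edge to the parent; so the threshold is at most that cost. The true threshold
  need not be the explored one here, but all that matters is that adjacency to the parent
  fails.\<close>

lemma explores_not_kept:
  assumes w: "w \<in> inner_nodes T m" and "w \<noteq> []" and k: "C {\<phi> w, \<phi> (w @ [0])} \<le> C {\<phi> (butlast w), \<phi> w}"
  shows "\<phi> (butlast w) \<notin> potential_nbrs n d C (\<phi> w)"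
proof -
  note f = labellings_nbr_nodes[OF \<phi> w]
  let ?c = "C {\<phi> (butlast w), \<phi> w}"
  have "insert (\<phi> (w @ [0])) (\<phi> ` nbr_nodes m w) \<subseteq> {j \<in> {1..n}. j \<noteq> \<phi> w \<and> C {\<phi> w, j} \<le> ?c}" (is "?A \<subseteq> ?B")
  proof -
    have "C {\<phi> w, \<phi> x} \<le> ?c" if x: "x \<in> nbr_nodes m w" for x
    proof (cases "x = butlast w")
      case False
      then obtain j where "j \<in> {1..m w}" "x = w @ [j]" using x \<open>w \<noteq> []\<close> by (auto simp: nbr_nodes_def)
      then have "C {\<phi> w, \<phi> x} < C {\<phi> w, \<phi> (w @ [0])}" using ex w by (simp add: explores_def)
      with k show ?thesis by simp
    qed (simp add: insert_commute)
    with f k show ?thesis by auto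
  qed
  then have "card ?A \<le> card ?B" by (rule card_mono[rotated]) simp
  moreover have "card ?A = Suc (d (\<phi> w))"
    using f finite_nbr_nodes by (subst card_insert_disjoint) auto
  ultimately have "threshold n d C (\<phi> w) \<le> ?c"
    using threshold_le_iff[where n = n and d = d and i = "\<phi> w", OF f(1) d[OF f(1)]] by simp
  then show ?thesis by (simp add: potential_nbrs_def insert_commute)
qed

text \<open>Marks and potential neighbours of a kept node are read off by
  \<open>explores_kept\<close>. An edge to a child belongs to the finite model iff the selection is
  mutual, and from the side of the child this is the thinning rule.\<close>

lemma explores_agree:
  assumes T: "T = Suc (Suc t)"
    and c: "clf_network (ewt \<omega>)" "clf_network (component (finite_model n d C) (\<phi> []))"
    and nd: "\<And>w. w \<in> inner_nodes T m \<Longrightarrow> ewt_n \<omega> w = m w"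
    and vd: "\<And>w. w \<in> inner_nodes T m \<Longrightarrow> ewt_v \<omega> w = C {\<phi> w, \<phi> (w @ [0])}"
    and cd: "\<And>w j. w \<in> inner_nodes T m \<Longrightarrow> j \<in> {1..m w} \<Longrightarrow> ewt_cost \<omega> w j = C {\<phi> w, \<phi> (w @ [j])}"
  shows "agree (real t) (ewt \<omega>) (component (finite_model n d C) (\<phi> []))"
proof -
  let ?F = "finite_model n d C"
  have kin: "w \<in> kept \<omega> \<Longrightarrow> length w < T \<Longrightarrow> w \<in> inner_nodes T m" for w
  proof (induction w rule: rev_induct)
    case (snoc j w)
    then have "w \<in> inner_nodes T m" by (auto simp: kept_snoc)
    with snoc.prems nd[OF this] show ?case by (auto simp: kept_snoc inner_snoc)
  qed (simp add: Nil_inner T)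
  have kept_lt: "w = [] \<or> C {\<phi> (butlast w), \<phi> w} < C {\<phi> w, \<phi> (w @ [0])}"
    if w: "w \<in> kept \<omega>" "length w < T" for w
  proof (cases w rule: rev_cases)
    case (snoc u j)
    have u: "u \<in> inner_nodes T m" "j \<in> {1..m u}" using kin[OF w] snoc by (auto simp: inner_snoc)
    have "ewt_cost \<omega> u j < ewt_v \<omega> w" using w(1) snoc by (simp add: kept_snoc)
    then show ?thesis using cd[OF u] vd[OF kin[OF w]] snoc by simp
  qed simp
  note K = explores_kept[OF kin kept_lt]
  have r: "\<phi> [] \<in> {1..n}" by (rule labellingsD(2)[OF \<phi>]) simp
  have adjF: "(u, v) \<in> adj ?F \<longleftrightarrow> u \<in> potential_nbrs n d C v \<and> v \<in> potential_nbrs n d C u" for u v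
    by (auto simp: adj_finite_model potential_nbrs_def)
  have sub: "{x. (w, x) \<in> adj (ewt \<omega>)} \<subseteq> tree_verts T m"
    if w: "w \<in> kept \<omega>" "length w \<le> t" for w
  proof
    fix x assume "x \<in> {x. (w, x) \<in> adj (ewt \<omega>)}"
    then have "x \<in> kept \<omega>" "length x < T" using w T by (auto simp: adj_ewt)
    then show "x \<in> tree_verts T m" using kin inner_subset by blast
  qed
  show ?thesis
  proof (rule agree_local[OF c, where \<sigma> = \<phi> and Y = "tree_verts T m"])
    show "0 \<le> real t" by simp
    show "\<phi> (root_vertex (ewt \<omega>)) = root_vertex (component ?F (\<phi> []))" by (simp add: root_ewt)
    show "inj_on \<phi> (tree_verts T m)" by (rule labellingsD(1)[OF \<phi>])
    show "nball (ewt \<omega>) (real t) \<subseteq> tree_verts T m"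
    proof
      fix w assume "w \<in> nball (ewt \<omega>) (real t)"
      from nball_ewt[OF c(1) this] have "w \<in> inner_nodes T m" using T kin by simp
      then show "w \<in> tree_verts T m" using inner_subset by blast
    qed
    fix w assume wb: "w \<in> nball (ewt \<omega>) (real t)"
    note w = nball_ewt[OF c(1) wb]
    then have wT: "length w < T" "Suc (length w) < T" using T by auto
    note win = kin[OF w(1) wT(1)]
    note Kw = K[OF w(1) wT(1) w(1) wT(1)]
    show "x \<in> tree_verts T m" if "(w, x) \<in> adj (ewt \<omega>)" for x
      using sub[OF w] that by blast
    show "emark (component ?F (\<phi> [])) {\<phi> w, \<phi> x} = emark (ewt \<omega>) {w, x}" if x: "(w, x) \<in> adj (ewt \<omega>)" for x
    proof -
      from x obtain j where j: "x = w @ [j] \<or> w = x @ [j]" "x \<in> kept \<omega>" by (auto simp: adj_ewt)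
      obtain u where uj: "{w, x} = {u, u @ [j]}" "length u \<le> t" "u @ [j] \<in> kept \<omega>"
          "{\<phi> w, \<phi> x} = {\<phi> u, \<phi> (u @ [j])}"
      proof (cases "x = w @ [j]")
        case True
        with that[of w] w j show ?thesis by simp
      next
        case False
        with that[of x] w j show ?thesis by (simp add: insert_commute)
      qed
      have "u @ [j] \<in> inner_nodes T m" using uj T by (intro kin) auto
      then have "u \<in> inner_nodes T m" "j \<in> {1..m u}" by (auto simp: inner_snoc)
      from cd[OF this] show ?thesis unfolding uj(1,4) by (simp add: emark_ewt_snoc)
    qed
    show "vmark (component ?F (\<phi> [])) (\<phi> w) = vmark (ewt \<omega>) w"
      using Kw(1) labellingsD(3)[OF \<phi> win] nd[OF win] vd[OF win] by (cases "w = []") (simp_all add: vmark_ewt)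
    assume "\<phi> w \<in> verts (component ?F (\<phi> []))"
    then have adjw: "(\<phi> w, x') \<in> adj (component ?F (\<phi> [])) \<longleftrightarrow> (\<phi> w, x') \<in> adj ?F" for x'
      using r by (simp add: adj_component)
    show "{x'. (\<phi> w, x') \<in> adj (component ?F (\<phi> []))} = \<phi> ` {x. (w, x) \<in> adj (ewt \<omega>)}"
    proof (intro equalityI subsetI)
      fix x' assume "x' \<in> {x'. (\<phi> w, x') \<in> adj (component ?F (\<phi> []))}"
      then have x': "x' \<in> potential_nbrs n d C (\<phi> w)" "\<phi> w \<in> potential_nbrs n d C x'"
        by (auto simp: adjw adjF)
      then obtain x where x: "x' = \<phi> x" "x \<in> nbr_nodes m w" using Kw(2) by auto
      have "(w, x) \<in> adj (ewt \<omega>)"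
      proof (cases "w \<noteq> [] \<and> x = butlast w")
        case True
        then show ?thesis using w(1) by (cases w rule: rev_cases) (auto simp: adj_ewt kept_snoc)
      next
        case False
        then obtain j where j: "x = w @ [j]" "j \<in> {1..m w}" using x(2) by (auto simp: nbr_nodes_def split: if_splits)
        have xin: "x \<in> inner_nodes T m" using win wT j by (auto simp: inner_snoc)
        \<comment> \<open>Adjacency also requires \<open>\<phi> w\<close> to be a potential
          neighbour of \<open>\<phi> x\<close>; \<open>explores_not_kept\<close> forbids this unless
          the edge cost is below the explored threshold at \<open>x\<close>.\<close>
        have "C {\<phi> (butlast x), \<phi> x} < C {\<phi> x, \<phi> (x @ [0])}"
        proof (rule ccontr)
          assume "\<not> ?thesis"
          then have "\<phi> (butlast x) \<notin> potential_nbrs n d C (\<phi> x)"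
            using xin j by (intro explores_not_kept) auto
          then show False using x' x j by simp
        qed
        then have "ewt_cost \<omega> w j < ewt_v \<omega> x" using cd[OF win j(2)] vd[OF xin] j by simp
        then have "x \<in> kept \<omega>" using w(1) j nd[OF win] by (simp add: kept_snoc)
        then show ?thesis using w(1) j by (simp add: adj_ewt)
      qed
      then show "x' \<in> \<phi> ` {x. (w, x) \<in> adj (ewt \<omega>)}" using x(1) by blast
    next
      fix x' assume "x' \<in> \<phi> ` {x. (w, x) \<in> adj (ewt \<omega>)}"
      then obtain x where x: "x' = \<phi> x" "(w, x) \<in> adj (ewt \<omega>)" by blast
      then have xk: "x \<in> kept \<omega>" "length x < T" using w T by (auto simp: adj_ewt)
      have nb: "x \<in> nbr_nodes m w \<and> w \<in> nbr_nodes m x"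
      proof -
        from x(2) obtain j where "x = w @ [j] \<or> w = x @ [j]" by (auto simp: adj_ewt)
        then show ?thesis using kin[OF xk] win nbr_nodes_inner by blast
      qed
      show "x' \<in> {x'. (\<phi> w, x') \<in> adj (component ?F (\<phi> []))}"
        unfolding mem_Collect_eq adjw adjF x(1) Kw(2) K(2)[OF xk xk] using nb by blast
    qed
  qed
qed

end

section \<open>Orderings of the children\<close>

text \<open>If the costs of \<open>k\<close> and \<open>l\<close> differed, the set below the larger
  one would contain the other set together with its successor, one element too many. Consequently an
  exploration is forced by the costs up to the order in which children are listed.\<close>

lemma lower_set_unique:
  fixes c :: "'a \<Rightarrow> real"
  assumes fin: "finite X" and card: "card A = card B"
    and A: "A \<subseteq> X" "k \<in> X - A" "\<And>x. x \<in> A \<Longrightarrow> c x < c k" "\<And>x. x \<in> X - A - {k} \<Longrightarrow> c k < c x"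
    and B: "B \<subseteq> X" "l \<in> X - B" "\<And>x. x \<in> B \<Longrightarrow> c x < c l" "\<And>x. x \<in> X - B - {l} \<Longrightarrow> c l < c x"
  shows "A = B" "k = l"
proof -
  have less: False
    if "c k < c l" "card A = card B" and A: "A \<subseteq> X" "k \<in> X - A" "\<And>x. x \<in> A \<Longrightarrow> c x < c k"
      and B: "B \<subseteq> X" "\<And>x. x \<in> X - B - {l} \<Longrightarrow> c l < c x" for A B k l
  proof -
    have "insert k A \<subseteq> B"
    proof
      fix x assume "x \<in> insert k A"
      then have "x \<in> X" "c x < c l" using that(1) A(1,2) A(3)[of x] by auto
      then show "x \<in> B" using B(2)[of x] by (cases "x = l") auto
    qed
    then have "card (insert k A) \<le> card B" using finite_subset[OF B(1) fin] by (rule card_mono[rotated])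
    then show False using A(2) finite_subset[OF A(1) fin] that(2) by simp
  qed
  have "\<not> c k < c l" using less[of k l A B] card A(1-3) B(1,4) by blast
  moreover have "\<not> c l < c k" using less[of l k B A] card[symmetric] B(1-3) A(1,4) by blast
  ultimately have eq: "c k = c l" by simp
  show "k = l"
  proof (rule ccontr)
    assume "k \<noteq> l"
    then show False using A(2) B(3)[of k] B(4)[of k] eq by force
  qed
  show "A = B"
  proof -
    have *: "A = {x \<in> X. c x < c k}"
      if "A \<subseteq> X" "\<And>x. x \<in> A \<Longrightarrow> c x < c k" "\<And>x. x \<in> X - A - {k} \<Longrightarrow> c k < c x" for A k
    proof (intro equalityI subsetI)
      fix x assume "x \<in> {x \<in> X. c x < c k}"
      then show "x \<in> A" using that(3)[of x] by (cases "x = k") auto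
    qed (use that in auto)
    show ?thesis using *[OF A(1,3,4)] *[OF B(1,3,4)] eq by simp
  qed
qed

lemma finite_inner: "finite (inner_nodes T m)" and finite_explored: "finite (explored T m)"
proof -
  have ex: "finite (explored T m)" if "finite (inner_nodes T m)" for T
  proof -
    have "explored T m = (\<Union>w\<in>inner_nodes T m. (\<lambda>j. w @ [j]) ` {..m w})" by (auto simp: explored_def)
    with that show ?thesis by simp
  qed
  show i: "finite (inner_nodes T m)" for T
  proof (induction T)
    case (Suc T)
    have "inner_nodes (Suc T) m \<subseteq> tree_verts T m"
    proof
      fix w assume "w \<in> inner_nodes (Suc T) m"
      then show "w \<in> tree_verts T m"
        by (cases w rule: rev_cases) (auto simp: explored_snoc inner_nodes_def nodes_snoc)
    qed
    then show ?case using ex[OF Suc] by (meson finite_insert finite_subset)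
  qed (simp add: inner_nodes_def)
  show "finite (explored T m)" by (rule ex[OF i])
qed

lemma nodes_cong:
  assumes "\<And>w. w \<in> nodes m \<Longrightarrow> length w < T \<Longrightarrow> m' w = m w" and "length w \<le> T"
  shows "w \<in> nodes m' \<longleftrightarrow> w \<in> nodes m"
  using assms(2)
proof (induction w rule: rev_induct)
  case (snoc j w)
  then show ?case using assms(1)[of w] by (auto simp: nodes_snoc)
qed (simp add: nodes_root)

lemma nbr_nodes_cong: "m w = m' w \<Longrightarrow> nbr_nodes m w = nbr_nodes m' w"
  by (simp add: nbr_nodes_def)

section \<open>Shapes, pruning and weighted counts\<close>

text \<open>A normal form: vanishing off the inner nodes gives each truncated tree a single
  representing function, so that sums over shapes count it once.\<close>

definition shapes :: "nat \<Rightarrow> (nat list \<Rightarrow> nat) set" where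
  "shapes T = {m. \<forall>w. w \<notin> inner_nodes T m \<longrightarrow> m w = 0}"

definition tree_weight :: "nat \<Rightarrow> (nat list \<Rightarrow> nat) \<Rightarrow> real" where
  "tree_weight T m = (\<Prod>w\<in>inner_nodes T m. 1 / fact (m w))"

definition explorations ::
  "nat \<Rightarrow> (nat \<Rightarrow> nat) \<Rightarrow> (nat set \<Rightarrow> real) \<Rightarrow> nat \<Rightarrow> nat \<Rightarrow> ((nat list \<Rightarrow> nat) \<times> (nat list \<Rightarrow> nat)) set" where
  "explorations n d C r T =
     {(m, \<phi>). m \<in> shapes T \<and> \<phi> \<in> labellings n d T m \<and> \<phi> [] = r \<and> explores n C T m \<phi>}"

text \<open>Forgets the last generation; zeroing \<open>m\<close> and restricting
  \<open>\<phi>\<close> keep the result in normal form.\<close>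

definition prune :: "nat \<Rightarrow> (nat list \<Rightarrow> nat) \<times> (nat list \<Rightarrow> nat) \<Rightarrow> (nat list \<Rightarrow> nat) \<times> (nat list \<Rightarrow> nat)" where
  "prune T = (\<lambda>(m, \<phi>). (\<lambda>w. if w \<in> inner_nodes T m then m w else 0, restrict \<phi> (tree_verts T m)))"

lemma prune_nodes:
  assumes m': "m' = (\<lambda>w. if w \<in> inner_nodes T m then m w else 0)"
  shows "length w \<le> T \<Longrightarrow> w \<in> nodes m' \<longleftrightarrow> w \<in> nodes m"
    and "inner_nodes T m' = inner_nodes T m" and "explored T m' = explored T m"
    and "w \<in> inner_nodes T m \<Longrightarrow> m' w = m w"
proof -
  show n: "length w \<le> T \<Longrightarrow> w \<in> nodes m' \<longleftrightarrow> w \<in> nodes m" for w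
    by (rule nodes_cong) (auto simp: m' inner_nodes_def)
  then show i: "inner_nodes T m' = inner_nodes T m" by (auto simp: inner_nodes_def)
  show e: "w \<in> inner_nodes T m \<Longrightarrow> m' w = m w" for w by (simp add: m')
  show "explored T m' = explored T m" unfolding explored_def i using e by auto
qed

lemma prune_explorations:
  assumes "(m, \<phi>) \<in> explorations n d C r (Suc T)"
  shows "prune T (m, \<phi>) \<in> explorations n d C r T"
proof -
  define m' where m': "m' = (\<lambda>w. if w \<in> inner_nodes T m then m w else 0)"
  note p = prune_nodes[OF m']
  let ?V = "tree_verts T m"
  let ?\<phi> = "restrict \<phi> ?V"
  have \<phi>: "\<phi> \<in> labellings n d (Suc T) m" "\<phi> [] = r" "explores n C (Suc T) m \<phi>"
    using assms by (auto simp: explorations_def)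
  have sub: "inner_nodes T m \<subseteq> inner_nodes (Suc T) m" "explored T m \<subseteq> explored (Suc T) m"
    by (auto simp: inner_nodes_def explored_def)
  have V: "w \<in> ?V" "w @ [0] \<in> ?V" "j \<in> {1..m w} \<Longrightarrow> w @ [j] \<in> ?V" "nbr_nodes m w \<subseteq> ?V" if "w \<in> inner_nodes T m" for w j
    using that inner_subset[of T m] nbr_nodes_subset[of w T m] explored_snoc[of w _ T m] by auto
  have "m' \<in> shapes T" by (simp add: shapes_def p(2)) (simp add: m')
  moreover have "?\<phi> \<in> labellings n d T m'"
    unfolding labellings_def p(2,3)
  proof (intro CollectI conjI ballI)
    have "\<phi> x \<in> {1..n}" if "x \<in> ?V" for x using labellingsD(2)[OF \<phi>(1), of x] sub that by auto
    then show "?\<phi> \<in> ?V \<rightarrow>\<^sub>E {1..n}" by auto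
    have "inj_on \<phi> ?V" using labellingsD(1)[OF \<phi>(1)] by (rule inj_on_subset) (use sub in auto)
    then show "inj_on ?\<phi> ?V" by (auto simp: inj_on_def)
    fix w assume w: "w \<in> inner_nodes T m"
    show "d (?\<phi> w) = (if w = [] then m' w else m' w + 1)"
      using labellingsD(3)[OF \<phi>(1), of w] V(1)[OF w] p(4)[OF w] sub w by auto
  qed
  moreover have "explores n C T m' ?\<phi>" unfolding explores_def p(2)
  proof (rule ballI)
    fix w assume w: "w \<in> inner_nodes T m"
    note Vw = V[OF w]
    have im: "?\<phi> ` nbr_nodes m' w = \<phi> ` nbr_nodes m w"
      unfolding nbr_nodes_cong[of m' w m, OF p(4)[OF w]] using Vw(4) by (intro image_cong) auto
    have e: "?\<phi> w = \<phi> w" "?\<phi> (w @ [0]) = \<phi> (w @ [0])" "j \<in> {1..m w} \<Longrightarrow> ?\<phi> (w @ [j]) = \<phi> (w @ [j])" for j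
      using Vw by (simp_all del: insert_iff)
    have "w \<in> inner_nodes (Suc T) m" using sub w by blast
    with \<phi>(3) have "(\<forall>j\<in>{1..m w}. C {\<phi> w, \<phi> (w @ [j])} < C {\<phi> w, \<phi> (w @ [0])}) \<and>
      (\<forall>x\<in>{1..n} - {\<phi> w, \<phi> (w @ [0])} - \<phi> ` nbr_nodes m w. C {\<phi> w, \<phi> (w @ [0])} < C {\<phi> w, x})"
      unfolding explores_def by blast
    then show "(\<forall>j\<in>{1..m' w}. C {?\<phi> w, ?\<phi> (w @ [j])} < C {?\<phi> w, ?\<phi> (w @ [0])}) \<and>
      (\<forall>x\<in>{1..n} - {?\<phi> w, ?\<phi> (w @ [0])} - ?\<phi> ` nbr_nodes m' w. C {?\<phi> w, ?\<phi> (w @ [0])} < C {?\<phi> w, x})"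
      unfolding im p(4)[OF w] e(1,2) by (simp add: e(3) del: restrict_apply)
  qed
  ultimately show ?thesis
    using \<phi>(2) unfolding prune_def explorations_def m'[symmetric] by (auto simp: m')
qed

text \<open>One more generation adds no choice but orderings. At a node of depth \<open>T\<close>
  the degree fixes the number of children, and \<open>lower_set_unique\<close> fixes their set and
  the threshold vertex. So there are at most \<Prod> k! extensions, each with an extra weight factor
  \<Prod> 1/k!.\<close>

lemma explorations_fiber:
  assumes y: "(m', \<phi>') \<in> explorations n d C r T"
  defines "F \<equiv> {z \<in> explorations n d C r (Suc T). prune T z = (m', \<phi>')}"
  shows "finite F" "(\<Sum>z\<in>F. tree_weight (Suc T) (fst z)) \<le> tree_weight T m'"
proof -
  define L where "L = {w \<in> nodes m'. length w = T}"
  \<comment> \<open>The number of children forced at a node of the last level: its degree, less one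
    for the parent except at the root.\<close>
  define k where "k w = d (\<phi>' w) - (if w = [] then 0 else 1)" for w
  have facts: "inner_nodes (Suc T) m = inner_nodes T m' \<union> L" "inner_nodes T m = inner_nodes T m'"
      "explored T m = explored T m'"
      "\<And>w. w \<in> inner_nodes T m' \<Longrightarrow> m w = m' w" "\<And>w. w \<in> L \<Longrightarrow> m w = k w" "\<And>x. x \<in> tree_verts T m' \<Longrightarrow> \<phi> x = \<phi>' x"
      "m \<in> shapes (Suc T)" "\<phi> \<in> labellings n d (Suc T) m" "explores n C (Suc T) m \<phi>"
      if z: "(m, \<phi>) \<in> F" for m \<phi>
  proof -
    have m': "m' = (\<lambda>w. if w \<in> inner_nodes T m then m w else 0)"
      and \<phi>': "\<phi>' = restrict \<phi> (tree_verts T m)"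
      using z by (auto simp: F_def prune_def)
    note p = prune_nodes[OF m']
    show i: "inner_nodes (Suc T) m = inner_nodes T m' \<union> L"
      using p(1) by (auto simp: inner_nodes_def L_def less_Suc_eq)
    show "inner_nodes T m = inner_nodes T m'" "explored T m = explored T m'" by (simp_all add: p)
    show "m w = m' w" if "w \<in> inner_nodes T m'" for w using p(2,4) that by simp
    show e: "\<phi> x = \<phi>' x" if "x \<in> tree_verts T m'" for x using \<phi>' p(3) that by simp
    show l: "m \<in> shapes (Suc T)" "\<phi> \<in> labellings n d (Suc T) m" "explores n C (Suc T) m \<phi>"
      using z by (auto simp: F_def explorations_def)
    show "m w = k w" if w: "w \<in> L" for w
    proof -
      have "w \<in> inner_nodes (Suc T) m" using i w by blast
      moreover have "w \<in> tree_verts T m'"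
        using w by (cases w rule: rev_cases) (auto simp: L_def explored_snoc inner_nodes_def nodes_snoc)
      ultimately have "d (\<phi>' w) = (if w = [] then m w else m w + 1)"
        using labellingsD(3)[OF l(2), of w] e[of w] by simp
      then show ?thesis unfolding k_def by (cases "w = []") simp_all
    qed
  qed
  have finL: "finite L"
    by (rule finite_subset[OF _ finite_inner[of "Suc T" m']]) (auto simp: L_def inner_nodes_def)
  have LV: "w \<in> tree_verts T m'" "w \<noteq> [] \<Longrightarrow> butlast w \<in> tree_verts T m'" if "w \<in> L" for w
  proof -
    show "w \<in> tree_verts T m'"
      using that by (cases w rule: rev_cases) (auto simp: L_def explored_snoc inner_nodes_def nodes_snoc)
    show "w \<noteq> [] \<Longrightarrow> butlast w \<in> tree_verts T m'"
      using that inner_subset[of T m']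
      by (cases w rule: rev_cases) (auto simp: L_def inner_nodes_def nodes_snoc)
  qed
  have disj: "inner_nodes T m' \<inter> L = {}" by (auto simp: L_def inner_nodes_def)
  have weight: "tree_weight (Suc T) m = tree_weight T m' * (\<Prod>w\<in>L. 1 / fact (k w))" if z: "(m, \<phi>) \<in> F" for m \<phi>
    unfolding tree_weight_def facts(1)[OF z]
    by (subst prod.union_disjoint[OF finite_inner finL disj])
      (auto intro!: arg_cong2[of _ _ _ _ "(*)"] prod.cong simp: facts(4,5)[OF z])
  define ch where "ch \<phi> w = \<phi> ` (\<lambda>j. w @ [j]) ` {1..k w}" for \<phi> :: "nat list \<Rightarrow> nat" and w
  have card_ch: "card (ch \<phi> w) = k w" if z: "(m, \<phi>) \<in> F" and w: "w \<in> L" for m \<phi> w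
  proof -
    have "(\<lambda>j. w @ [j]) ` {1..k w} \<subseteq> insert [] (explored (Suc T) m)"
      using w facts(1,5)[OF z] explored_snoc[of w _ "Suc T" m] by auto
    from inj_on_subset[OF labellingsD(1)[OF facts(8)[OF z]] this]
    have "card (ch \<phi> w) = card ((\<lambda>j. w @ [j]) ` {1..k w})" unfolding ch_def by (rule card_image)
    also have "\<dots> = k w" by (subst card_image) (auto simp: inj_on_def)
    finally show ?thesis .
  qed
  have uniq: "ch \<phi> w = ch \<psi> w \<and> \<phi> (w @ [0]) = \<psi> (w @ [0])"
    if z: "(m, \<phi>) \<in> F" "(l, \<psi>) \<in> F" and w: "w \<in> L" for m \<phi> l \<psi> w
  proof -
    \<comment> \<open>The candidates at \<open>w\<close>: its own vertex is left out, and so is its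
      parent's, whose edge is ignored when children are selected.\<close>
    define X where "X = {1..n} - {\<phi>' w} - (if w = [] then {} else {\<phi>' (butlast w)})"
    have A: "ch \<phi> w \<subseteq> X" "\<phi> (w @ [0]) \<in> X - ch \<phi> w"
      "\<And>x. x \<in> ch \<phi> w \<Longrightarrow> C {\<phi>' w, x} < C {\<phi>' w, \<phi> (w @ [0])}"
      "\<And>x. x \<in> X - ch \<phi> w - {\<phi> (w @ [0])} \<Longrightarrow> C {\<phi>' w, \<phi> (w @ [0])} < C {\<phi>' w, x}"
      if z: "(m, \<phi>) \<in> F" for m \<phi>
    proof -
      note f = facts[OF z]
      have win: "w \<in> inner_nodes (Suc T) m" using f(1) w by blast
      note g = labellings_nbr_nodes[OF f(8) win]
      have e: "\<phi> w = \<phi>' w" "w \<noteq> [] \<Longrightarrow> \<phi> (butlast w) = \<phi>' (butlast w)" using f(6) LV[OF w] by auto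
      have nb: "\<phi> ` nbr_nodes m w = ch \<phi> w \<union> (if w = [] then {} else {\<phi>' (butlast w)})"
        using e(2) f(5)[OF w] by (auto simp: nbr_nodes_def ch_def)
      \<comment> \<open>If the parent were among the children, the neighbour set would be one short
        of the degree.\<close>
      have par: "\<phi>' (butlast w) \<notin> ch \<phi> w" if "w \<noteq> []"
      proof
        assume "\<phi>' (butlast w) \<in> ch \<phi> w"
        then have "card (\<phi> ` nbr_nodes m w) = k w"
          using nb that card_ch[OF z w] by (simp add: insert_absorb)
        with g(3) e that labellingsD(3)[OF f(8) win] f(5)[OF w] show False by simp
      qed
      show "ch \<phi> w \<subseteq> X" using g(2) par unfolding nb e X_def by (auto split: if_splits)
      show "\<phi> (w @ [0]) \<in> X - ch \<phi> w" using g(4) unfolding nb e X_def by (auto split: if_splits)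
      have ex: "\<forall>j\<in>{1..m w}. C {\<phi> w, \<phi> (w @ [j])} < C {\<phi> w, \<phi> (w @ [0])}"
        "\<forall>x\<in>{1..n} - {\<phi> w, \<phi> (w @ [0])} - \<phi> ` nbr_nodes m w. C {\<phi> w, \<phi> (w @ [0])} < C {\<phi> w, x}"
        using f(9) win unfolding explores_def by blast+
      show "C {\<phi>' w, x} < C {\<phi>' w, \<phi> (w @ [0])}" if "x \<in> ch \<phi> w" for x
        using that ex(1) unfolding e f(5)[OF w] ch_def by auto
      show "C {\<phi>' w, \<phi> (w @ [0])} < C {\<phi>' w, x}" if "x \<in> X - ch \<phi> w - {\<phi> (w @ [0])}" for x
        using that ex(2) unfolding e nb X_def by (auto split: if_splits)
    qed
    have fin: "finite X" by (simp add: X_def)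
    have c: "card (ch \<phi> w) = card (ch \<psi> w)" using card_ch w z by simp
    show ?thesis
      using lower_set_unique[where c = "\<lambda>x. C {\<phi>' w, x}", OF fin c A[OF z(1)] A[OF z(2)]] by blast
  qed
  have meq: "m = l" if z: "(m, \<phi>) \<in> F" "(l, \<psi>) \<in> F" for m \<phi> l \<psi>
  proof
    fix w show "m w = l w"
    proof (cases "w \<in> inner_nodes T m' \<union> L")
      case True
      then show ?thesis using facts(4,5)[OF z(1)] facts(4,5)[OF z(2)] by auto
    next
      case False
      then show ?thesis using facts(1,7)[OF z(1)] facts(1,7)[OF z(2)] by (simp add: shapes_def)
    qed
  qed
  show fsum: "finite F" "(\<Sum>z\<in>F. tree_weight (Suc T) (fst z)) \<le> tree_weight T m'"
  proof (atomize (full), cases "F = {}")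
    case True
    then show "finite F \<and> (\<Sum>z\<in>F. tree_weight (Suc T) (fst z)) \<le> tree_weight T m'"
      by (auto simp: tree_weight_def intro!: prod_nonneg)
  next
    case False
    then obtain m0 \<phi>0 where z0: "(m0, \<phi>0) \<in> F" by auto
    \<comment> \<open>An extension is recorded by the lists of labels of the new children. By
      \<open>uniq\<close> each list permutes the fixed set \<open>ch \<phi>0 w\<close>, and the
      lists determine the extension.\<close>
    define enc where "enc z = (\<lambda>w\<in>L. map (\<lambda>j. snd z (w @ [j])) [1..<Suc (k w)])"
      for z :: "(nat list \<Rightarrow> nat) \<times> (nat list \<Rightarrow> nat)"
    let ?P = "PiE L (\<lambda>w. permutations_of_set (ch \<phi>0 w))"
    have encP: "enc ` F \<subseteq> ?P"
    proof
      fix p assume "p \<in> enc ` F"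
      then obtain m \<phi> where z: "(m, \<phi>) \<in> F" "p = enc (m, \<phi>)" by auto
      have "map (\<lambda>j. \<phi> (w @ [j])) [1..<Suc (k w)] \<in> permutations_of_set (ch \<phi>0 w)" if w: "w \<in> L" for w
      proof (rule permutations_of_setI)
        have "set [1..<Suc (k w)] = {1..k w}" by auto
        then show s: "set (map (\<lambda>j. \<phi> (w @ [j])) [1..<Suc (k w)]) = ch \<phi>0 w"
          using uniq[OF z(1) z0 w] unfolding set_map by (simp add: ch_def image_image)
        show "distinct (map (\<lambda>j. \<phi> (w @ [j])) [1..<Suc (k w)])"
          by (rule card_distinct) (use card_ch[OF z0 w] s in simp)
      qed
      then show "p \<in> ?P" by (auto simp: z(2) enc_def)
    qed
    have "inj_on enc F"
    proof (rule inj_onI)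
      fix y z assume yz: "y \<in> F" "z \<in> F" "enc y = enc z"
      obtain m \<phi> l \<psi> where [simp]: "y = (m, \<phi>)" "z = (l, \<psi>)" by (cases y; cases z)
      have F: "(m, \<phi>) \<in> F" "(l, \<psi>) \<in> F" using yz by auto
      have ml: "m = l" by (rule meq[OF F])
      have "\<phi> x = \<psi> x" for x
      proof (cases "x \<in> insert [] (explored (Suc T) m)")
        case False
        then show ?thesis using facts(8)[OF F(1)] facts(8)[OF F(2)] ml
          by (auto simp: labellings_def PiE_def extensional_def)
      next
        case True
        show ?thesis
        proof (cases "x \<in> tree_verts T m'")
          case True
          then show ?thesis using facts(6)[OF F(1)] facts(6)[OF F(2)] by simp
        next
          case False
          with True obtain w j where x: "x = w @ [j]" "w \<in> inner_nodes (Suc T) m" "j \<le> m w"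
            by (auto simp: explored_def)
          have w: "w \<in> L"
            using False x facts(1,2,3,4)[OF F(1)] explored_snoc[of w j T m] by auto
          show ?thesis
          proof (cases "j = 0")
            case True
            then show ?thesis using uniq[OF F w] x by simp
          next
            case False
            have "enc y w = enc z w" using yz(3) by simp
            then have "map (\<lambda>j. \<phi> (w @ [j])) [1..<Suc (k w)] = map (\<lambda>j. \<psi> (w @ [j])) [1..<Suc (k w)]"
              using w by (simp add: enc_def)
            then have "\<forall>j\<in>set [1..<Suc (k w)]. \<phi> (w @ [j]) = \<psi> (w @ [j])" unfolding map_eq_conv .
            moreover have "j \<in> set [1..<Suc (k w)]" using False x(3) facts(5)[OF F(1) w] by auto
            ultimately show ?thesis using x(1) by blast
          qed
        qed
      qed
      then show "y = z" using ml by auto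
    qed
    moreover have finP: "finite ?P" using finL by (intro finite_PiE) auto
    ultimately have fF: "finite F" and cF1: "card F \<le> card ?P"
      using encP by (auto intro: inj_on_finite card_inj_on_le)
    note cF1
    also have "card ?P = (\<Prod>w\<in>L. fact (k w))"
      unfolding card_PiE[OF finL] by (rule prod.cong) (use card_ch[OF z0] in \<open>auto simp: ch_def\<close>)
    finally have "real (card F) \<le> real (\<Prod>w\<in>L. fact (k w))" by (simp only: of_nat_le_iff)
    then have cF: "real (card F) \<le> (\<Prod>w\<in>L. fact (k w))" by (simp only: of_nat_prod of_nat_fact)
    have "(\<Sum>z\<in>F. tree_weight (Suc T) (fst z)) = (\<Sum>z\<in>F. tree_weight T m' * (\<Prod>w\<in>L. 1 / fact (k w)))"
      by (rule sum.cong) (auto simp: weight)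
    also have "\<dots> = real (card F) * (tree_weight T m' * (\<Prod>w\<in>L. 1 / fact (k w)))" by simp
    also have "\<dots> \<le> (\<Prod>w\<in>L. fact (k w)) * (tree_weight T m' * (\<Prod>w\<in>L. 1 / fact (k w)))"
      using cF by (rule mult_right_mono) (auto simp: tree_weight_def intro!: mult_nonneg_nonneg prod_nonneg)
    also have "\<dots> = tree_weight T m' * (\<Prod>w\<in>L. fact (k w) * (1 / fact (k w)))"
      by (simp only: prod.distrib mult_ac)
    also have "\<dots> = tree_weight T m'" by simp
    finally show "finite F \<and> (\<Sum>z\<in>F. tree_weight (Suc T) (fst z)) \<le> tree_weight T m'" using fF by simp
  qed
qed

text \<open>The weights \<open>1/n!\<close> compensate for the arbitrary ordering of the children.\<close>

lemma explorations_weight_le_1: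
  "finite (explorations n d C r T) \<and> (\<Sum>z\<in>explorations n d C r T. tree_weight T (fst z)) \<le> 1"
proof (induction T)
  case 0
  have [simp]: "inner_nodes 0 m = {}" "explored 0 m = {}" for m
    by (auto simp: inner_nodes_def explored_def)
  \<comment> \<open>With no explored generation only the labelled root remains, so there is at most
    one exploration, of weight 1.\<close>
  have "z = (\<lambda>_. 0, \<lambda>x\<in>{[]}. r)" if "z \<in> explorations n d C r 0" for z
    using that by (auto simp: explorations_def shapes_def labellings_def PiE_def extensional_def fun_eq_iff)
  then have sub: "explorations n d C r 0 \<subseteq> {(\<lambda>_. 0, \<lambda>x\<in>{[]}. r)}" by blast
  then have "finite (explorations n d C r 0)" by (rule finite_subset) simp
  moreover have "(\<Sum>z\<in>explorations n d C r 0. tree_weight 0 (fst z)) \<le>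
      (\<Sum>z\<in>{(\<lambda>_. 0, \<lambda>x\<in>{[] :: nat list}. r)}. tree_weight 0 (fst z))"
    using sub by (intro sum_mono2) (auto simp: tree_weight_def)
  ultimately show ?case by (simp add: tree_weight_def)
next
  case (Suc T)
  let ?Z = "explorations n d C r"
  have img: "prune T ` ?Z (Suc T) \<subseteq> ?Z T" using prune_explorations by auto
  have "?Z (Suc T) = (\<Union>y\<in>?Z T. {z \<in> ?Z (Suc T). prune T z = y})" using img by blast
  moreover have "finite (\<Union>y\<in>?Z T. {z \<in> ?Z (Suc T). prune T z = y})"
    using Suc explorations_fiber(1) by (intro finite_UN_I) auto
  ultimately have fin: "finite (?Z (Suc T))" by simp
  have "(\<Sum>z\<in>?Z (Suc T). tree_weight (Suc T) (fst z)) =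
      (\<Sum>y\<in>?Z T. \<Sum>z\<in>{z \<in> ?Z (Suc T). prune T z = y}. tree_weight (Suc T) (fst z))"
    by (rule sum.group[symmetric, OF fin _ img]) (use Suc in simp)
  also have "\<dots> \<le> (\<Sum>y\<in>?Z T. tree_weight T (fst y))"
    by (rule sum_mono) (use explorations_fiber(2) in auto)
  also have "\<dots> \<le> 1" using Suc by simp
  finally show ?case using fin by simp
qed

section \<open>The density of an exploration\<close>

abbreviation exp_law :: "nat \<Rightarrow> real measure" where
  "exp_law n \<equiv> density lborel (\<lambda>x. ennreal (exponential_density (1 / real n) x))"

abbreviation exp_prod :: "nat \<Rightarrow> 'i set \<Rightarrow> ('i \<Rightarrow> real) measure" where
  "exp_prod n X \<equiv> PiM X (\<lambda>_. exp_law n)"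

lemma prob_space_exp_law: "0 < n \<Longrightarrow> prob_space (exp_law n)"
  by (rule prob_space_exponential_density) simp

lemma emeasure_exp_law_gt:
  assumes "0 < n" "0 \<le> a"
  shows "emeasure (exp_law n) {a<..} = ennreal (exp (- a / real n))"
proof -
  interpret prob_space "exp_law n" by (rule prob_space_exp_law) fact
  have "distributed (exp_law n) lborel (\<lambda>x. x) (exponential_density (1 / real n))"
    unfolding distributed_def by (simp add: distr_id2)
  from exponential_distributedD_gt[OF this assms(2)] assms(1)
  have "prob {x. a < x} = exp (- a / real n)" by simp
  then show ?thesis by (simp add: emeasure_eq_measure greaterThan_def)
qed

lemma PiM_density:
  fixes p :: "real \<Rightarrow> ennreal"
  assumes fin: "finite E" and p: "p \<in> borel_measurable lborel" and N: "prob_space (density lborel p)"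
  shows "PiM E (\<lambda>_. density lborel p) = density (PiM E (\<lambda>_. lborel)) (\<lambda>y. \<Prod>x\<in>E. p (y x))"
proof -
  interpret N: product_prob_space "\<lambda>_. density lborel p" E
    by (rule product_prob_spaceI) (rule N)
  interpret L: product_sigma_finite "\<lambda>_. lborel :: real measure" ..
  note p [measurable]
  show ?thesis
  proof (rule N.PiM_eqI[symmetric, OF fin])
    show "sets (density (PiM E (\<lambda>_. lborel)) (\<lambda>y. \<Prod>x\<in>E. p (y x))) = sets (PiM E (\<lambda>_. density lborel p))"
      by (simp cong: sets_PiM_cong)
    fix A assume A: "\<And>i. i \<in> E \<Longrightarrow> A i \<in> sets (density lborel p)"
    then have [measurable]: "\<And>i. i \<in> E \<Longrightarrow> A i \<in> sets lborel" by simp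
    have "emeasure (density (PiM E (\<lambda>_. lborel)) (\<lambda>y. \<Prod>x\<in>E. p (y x))) (PiE E A) =
        (\<integral>\<^sup>+y. (\<Prod>x\<in>E. p (y x)) * indicator (PiE E A) y \<partial>PiM E (\<lambda>_. lborel))"
      using fin by (subst emeasure_density) (auto intro!: sets_PiM_I_finite)
    also have "\<dots> = (\<integral>\<^sup>+y. (\<Prod>x\<in>E. p (y x) * indicator (A x) (y x)) \<partial>PiM E (\<lambda>_. lborel))"
    proof (rule nn_integral_cong)
      fix y assume y: "y \<in> space (PiM E (\<lambda>_. lborel :: real measure))"
      show "(\<Prod>x\<in>E. p (y x)) * indicator (PiE E A) y = (\<Prod>x\<in>E. p (y x) * indicator (A x) (y x))"
      proof (cases "y \<in> PiE E A")
        case False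
        then obtain x where x: "x \<in> E" "y x \<notin> A x" using y by (auto simp: space_PiM PiE_iff)
        then have "(\<Prod>x\<in>E. p (y x) * indicator (A x) (y x)) = 0"
          using fin by (intro prod_zero bexI[of _ x]) auto
        then show ?thesis using False by simp
      next
        case True
        then show ?thesis by (auto intro!: prod.cong simp: PiE_iff)
      qed
    qed
    also have "\<dots> = (\<Prod>x\<in>E. \<integral>\<^sup>+z. p z * indicator (A x) z \<partial>lborel)"
      by (rule L.product_nn_integral_prod[OF fin]) measurable
    also have "\<dots> = (\<Prod>x\<in>E. emeasure (density lborel p) (A x))"
      by (intro prod.cong refl emeasure_density[symmetric, OF p]) (use A in simp)
    finally show "emeasure (density (PiM E (\<lambda>_. lborel)) (\<lambda>y. \<Prod>x\<in>E. p (y x))) (PiE E A) =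
      (\<Prod>x\<in>E. emeasure (density lborel p) (A x))" .
  qed
qed

lemma inj_on_snoc: "inj_on (\<lambda>(w, j). w @ [j]) X"
  by (auto simp: inj_on_def)

lemma explored_Sigma: "explored T m = (\<lambda>(w, j). w @ [j]) ` (SIGMA w:inner_nodes T m. {..m w})"
  by (auto simp: explored_def)

lemma sum_explored:
  "(\<Sum>x\<in>explored T m. f x) = (\<Sum>w\<in>inner_nodes T m. \<Sum>j\<le>m w. f (w @ [j]))"
  unfolding explored_Sigma
  by (subst sum.reindex[OF inj_on_snoc]) (simp add: sum.Sigma finite_inner case_prod_unfold)

definition tree_box :: "nat \<Rightarrow> (nat list \<Rightarrow> nat) \<Rightarrow> (nat list \<Rightarrow> real) \<Rightarrow> bool" where
  "tree_box T m y \<longleftrightarrow> (\<forall>w\<in>inner_nodes T m. 0 \<le> y (w @ [0]) \<and> (\<forall>j\<in>{1..m w}. 0 \<le> y (w @ [j]) \<and> y (w @ [j]) < y (w @ [0])))"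

text \<open>The joint density of the marks of the backbone tree on a given shape, up to the constant \<open>shape_prob\<close>.\<close>

definition mark_density :: "nat \<Rightarrow> (nat list \<Rightarrow> nat) \<Rightarrow> (nat list \<Rightarrow> real) \<Rightarrow> real" where
  "mark_density T m y = (if tree_box T m y then exp (- (\<Sum>w\<in>inner_nodes T m. y (w @ [0]))) else 0)"

abbreviation parent_edge :: "(nat list \<Rightarrow> nat) \<Rightarrow> nat list \<Rightarrow> nat set" where
  "parent_edge \<phi> x \<equiv> {\<phi> (butlast x), \<phi> x}"

abbreviation mark_space :: "nat \<Rightarrow> (nat list \<Rightarrow> nat) \<Rightarrow> (nat list \<Rightarrow> real) measure" where
  "mark_space T m \<equiv> PiM (explored T m) (\<lambda>_. borel)"

abbreviation mark_lborel :: "nat \<Rightarrow> (nat list \<Rightarrow> nat) \<Rightarrow> (nat list \<Rightarrow> real) measure" where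
  "mark_lborel T m \<equiv> PiM (explored T m) (\<lambda>_. lborel)"

lemma measurable_PiM_lborel_cong:
  "measurable (PiM E (\<lambda>_. lborel :: real measure)) M = measurable (PiM E (\<lambda>_. borel)) M"
  by (rule measurable_cong_sets) (simp_all cong: sets_PiM_cong)

lemma pred_tree_box [measurable]: "Measurable.pred (mark_space T m) (tree_box T m)"
proof -
  have [measurable]: "(\<lambda>y. y (w @ [j])) \<in> borel_measurable (mark_space T m)"
    if "w \<in> inner_nodes T m" "j \<le> m w" for w j
    by (rule measurable_component_singleton) (use that in \<open>simp add: explored_snoc\<close>)
  show ?thesis unfolding tree_box_def
    by (intro pred_intros_finite finite_inner pred_intros_logic finite_atLeastAtMost) (measurable, auto simp: explored_snoc)
qed

lemma measurable_mark_density [measurable]: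
  "mark_density T m \<in> borel_measurable (mark_space T m)"
proof -
  have [measurable]: "(\<lambda>y. y (w @ [0])) \<in> borel_measurable (mark_space T m)"
    if "w \<in> inner_nodes T m" for w
    by (rule measurable_component_singleton) (use that in \<open>simp add: explored_snoc\<close>)
  show ?thesis unfolding mark_density_def[abs_def] by measurable
qed

lemma pairs_iff: "{i, j} \<in> pairs n \<longleftrightarrow> i \<in> {1..n} \<and> j \<in> {1..n} \<and> i \<noteq> j"
  by (auto simp: pairs_def doubleton_eq_iff)

lemma card_pairs_at:
  assumes i: "i \<in> {1..n}"
  shows "card {e \<in> pairs n. i \<in> e} = n - 1"
proof -
  have "{e \<in> pairs n. i \<in> e} = (\<lambda>j. {i, j}) ` ({1..n} - {i})"
  proof (intro equalityI subsetI)
    fix e assume "e \<in> {e \<in> pairs n. i \<in> e}"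
    then show "e \<in> (\<lambda>j. {i, j}) ` ({1..n} - {i})" by (auto simp: pairs_def)
  qed (use i in \<open>auto simp: pairs_iff simp del: atLeastAtMost_iff\<close>)
  also have "card \<dots> = card ({1..n} - {i})"
    by (rule card_image) (auto simp: inj_on_def doubleton_eq_iff)
  finally show ?thesis using i by simp
qed

lemma finite_pairs: "finite (pairs n)"
  by (rule finite_subset[of _ "Pow {1..n}"]) (auto simp: pairs_def)

section \<open>Revealed and unrevealed edges\<close>

context
  fixes n :: nat and d :: "nat \<Rightarrow> nat" and T m \<phi>
  assumes \<phi>: "\<phi> \<in> labellings n d T m"
begin

private lemma explored_facts:
  assumes "x \<in> explored T m"
  shows "butlast x \<in> tree_verts T m" "x \<in> tree_verts T m"
    "\<phi> (butlast x) \<in> {1..n}" "\<phi> x \<in> {1..n}" "\<phi> (butlast x) \<noteq> \<phi> x"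
proof -
  from assms obtain w j where w: "x = w @ [j]" "w \<in> inner_nodes T m" by (auto simp: explored_def)
  then show 1: "butlast x \<in> tree_verts T m" using inner_subset by auto
  show 2: "x \<in> tree_verts T m" using assms by simp
  show "\<phi> (butlast x) \<in> {1..n}" "\<phi> x \<in> {1..n}" using labellingsD(2)[OF \<phi>] 1 2 by auto
  show "\<phi> (butlast x) \<noteq> \<phi> x"
    using inj_on_eq_iff[OF labellingsD(1)[OF \<phi>] 1 2] w(1) by simp
qed

lemma parent_edge_pairs: "parent_edge \<phi> ` explored T m \<subseteq> pairs n"
  using explored_facts by (force simp: pairs_def)

lemma parent_edge_eqD:
  assumes x: "x \<in> explored T m" and u: "u \<in> tree_verts T m" and eq: "{\<phi> u, i} = parent_edge \<phi> x"
  shows "(u = butlast x \<and> i = \<phi> x) \<or> (u = x \<and> i = \<phi> (butlast x))"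
  using explored_facts[OF x] eq inj_on_eq_iff[OF labellingsD(1)[OF \<phi>]] u
  by (auto simp: doubleton_eq_iff)

text \<open>Equality with exchanged ends would give \<open>x = butlast y\<close> and
  \<open>y = butlast x\<close>, impossible by length. Thus distinct tree edges carry independent
  costs, and the product measure may be reindexed by tree nodes.\<close>

lemma inj_on_parent_edge: "inj_on (parent_edge \<phi>) (explored T m)"
proof (rule inj_onI)
  fix x y assume xy: "x \<in> explored T m" "y \<in> explored T m" "parent_edge \<phi> x = parent_edge \<phi> y"
  have ne: "x \<noteq> []" "y \<noteq> []" using xy by (auto simp: explored_def)
  have "{\<phi> x, \<phi> (butlast x)} = parent_edge \<phi> y" using xy(3) by (simp add: insert_commute)
  from parent_edge_eqD[OF xy(2) explored_facts(2)[OF xy(1)] this]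
  show "x = y"
  proof
    assume a: "x = butlast y \<and> \<phi> (butlast x) = \<phi> y"
    then have "butlast x = y"
      using inj_on_eq_iff[OF labellingsD(1)[OF \<phi>] explored_facts(1)[OF xy(1)] explored_facts(2)[OF xy(2)]] by blast
    with a have "length x = length x - 1 - 1" by (metis length_butlast)
    then show ?thesis using ne by (cases x) auto
  qed simp
qed

text \<open>The hypothesis on \<open>x\<close> excludes every tree neighbour of \<open>w\<close>:
  children, threshold vertex and parent. The comparisons in the second clause of
  \<open>explores\<close> are therefore with costs independent of the revealed ones.\<close>

lemma other_edges:
  assumes w: "w \<in> inner_nodes T m" and x: "x \<in> {1..n} - {\<phi> w, \<phi> (w @ [0])} - \<phi> ` nbr_nodes m w"
  shows "{\<phi> w, x} \<in> pairs n - parent_edge \<phi> ` explored T m"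
proof
  have "\<phi> w \<in> {1..n}" using labellings_nbr_nodes(1)[OF \<phi> w] .
  then show "{\<phi> w, x} \<in> pairs n" using x by (auto simp: pairs_def)
  show "{\<phi> w, x} \<notin> parent_edge \<phi> ` explored T m"
  proof
    assume "{\<phi> w, x} \<in> parent_edge \<phi> ` explored T m"
    then obtain z where z: "z \<in> explored T m" "{\<phi> w, x} = parent_edge \<phi> z" by blast
    from z(1) obtain u j where u: "z = u @ [j]" "u \<in> inner_nodes T m" "j \<le> m u" by (auto simp: explored_def)
    have "w \<in> tree_verts T m" using w inner_subset by blast
    from parent_edge_eqD[OF z(1) this z(2)] show False
    proof
      assume "w = butlast z \<and> x = \<phi> z"
      then have "x = \<phi> (w @ [j])" "j \<le> m w" using u by auto
      with x show False by (cases "j = 0") (auto simp: nbr_nodes_def)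
    next
      assume "w = z \<and> x = \<phi> (butlast z)"
      then have "w \<noteq> []" "x = \<phi> (butlast w)" using u by auto
      with x show False by (auto simp: nbr_nodes_def)
    qed
  qed
qed

text \<open>Of the \<open>n - 1\<close> edges at the vertex, \<open>m w + 1\<close> are revealed by
  exploring \<open>w\<close>. The edge to the parent, if there is one, is revealed as well, hence an
  inequality.\<close>

lemma card_other_edges:
  assumes w: "w \<in> inner_nodes T m"
  shows "card {e \<in> pairs n - parent_edge \<phi> ` explored T m. \<phi> w \<in> e} + (m w + 1) \<le> n - 1"
proof -
  let ?J = "parent_edge \<phi> ` (\<lambda>j. w @ [j]) ` {..m w}"
  have sub: "(\<lambda>j. w @ [j]) ` {..m w} \<subseteq> explored T m" using w explored_snoc by auto
  have "card ?J = card ((\<lambda>j. w @ [j]) ` {..m w})"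
    by (rule card_image[OF inj_on_subset[OF inj_on_parent_edge sub]])
  also have "\<dots> = m w + 1" by (subst card_image) (auto simp: inj_on_def)
  finally have cJ: "card ?J = m w + 1" .
  have "card {e \<in> pairs n - parent_edge \<phi> ` explored T m. \<phi> w \<in> e} + card ?J =
      card ({e \<in> pairs n - parent_edge \<phi> ` explored T m. \<phi> w \<in> e} \<union> ?J)"
    using sub by (intro card_Un_disjoint[symmetric]) (auto simp: finite_pairs)
  also have "\<dots> \<le> card {e \<in> pairs n. \<phi> w \<in> e}"
    using parent_edge_pairs sub by (intro card_mono) (auto simp: finite_pairs)
  also have "\<dots> = n - 1" by (rule card_pairs_at[OF labellings_nbr_nodes(1)[OF \<phi> w]])
  finally show ?thesis using cJ by simp
qed

lemma pred_explores: "Measurable.pred (cost_space n) (\<lambda>C. explores n C T m \<phi>)"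
  unfolding explores_def
  by (intro pred_intros_finite finite_inner pred_intros_logic finite_atLeastAtMost finite_Diff) measurable

text \<open>Each of the \<open>n - 1\<close> edges at an explored vertex \<open>w\<close> with threshold \<open>v\<close> contributes at least
  \<open>exp (- v / n)\<close>: either its cost \<open>c \<le> v\<close> is prescribed, with density \<open>exp (- c / n) / n\<close>, or it must exceed \<open>v\<close>.
  This yields the limiting density as a lower bound for every \<open>n\<close>.\<close>

lemma nn_integral_explores_ge:
  assumes h [measurable]: "h \<in> borel_measurable (mark_space T m)"
  shows "ennreal ((1 / real n) ^ card (explored T m)) *
      (\<integral>\<^sup>+y. h y * ennreal (mark_density T m y) \<partial>mark_lborel T m) \<le>
    (\<integral>\<^sup>+C. h (\<lambda>x\<in>explored T m. C (parent_edge \<phi> x)) * indicator {C. explores n C T m \<phi>} C \<partial>cost_law n)"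
proof -
  let ?E = "explored T m" and ?I = "inner_nodes T m"
  define J where "J = parent_edge \<phi> ` ?E"
  define K where "K = pairs n - J"
  \<comment> \<open>The sum of the thresholds at the explored ends of \<open>e\<close> is at least
    each of them, so \<open>M y e < z e\<close> on all of \<open>K\<close> secures the comparisons
    in \<open>explores\<close>. Unlike the maximum, the sum lets the exponent split over the
    nodes.\<close>
  define M where "M y e = (\<Sum>w\<in>{w\<in>?I. \<phi> w \<in> e}. y (w @ [0]))" for y :: "nat list \<Rightarrow> real" and e
  \<comment> \<open>\<open>n - 2 - m w\<close> bounds the number of unrevealed edges at
    \<open>w\<close>, by \<open>card_other_edges\<close>.\<close>
  define F where "F y = h y * indicator {y. tree_box T m y} y *
    ennreal (exp (- (\<Sum>w\<in>?I. y (w @ [0]) * (real n - 2 - real (m w))) / real n))" for y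
  have n0: "0 < n" using labellingsD(2)[OF \<phi>, of "[]"] by auto
  note prob = prob_space_exp_law[OF n0]
  interpret P: product_prob_space "\<lambda>_. exp_law n" "pairs n"
    by (rule product_prob_spaceI) (rule prob)
  interpret L: product_sigma_finite "\<lambda>_. exp_law n" ..
  have JK: "J \<inter> K = {}" "J \<union> K = pairs n" "finite J" "finite K"
    using parent_edge_pairs finite_pairs finite_explored by (auto simp: J_def K_def)
  have setsE: "sets (exp_prod n X) = sets (PiM X (\<lambda>_. borel))" for X :: "'x set"
    by (simp cong: sets_PiM_cong)
  have meas_cong: "measurable (exp_prod n X) Q = measurable (PiM X (\<lambda>_. borel)) Q"
    for X :: "'x set" and Q :: "'y measure"
    by (rule measurable_cong_sets) (simp_all add: setsE)
  have proj: "(\<lambda>C. \<lambda>x\<in>?E. C (parent_edge \<phi> x)) \<in> measurable (exp_prod n X) (mark_space T m)"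
    if "J \<subseteq> X" for X
    unfolding meas_cong
    by (rule measurable_restrict) (rule measurable_component_singleton, use that in \<open>auto simp: J_def\<close>)
  have comp: "(\<lambda>y. y (w @ [0])) \<in> borel_measurable (mark_space T m)" if "w \<in> ?I" for w
    by (rule measurable_component_singleton) (use that in \<open>simp add: explored_snoc\<close>)
  have F [measurable]: "F \<in> borel_measurable (mark_space T m)"
    unfolding F_def using comp[measurable] by measurable
  \<comment> \<open>With the revealed costs fixed, the others are integrated out over a smaller
    event, a product of independent exceedances.\<close>
  have inner_ge: "F (\<lambda>x\<in>?E. C (parent_edge \<phi> x)) \<le>
      (\<integral>\<^sup>+z. h (\<lambda>x\<in>?E. merge J K (C, z) (parent_edge \<phi> x)) * indicator {C. explores n C T m \<phi>} (merge J K (C, z))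
        \<partial>exp_prod n K)" for C
  proof (cases "tree_box T m (\<lambda>x\<in>?E. C (parent_edge \<phi> x))")
    case True
    define y where "y = (\<lambda>x\<in>?E. C (parent_edge \<phi> x))"
    have b: "tree_box T m y" using True by (simp add: y_def)
    have yw: "y (w @ [j]) = C {\<phi> w, \<phi> (w @ [j])}" if "w \<in> ?I" "j \<le> m w" for w j
      using that by (simp add: y_def explored_snoc)
    have y0: "0 \<le> y (w @ [0])" if "w \<in> ?I" for w using b that by (auto simp: tree_box_def)
    have M0: "0 \<le> M y e" for e unfolding M_def by (rule sum_nonneg) (use y0 in auto)
    have mJ: "merge J K (C, z) (parent_edge \<phi> x) = C (parent_edge \<phi> x)" if "x \<in> ?E" for x z
      using that by (auto simp: merge_def J_def)
    have ex: "explores n (merge J K (C, z)) T m \<phi>" if z: "\<And>e. e \<in> K \<Longrightarrow> M y e < z e" for z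
      unfolding explores_def
    proof (intro ballI conjI)
      fix w assume w: "w \<in> ?I"
      have mw: "merge J K (C, z) {\<phi> w, \<phi> (w @ [j])} = y (w @ [j])" if "j \<le> m w" for j
        using mJ[of "w @ [j]" z] w that by (simp add: explored_snoc yw)
      show "merge J K (C, z) {\<phi> w, \<phi> (w @ [j])} < merge J K (C, z) {\<phi> w, \<phi> (w @ [0])}" if "j \<in> {1..m w}" for j
        using that mw[of j] mw[of 0] b w by (simp add: tree_box_def)
      fix x assume x: "x \<in> {1..n} - {\<phi> w, \<phi> (w @ [0])} - \<phi> ` nbr_nodes m w"
      have e: "{\<phi> w, x} \<in> K" using other_edges[OF w x] by (simp add: K_def J_def)
      have "y (w @ [0]) \<le> M y {\<phi> w, x}" unfolding M_def
        by (rule member_le_sum) (use w y0 finite_inner in auto)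
      also have "\<dots> < z {\<phi> w, x}" by (rule z[OF e])
      also have "z {\<phi> w, x} = merge J K (C, z) {\<phi> w, x}" using e by (auto simp: merge_def K_def)
      finally show "merge J K (C, z) {\<phi> w, \<phi> (w @ [0])} < merge J K (C, z) {\<phi> w, x}"
        using mw[of 0] by simp
    qed
    have "(\<Sum>e\<in>K. M y e) = (\<Sum>w\<in>?I. real (card {e\<in>K. \<phi> w \<in> e}) * y (w @ [0]))"
    proof -
      have "(\<Sum>e\<in>K. M y e) = (\<Sum>e\<in>K. \<Sum>w\<in>?I. if \<phi> w \<in> e then y (w @ [0]) else 0)"
        unfolding M_def by (intro sum.cong refl sum.inter_filter finite_inner)
      also have "\<dots> = (\<Sum>w\<in>?I. \<Sum>e\<in>K. if \<phi> w \<in> e then y (w @ [0]) else 0)" by (rule sum.swap)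
      also have "\<dots> = (\<Sum>w\<in>?I. real (card {e\<in>K. \<phi> w \<in> e}) * y (w @ [0]))"
        by (intro sum.cong refl) (simp flip: sum.inter_filter[OF JK(4)])
      finally show ?thesis .
    qed
    also have "\<dots> \<le> (\<Sum>w\<in>?I. y (w @ [0]) * (real n - 2 - real (m w)))"
    proof (rule sum_mono)
      fix w assume w: "w \<in> ?I"
      have "real (card {e\<in>K. \<phi> w \<in> e}) \<le> real n - 2 - real (m w)"
        using card_other_edges[OF w] by (simp add: K_def J_def)
      then show "real (card {e\<in>K. \<phi> w \<in> e}) * y (w @ [0]) \<le> y (w @ [0]) * (real n - 2 - real (m w))"
        using y0[OF w] by (simp add: mult.commute mult_left_mono)
    qed
    finally have Msum: "(\<Sum>e\<in>K. M y e) \<le> (\<Sum>w\<in>?I. y (w @ [0]) * (real n - 2 - real (m w)))" .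
    have "F y \<le> h y * ennreal (exp (- (\<Sum>e\<in>K. M y e) / real n))"
      unfolding F_def using b Msum n0
      by (auto intro!: mult_left_mono ennreal_leI simp: divide_right_mono)
    also have "ennreal (exp (- (\<Sum>e\<in>K. M y e) / real n)) = (\<Prod>e\<in>K. ennreal (exp (- M y e / real n)))"
      by (simp add: prod_ennreal exp_sum[OF JK(4), symmetric] sum_negf sum_divide_distrib)
    also have "\<dots> = (\<Prod>e\<in>K. \<integral>\<^sup>+c. indicator {M y e<..} c \<partial>exp_law n)"
      by (intro prod.cong refl) (simp add: emeasure_exp_law_gt[OF n0 M0])
    also have "\<dots> = (\<integral>\<^sup>+z. (\<Prod>e\<in>K. indicator {M y e<..} (z e)) \<partial>exp_prod n K)"
      by (rule L.product_nn_integral_prod[symmetric, OF JK(4)]) simp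
    also have "h y * \<dots> = (\<integral>\<^sup>+z. h y * (\<Prod>e\<in>K. indicator {M y e<..} (z e)) \<partial>exp_prod n K)"
    proof (rule nn_integral_cmult[symmetric])
      have *: "(\<lambda>z. indicator {M y e<..} (z e) :: ennreal) \<in> borel_measurable (exp_prod n K)" if "e \<in> K" for e
        unfolding meas_cong
        by (rule measurable_compose[OF measurable_component_singleton[OF that]]) simp
      show "(\<lambda>z. \<Prod>e\<in>K. indicator {M y e<..} (z e) :: ennreal) \<in> borel_measurable (exp_prod n K)"
        by (rule borel_measurable_prod_ennreal) (rule *)
    qed
    also have "\<dots> \<le> (\<integral>\<^sup>+z. h (\<lambda>x\<in>?E. merge J K (C, z) (parent_edge \<phi> x)) *
        indicator {C. explores n C T m \<phi>} (merge J K (C, z)) \<partial>exp_prod n K)"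
    proof (rule nn_integral_mono)
      fix z
      have hy: "(\<lambda>x\<in>?E. merge J K (C, z) (parent_edge \<phi> x)) = y" unfolding y_def using mJ by auto
      show "h y * (\<Prod>e\<in>K. indicator {M y e<..} (z e)) \<le> h (\<lambda>x\<in>?E. merge J K (C, z) (parent_edge \<phi> x)) *
          indicator {C. explores n C T m \<phi>} (merge J K (C, z))"
      proof (cases "\<forall>e\<in>K. M y e < z e")
        case True
        then show ?thesis using ex[of z] unfolding hy by simp
      next
        case False
        then have "(\<Prod>e\<in>K. indicator {M y e<..} (z e)) = (0 :: ennreal)"
          using JK(4) by (intro prod_zero) (auto simp: indicator_def)
        then show ?thesis by (simp only: mult_zero_right zero_le)
      qed
    qed
    finally show ?thesis by (simp only: y_def)
  qed (simp add: F_def)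
  define p where "p = (\<lambda>x. ennreal (exponential_density (1 / real n) x))"
  have p [measurable]: "p \<in> borel_measurable lborel" unfolding p_def by simp
  have "ennreal ((1 / real n) ^ card ?E) * (\<integral>\<^sup>+y. h y * ennreal (mark_density T m y) \<partial>mark_lborel T m)
      = (\<integral>\<^sup>+y. ennreal ((1 / real n) ^ card ?E) * (h y * ennreal (mark_density T m y)) \<partial>mark_lborel T m)"
    by (rule nn_integral_cmult[symmetric]) (simp add: measurable_PiM_lborel_cong)
  also have "\<dots> \<le> (\<integral>\<^sup>+y. (\<Prod>x\<in>?E. p (y x)) * F y \<partial>mark_lborel T m)"
  proof (rule nn_integral_mono)
    fix y
    show "ennreal ((1 / real n) ^ card ?E) * (h y * ennreal (mark_density T m y)) \<le> (\<Prod>x\<in>?E. p (y x)) * F y"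
    proof (cases "tree_box T m y")
      case b: True
      have y0: "0 \<le> y (w @ [0])" if "w \<in> ?I" for w using b that by (auto simp: tree_box_def)
      have yE: "0 \<le> y (w @ [j]) \<and> y (w @ [j]) \<le> y (w @ [0])" if "w \<in> ?I" "j \<le> m w" for w j
        using b that by (cases "j = 0") (auto simp: tree_box_def intro: less_imp_le)
      have pE: "p (y x) = ennreal (1 / real n * exp (- y x / real n))" if "x \<in> ?E" for x
      proof -
        have "0 \<le> y x" using that yE by (auto simp: explored_def)
        then show ?thesis by (simp add: p_def exponential_density_def)
      qed
      have "(\<Prod>x\<in>?E. p (y x)) = ennreal (\<Prod>x\<in>?E. 1 / real n * exp (- y x / real n))"
        using pE by (simp add: prod_ennreal)
      also have "(\<Prod>x\<in>?E. 1 / real n * exp (- y x / real n)) = (1 / real n) ^ card ?E * exp (- (\<Sum>x\<in>?E. y x) / real n)"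
        by (simp add: prod.distrib prod_dividef exp_sum[OF finite_explored, symmetric] sum_negf sum_divide_distrib
            power_divide)
      finally have pr: "(\<Prod>x\<in>?E. p (y x)) = ennreal ((1 / real n) ^ card ?E) * ennreal (exp (- (\<Sum>x\<in>?E. y x) / real n))"
        by (simp add: ennreal_mult)
      have "(\<Sum>x\<in>?E. y x) \<le> (\<Sum>w\<in>?I. y (w @ [0]) * (real (m w) + 1))"
        unfolding sum_explored
      proof (rule sum_mono)
        fix w assume w: "w \<in> ?I"
        have "(\<Sum>j\<le>m w. y (w @ [j])) \<le> (\<Sum>j\<le>m w. y (w @ [0]))" by (rule sum_mono) (use yE w in auto)
        then show "(\<Sum>j\<le>m w. y (w @ [j])) \<le> y (w @ [0]) * (real (m w) + 1)" by (simp add: algebra_simps)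
      qed
      \<comment> \<open>Here \<open>m w + 1\<close> revealed and \<open>n - 2 - m w\<close> other
        edges make \<open>n - 1\<close>. Bounding this by \<open>n\<close> cancels the division by
        \<open>n\<close> in the exponent and leaves \<open>exp (- v)\<close> for each explored
        node.\<close>
      moreover have "(\<Sum>w\<in>?I. y (w @ [0]) * (real (m w) + 1)) + (\<Sum>w\<in>?I. y (w @ [0]) * (real n - 2 - real (m w)))
          = (\<Sum>w\<in>?I. y (w @ [0]) * (real n - 1))"
        unfolding sum.distrib[symmetric] by (rule sum.cong) (simp_all add: algebra_simps)
      ultimately have "(\<Sum>x\<in>?E. y x) + (\<Sum>w\<in>?I. y (w @ [0]) * (real n - 2 - real (m w))) \<le>
          (\<Sum>w\<in>?I. y (w @ [0]) * (real n - 1))"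
        by linarith
      also have "\<dots> \<le> (\<Sum>w\<in>?I. y (w @ [0])) * real n"
        unfolding sum_distrib_right by (intro sum_mono mult_left_mono y0) simp
      finally have "- (\<Sum>w\<in>?I. y (w @ [0])) \<le>
          - (\<Sum>x\<in>?E. y x) / real n + - (\<Sum>w\<in>?I. y (w @ [0]) * (real n - 2 - real (m w))) / real n"
        using n0 by (simp add: field_simps)
      then have "exp (- (\<Sum>w\<in>?I. y (w @ [0]))) \<le>
          exp (- (\<Sum>x\<in>?E. y x) / real n) * exp (- (\<Sum>w\<in>?I. y (w @ [0]) * (real n - 2 - real (m w))) / real n)"
        by (simp only: exp_add[symmetric] exp_le_cancel_iff)
      then have "ennreal (mark_density T m y) \<le> ennreal (exp (- (\<Sum>x\<in>?E. y x) / real n)) *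
          ennreal (exp (- (\<Sum>w\<in>?I. y (w @ [0]) * (real n - 2 - real (m w))) / real n))"
        using b by (simp add: mark_density_def ennreal_mult[symmetric] ennreal_leI)
      then have "ennreal ((1 / real n) ^ card ?E) * (h y * ennreal (mark_density T m y)) \<le>
          ennreal ((1 / real n) ^ card ?E) * (h y * (ennreal (exp (- (\<Sum>x\<in>?E. y x) / real n)) *
          ennreal (exp (- (\<Sum>w\<in>?I. y (w @ [0]) * (real n - 2 - real (m w))) / real n))))"
        by (intro mult_left_mono) auto
      also have "\<dots> = (\<Prod>x\<in>?E. p (y x)) * F y"
        using b by (simp add: pr F_def mult_ac)
      finally show ?thesis .
    qed (simp add: mark_density_def)
  qed
  also have "\<dots> = (\<integral>\<^sup>+y. F y \<partial>density (mark_lborel T m) (\<lambda>y. \<Prod>x\<in>?E. p (y x)))"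
    by (rule nn_integral_density[symmetric]) (simp_all add: measurable_PiM_lborel_cong)
  also have "density (mark_lborel T m) (\<lambda>y. \<Prod>x\<in>?E. p (y x)) = exp_prod n ?E"
    unfolding p_def by (rule PiM_density[symmetric, OF finite_explored _ prob]) simp
  \<comment> \<open>The independent coordinates indexed by tree nodes are the costs of the revealed
    edges, renamed along the injective map \<open>parent_edge \<phi>\<close>.\<close>
  also have "\<dots> = distr (exp_prod n J) (exp_prod n ?E) (\<lambda>C. \<lambda>x\<in>?E. C (parent_edge \<phi> x))"
    by (rule distr_PiM_reindex[symmetric, OF prob inj_on_parent_edge]) (auto simp: J_def)
  also have "(\<integral>\<^sup>+y. F y \<partial>\<dots>) = (\<integral>\<^sup>+C. F (\<lambda>x\<in>?E. C (parent_edge \<phi> x)) \<partial>exp_prod n J)"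
  proof (rule nn_integral_distr)
    show "(\<lambda>C. \<lambda>x\<in>?E. C (parent_edge \<phi> x)) \<in> measurable (exp_prod n J) (exp_prod n ?E)"
      using proj[of J] by (subst measurable_cong_sets[OF refl setsE]) simp
    show "F \<in> borel_measurable (distr (exp_prod n J) (exp_prod n ?E)
        (\<lambda>C. \<lambda>x\<in>?E. C (parent_edge \<phi> x)))"
      unfolding measurable_distr_eq1 meas_cong by (rule F)
  qed
  also have "\<dots> \<le> (\<integral>\<^sup>+C. (\<integral>\<^sup>+z. h (\<lambda>x\<in>?E. merge J K (C, z) (parent_edge \<phi> x)) *
      indicator {C. explores n C T m \<phi>} (merge J K (C, z)) \<partial>exp_prod n K) \<partial>exp_prod n J)"
    by (rule nn_integral_mono) (rule inner_ge)
  also have "\<dots> = (\<integral>\<^sup>+C. h (\<lambda>x\<in>?E. C (parent_edge \<phi> x)) * indicator {C. explores n C T m \<phi>} C \<partial>PiM (J \<union> K) (\<lambda>_. exp_law n))"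
  proof (rule L.product_nn_integral_fold[symmetric, OF JK(1,3,4)])
    have "(\<lambda>C. h (\<lambda>x\<in>?E. C (parent_edge \<phi> x))) \<in> borel_measurable (PiM (pairs n) (\<lambda>_. exp_law n))"
      by (rule measurable_compose[OF proj h]) (use JK in auto)
    moreover have "indicator {C. explores n C T m \<phi>} \<in> borel_measurable (PiM (pairs n) (\<lambda>_. exp_law n))"
      unfolding meas_cong by (intro borel_measurable_indicator') (use pred_explores in simp)
    ultimately show "(\<lambda>C. h (\<lambda>x\<in>?E. C (parent_edge \<phi> x)) * indicator {C. explores n C T m \<phi>} C)
        \<in> borel_measurable (PiM (J \<union> K) (\<lambda>_. exp_law n))"
      unfolding JK(2) by (rule borel_measurable_times_ennreal)
  qed
  finally show ?thesis unfolding JK(2) cost_law_def .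
qed

end

section \<open>The law of the tree data\<close>

abbreviation unif :: "real \<Rightarrow> real measure" where
  "unif v \<equiv> uniform_measure lborel {0..v}"

abbreviation cost_kernel :: "nat \<Rightarrow> real \<Rightarrow> (nat \<Rightarrow> real) measure" where
  "cost_kernel n v \<equiv> PiM {1..n} (\<lambda>_. unif v)"

lemma subprob_space_unif: "subprob_space (unif v)"
proof (cases "0 < v")
  case True
  then interpret prob_space "unif v" by (intro prob_space_uniform_measure) auto
  show ?thesis by unfold_locales
next
  case False
  then have "emeasure lborel {0..v} = 0" by (cases "v = 0") auto
  then show ?thesis
    by (intro subprob_spaceI) (simp_all add: emeasure_uniform_measure)
qed

lemma emeasure_cost_kernel:
  assumes "\<And>j. j \<in> {1..n} \<Longrightarrow> X j \<in> sets borel"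
  shows "emeasure (cost_kernel n v) (PiE {1..n} X) =
    (\<Prod>j\<in>{1..n}. emeasure lborel ({0..v} \<inter> X j) / emeasure lborel {0..v})"
proof -
  interpret U: subprob_space "unif v" by (rule subprob_space_unif)
  interpret product_sigma_finite "\<lambda>_. unif v" ..
  have "emeasure (cost_kernel n v) (PiE {1..n} X) = (\<Prod>j\<in>{1..n}. emeasure (unif v) (X j))"
    by (rule emeasure_PiM) (use assms in auto)
  also have "\<dots> = (\<Prod>j\<in>{1..n}. emeasure lborel ({0..v} \<inter> X j) / emeasure lborel {0..v})"
    by (rule prod.cong) (use assms in auto)
  finally show ?thesis .
qed

lemma prob_space_cost_kernel: "0 < v \<Longrightarrow> prob_space (cost_kernel n v)"
  by (intro prob_space_PiM prob_space_uniform_measure) auto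

lemma measurable_emeasure_Icc [measurable]:
  assumes [measurable]: "X \<in> sets borel"
  shows "(\<lambda>v :: real. emeasure lborel ({0..v} \<inter> X)) \<in> borel_measurable borel"
proof -
  have "emeasure lborel ({0..v} \<inter> X) = (\<integral>\<^sup>+x. indicator {z \<in> space (borel \<Otimes>\<^sub>M borel). 0 \<le> snd z \<and> snd z \<le> fst z \<and> snd z \<in> X} (v, x) \<partial>lborel)" for v
  proof -
    have "emeasure lborel ({0..v} \<inter> X) = (\<integral>\<^sup>+x. indicator ({0..v} \<inter> X) x \<partial>lborel)" by simp
    also have "\<dots> = (\<integral>\<^sup>+x. indicator {z \<in> space (borel \<Otimes>\<^sub>M borel). 0 \<le> snd z \<and> snd z \<le> fst z \<and> snd z \<in> X} (v, x) \<partial>lborel)"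
      by (intro nn_integral_cong) (auto simp: indicator_def space_pair_measure)
    finally show ?thesis .
  qed
  then show ?thesis by simp
qed

text \<open>Boxes form an intersection-stable generator, and on a box the kernel is a product of
  quotients of Lebesgue measures that are measurable in \<open>v\<close>.\<close>

lemma measurable_cost_kernel:
  "cost_kernel n \<in> measurable borel (subprob_algebra (PiM {1..n} (\<lambda>_. borel)))"
proof (rule measurable_subprob_algebra_generated[OF sets_PiM Int_stable_prod_algebra prod_algebra_sets_into_space])
  fix v :: real
  interpret U: subprob_space "unif v" by (rule subprob_space_unif)
  show "sets (cost_kernel n v) = sets (PiM {1..n} (\<lambda>_. borel))" by (simp cong: sets_PiM_cong)
  have sp: "space (cost_kernel n v) = PiE {1..n} (\<lambda>_. UNIV)" by (simp add: space_PiM)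
  show "subprob_space (cost_kernel n v)"
  proof (cases "0 < v")
    case True
    then show ?thesis by (intro prob_space_imp_subprob_space prob_space_cost_kernel)
  next
    case False
    then have 0: "emeasure lborel {0..v} = 0" by (cases "v = 0") auto
    have "emeasure (cost_kernel n v) (space (cost_kernel n v)) =
        (\<Prod>j\<in>{1..n}. emeasure lborel ({0..v} \<inter> UNIV) / emeasure lborel {0..v})"
      unfolding sp by (rule emeasure_cost_kernel) simp
    \<comment> \<open>For \<open>v \<le> 0\<close> every factor is 0, but at \<open>n = 0\<close>
      the empty product is 1; both are at most 1.\<close>
    also have "\<dots> \<le> 1" by (cases n) (simp_all add: 0)
    finally show ?thesis by (rule subprob_spaceI) (simp add: sp PiE_eq_empty_iff)
  qed
next
  fix A assume "A \<in> prod_algebra {1..n} (\<lambda>_. borel :: real measure)"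
  then obtain X where X: "A = PiE {1..n} X" "\<And>j. j \<in> {1..n} \<Longrightarrow> X j \<in> sets borel"
    by (auto simp: prod_algebra_eq_finite Pi_iff)
  have "emeasure (cost_kernel n v) A = (\<Prod>j\<in>{1..n}. emeasure lborel ({0..v} \<inter> X j) / emeasure lborel {0..v})" for v
    unfolding X(1) by (rule emeasure_cost_kernel) (rule X(2))
  then show "(\<lambda>v. emeasure (cost_kernel n v) A) \<in> borel_measurable borel"
    using X(2) by (simp only:) (intro borel_measurable_prod_ennreal borel_measurable_divide_ennreal measurable_emeasure_Icc;
      simp add: measurable_emeasure_Icc[of UNIV, simplified])
next
  have "emeasure (cost_kernel n v) (PiE {1..n} (\<lambda>_. UNIV)) =
        (\<Prod>j\<in>{1..n}. emeasure lborel ({0..v} \<inter> UNIV) / emeasure lborel {0..v})" for v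
    by (rule emeasure_cost_kernel) simp
  then show "(\<lambda>v. emeasure (cost_kernel n v) (\<Pi>\<^sub>E j\<in>{1..n}. space borel)) \<in> borel_measurable borel"
    using measurable_emeasure_Icc[of UNIV] by simp
qed

abbreviation node_kernel :: "nat \<Rightarrow> real \<Rightarrow> node_data measure" where
  "node_kernel n v \<equiv> distr (cost_kernel n v) node_space (\<lambda>z. (n, v, z))"

lemma measurable_node_data:
  "(\<lambda>(v, z). (n, v, z)) \<in> measurable (borel \<Otimes>\<^sub>M PiM {1..n} (\<lambda>_. borel)) node_space"
proof -
  have "(\<lambda>p. snd p j) \<in> borel_measurable (borel \<Otimes>\<^sub>M PiM {1..n} (\<lambda>_. borel :: real measure))"
    (is "_ \<in> borel_measurable ?B") for j
  proof (cases "j \<in> {1..n}")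
    case True
    show ?thesis by (rule measurable_compose[OF measurable_snd measurable_component_singleton[OF True]])
  next
    case False
    have "(\<lambda>_. undefined :: real) \<in> borel_measurable ?B" by simp
    then show ?thesis
      by (rule measurable_cong[THEN iffD2, rotated])
        (use False in \<open>auto simp: space_pair_measure space_PiM PiE_def extensional_def\<close>)
  qed
  then have "snd \<in> measurable ?B (PiM UNIV (\<lambda>_. borel :: real measure))"
    by (intro measurable_PiM_single') (auto simp: space_PiM)
  then show ?thesis unfolding node_space_def split_beta' by (intro measurable_Pair) simp_all
qed

lemma measurable_node_kernel: "node_kernel n \<in> measurable borel (subprob_algebra node_space)"
  by (rule measurable_distr2[OF measurable_node_data measurable_cost_kernel])

lemma sets_Erlang [measurable_cong]: "sets (Erlang k) = sets borel" and space_Erlang: "space (Erlang k) = UNIV"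
  by (simp_all add: Erlang_def)

lemma Er_borel_problang: "prob_space (Erlang k)"
  unfolding Erlang_def by (rule prob_space_erlang_density) simp

lemma measurable_node_kernel_Erlang: "node_kernel n \<in> measurable (Erlang k) (subprob_algebra node_space)"
  using measurable_node_kernel measurable_cong_sets[OF sets_Erlang refl] by blast

lemma measurable_node_law_kernel:
  "(\<lambda>n. Erlang (n + 1) \<bind> node_kernel n) \<in> measurable (measure_pmf Q) (subprob_algebra node_space)"
proof (simp only: measurable_pmf_measure1, rule funcsetI)
  fix n
  interpret prob_space "Erlang (n + 1)" by (rule Er_borel_problang)
  show "Erlang (n + 1) \<bind> node_kernel n \<in> space (subprob_algebra node_space)"
    using subprob_space_bind[OF _ measurable_node_kernel_Erlang[of n "n + 1"]] subprob_space_axioms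
      sets_bind[OF sets_kernel[OF measurable_node_kernel_Erlang[of n "n + 1"]]]
    by (auto simp: space_subprob_algebra space_Erlang)
qed

lemma sets_node_law [measurable_cong]: "sets (node_law Q) = sets node_space"
  unfolding node_law_def
  by (rule sets_bind[OF sets_kernel[OF measurable_node_law_kernel]]) auto

lemma prob_space_node_law: "prob_space (node_law Q)"
  unfolding node_law_def
proof (rule measure_pmf.prob_space_bind[OF _ measurable_node_law_kernel], rule AE_I2)
  fix n
  \<comment> \<open>Almost sure positivity of \<open>v\<close> avoids the zero measure that stands
    in for the uniform law at \<open>v \<le> 0\<close>.\<close>
  have pos: "AE v in Erlang (n + 1). 0 < v"
    unfolding Erlang_def by (subst AE_density) (auto simp: erlang_density_def intro!: AE_I2 eventually_mono[OF AE_lborel_singleton[of 0]])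
  show "prob_space (Erlang (n + 1) \<bind> node_kernel n)"
  proof (rule prob_space.prob_space_bind[OF Er_borel_problang _ measurable_node_kernel_Erlang])
    show "AE v in Erlang (n + 1). prob_space (node_kernel n v)"
      using pos
    proof eventually_elim
      case (elim v)
      have "(\<lambda>z. (n, v, z)) \<in> measurable (cost_kernel n v) node_space"
        using measurable_compose[OF measurable_Pair1'[of v] measurable_node_data]
        by (simp cong: measurable_cong_sets sets_PiM_cong)
      then show ?case by (rule prob_space.prob_space_distr[OF prob_space_cost_kernel[OF elim]])
    qed
  qed
qed

definition node_box :: "nat \<Rightarrow> (nat \<Rightarrow> real set) \<Rightarrow> node_data set" where
  "node_box n X = {(k, v, z). k = n \<and> v \<in> X 0 \<and> (\<forall>j\<in>{1..n}. z j \<in> X j)}"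

text \<open>The measure \<open>exp (- v) dv\<close> on thresholds combined with Lebesgue measure on
  \<open>[0, v]\<close> for each cost, evaluated on a box. The slot \<open>X 0\<close> constrains
  the threshold, in line with the child index 0.\<close>

definition node_mass :: "nat \<Rightarrow> (nat \<Rightarrow> real set) \<Rightarrow> ennreal" where
  "node_mass n X = (\<integral>\<^sup>+v. ennreal (exp (- v)) * indicator ({0..} \<inter> X 0) v *
     (\<Prod>j\<in>{1..n}. emeasure lborel ({0..v} \<inter> X j)) \<partial>lborel)"

lemma node_box_sets:
  assumes X: "\<And>j. j \<le> n \<Longrightarrow> X j \<in> sets borel"
  shows "node_box n X \<in> sets node_space"
proof -
  have c: "(\<lambda>x. snd (snd x) j) \<in> borel_measurable node_space" for j
    unfolding node_space_def
    by (rule measurable_compose[OF measurable_compose[OF measurable_snd measurable_snd]]) simp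
  have f: "(\<lambda>x. fst (snd x)) \<in> borel_measurable node_space" "fst \<in> measurable node_space (count_space UNIV)"
    unfolding node_space_def by simp_all
  note [measurable] = c f
  have [measurable]: "X 0 \<in> sets borel" using X by simp
  have [measurable]: "Measurable.pred node_space (\<lambda>x. \<forall>j\<in>{1..n}. snd (snd x) j \<in> X j)"
  proof (rule pred_intros_finite)
    fix j assume "j \<in> {1..n}"
    then have [measurable]: "X j \<in> sets borel" using X by simp
    show "Measurable.pred node_space (\<lambda>x. snd (snd x) j \<in> X j)" by measurable
  qed simp
  have "{x \<in> space node_space. fst x = n \<and> fst (snd x) \<in> X 0 \<and> (\<forall>j\<in>{1..n}. snd (snd x) j \<in> X j)} \<in> sets node_space"
    by measurable
  also have "{x \<in> space node_space. fst x = n \<and> fst (snd x) \<in> X 0 \<and> (\<forall>j\<in>{1..n}. snd (snd x) j \<in> X j)} = node_box n X"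
    by (auto simp: node_box_def node_space_def space_pair_measure space_PiM)
  finally show ?thesis .
qed

text \<open>The factors \<open>v^n\<close> of the Erlang density and \<open>1/v^n\<close> of the uniform densities cancel.\<close>

lemma emeasure_node_law_box:
  assumes XB: "\<And>j. j \<le> n \<Longrightarrow> X j \<in> sets borel"
  shows "emeasure (node_law Q) (node_box n X) = ennreal (pmf Q n / fact n) * node_mass n X"
    (is "emeasure _ ?A = _")
proof -
  note A = node_box_sets[OF XB]
  have X [measurable]: "X 0 \<in> sets borel" "\<And>j. j \<in> {1..n} \<Longrightarrow> X j \<in> sets borel" using XB by auto
  have ker: "emeasure (node_kernel k v) ?A = (if k = n then indicator (X 0) v *
      (\<Prod>j\<in>{1..n}. emeasure lborel ({0..v} \<inter> X j) / emeasure lborel {0..v}) else 0)" for k v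
  proof -
    have m: "(\<lambda>z. (k, v, z)) \<in> measurable (cost_kernel k v) node_space"
      using measurable_compose[OF measurable_Pair1'[of v] measurable_node_data]
      by (simp cong: measurable_cong_sets sets_PiM_cong)
    have "(\<lambda>z. (k, v, z)) -` ?A \<inter> space (cost_kernel k v) = (if k = n \<and> v \<in> X 0 then PiE {1..n} X else {})"
      by (auto simp: node_box_def space_PiM PiE_iff)
    then have "emeasure (node_kernel k v) ?A = emeasure (cost_kernel k v) (if k = n \<and> v \<in> X 0 then PiE {1..n} X else {})"
      by (simp only: emeasure_distr[OF m A])
    also have "\<dots> = (if k = n then indicator (X 0) v *
      (\<Prod>j\<in>{1..n}. emeasure lborel ({0..v} \<inter> X j) / emeasure lborel {0..v}) else 0)"
    proof -
      have "emeasure (cost_kernel n v) (PiE {1..n} X) =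
          (\<Prod>j\<in>{1..n}. emeasure lborel ({0..v} \<inter> X j) / emeasure lborel {0..v})"
        by (rule emeasure_cost_kernel) (rule X(2))
      then show ?thesis by simp
    qed
    finally show ?thesis .
  qed
  have "emeasure (node_law Q) ?A = (\<integral>\<^sup>+k. emeasure (Erlang (k + 1) \<bind> node_kernel k) ?A \<partial>measure_pmf Q)"
    unfolding node_law_def by (rule emeasure_bind[OF _ measurable_node_law_kernel A]) simp
  also have "\<dots> = (\<integral>\<^sup>+k. (\<integral>\<^sup>+v. emeasure (node_kernel k v) ?A \<partial>Erlang (k + 1)) \<partial>measure_pmf Q)"
    by (intro nn_integral_cong emeasure_bind[OF _ measurable_node_kernel_Erlang A]) (simp add: space_Erlang)
  also have "\<dots> = (\<integral>\<^sup>+k. (\<integral>\<^sup>+v. indicator (X 0) v *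
      (\<Prod>j\<in>{1..n}. emeasure lborel ({0..v} \<inter> X j) / emeasure lborel {0..v}) \<partial>Erlang (n + 1)) * indicator {n} k \<partial>measure_pmf Q)"
    unfolding ker by (intro nn_integral_cong) (auto simp: indicator_def)
  also have "\<dots> = (\<integral>\<^sup>+v. indicator (X 0) v *
      (\<Prod>j\<in>{1..n}. emeasure lborel ({0..v} \<inter> X j) / emeasure lborel {0..v}) \<partial>Erlang (n + 1)) * ennreal (pmf Q n)"
    by (subst nn_integral_cmult_indicator) (simp_all add: emeasure_pmf_single)
  also have "(\<integral>\<^sup>+v. indicator (X 0) v *
      (\<Prod>j\<in>{1..n}. emeasure lborel ({0..v} \<inter> X j) / emeasure lborel {0..v}) \<partial>Erlang (n + 1)) =
    (\<integral>\<^sup>+v. ennreal (erlang_density n 1 v) * (indicator (X 0) v *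
      (\<Prod>j\<in>{1..n}. emeasure lborel ({0..v} \<inter> X j) / emeasure lborel {0..v})) \<partial>lborel)"
  proof -
    have "(\<lambda>v. emeasure lborel ({0..v} \<inter> UNIV)) \<in> borel_measurable (borel :: real measure)"
      by (rule measurable_emeasure_Icc) simp
    then have [measurable]: "(\<lambda>v. emeasure lborel {0..v}) \<in> borel_measurable (borel :: real measure)" by simp
    have "(\<lambda>v. indicator (X 0) v *
      (\<Prod>j\<in>{1..n}. emeasure lborel ({0..v} \<inter> X j) / emeasure lborel {0..v})) \<in> borel_measurable (borel :: real measure)"
      by (intro borel_measurable_times_ennreal borel_measurable_prod_ennreal borel_measurable_divide_ennreal
          measurable_emeasure_Icc X(2)) measurable
    then show ?thesis unfolding Erlang_def by (subst nn_integral_density) simp_all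
  qed
  also have "\<dots> = (\<integral>\<^sup>+v. ennreal (1 / fact n) * (ennreal (exp (- v)) * indicator ({0..} \<inter> X 0) v *
      (\<Prod>j\<in>{1..n}. emeasure lborel ({0..v} \<inter> X j))) \<partial>lborel)"
  proof (rule nn_integral_cong_AE)
    \<comment> \<open>The powers of \<open>v\<close> are cancelled for \<open>v > 0\<close>; below 0
      both sides vanish, and 0 itself is a null set.\<close>
    show "AE v in lborel. ennreal (erlang_density n 1 v) * (indicator (X 0) v *
      (\<Prod>j\<in>{1..n}. emeasure lborel ({0..v} \<inter> X j) / emeasure lborel {0..v})) =
      ennreal (1 / fact n) * (ennreal (exp (- v)) * indicator ({0..} \<inter> X 0) v *
      (\<Prod>j\<in>{1..n}. emeasure lborel ({0..v} \<inter> X j)))"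
      using AE_lborel_singleton[of 0]
    proof eventually_elim
      case (elim v)
      show ?case
      proof (cases "0 < v")
        case False
        with elim have "v < 0" by simp
        then show ?thesis by (simp add: erlang_density_def)
      next
        case True
        have le: "emeasure lborel ({0..v} \<inter> X j) \<le> ennreal v" for j
          using emeasure_mono[of "{0..v} \<inter> X j" "{0..v}" lborel] True by simp
        define r where "r j = enn2real (emeasure lborel ({0..v} \<inter> X j))" for j
        have r: "emeasure lborel ({0..v} \<inter> X j) = ennreal (r j)" "0 \<le> r j" for j
          using le[of j] unfolding r_def by (auto intro!: ennreal_enn2real[symmetric] simp: less_top[symmetric] top_unique)
        have "(\<Prod>j\<in>{1..n}. emeasure lborel ({0..v} \<inter> X j) / emeasure lborel {0..v}) = ennreal ((\<Prod>j\<in>{1..n}. r j) / v ^ n)"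
          using True r(2) by (simp add: r(1) divide_ennreal prod_ennreal prod_dividef)
        moreover have "(\<Prod>j\<in>{1..n}. emeasure lborel ({0..v} \<inter> X j)) = ennreal (\<Prod>j\<in>{1..n}. r j)"
          using r(2) by (simp add: r(1) prod_ennreal)
        moreover have "erlang_density n 1 v * ((\<Prod>j\<in>{1..n}. r j) / v ^ n) = 1 / fact n * (exp (- v) * (\<Prod>j\<in>{1..n}. r j))"
          using True by (simp add: erlang_density_def)
        ultimately show ?thesis using True r(2)
          by (cases "v \<in> X 0") (simp_all add: ennreal_mult[symmetric] prod_nonneg erlang_density_def)
      qed
    qed
  qed
  also have "\<dots> = ennreal (1 / fact n) * (\<integral>\<^sup>+v. ennreal (exp (- v)) * indicator ({0..} \<inter> X 0) v *
      (\<Prod>j\<in>{1..n}. emeasure lborel ({0..v} \<inter> X j)) \<partial>lborel)"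
    by (rule nn_integral_cmult)
      (intro borel_measurable_times_ennreal borel_measurable_prod_ennreal; (simp add: X measurable_emeasure_Icc)?)
  finally show ?thesis unfolding node_mass_def
    by (simp add: mult.commute mult.left_commute ennreal_mult[symmetric] flip: mult.assoc)
qed

text \<open>Fubini for coordinates grouped in blocks; the blocks in use are a node's threshold
  together with the costs of its children.\<close>

lemma (in product_sigma_finite) nn_integral_PiM_blocks:
  assumes "finite I" and "\<And>w. w \<in> I \<Longrightarrow> finite (B w)" and "disjoint_family_on B I"
    and "\<And>w. w \<in> I \<Longrightarrow> f w \<in> borel_measurable (PiM (B w) M)"
  shows "(\<integral>\<^sup>+y. (\<Prod>w\<in>I. f w (restrict y (B w))) \<partial>PiM (\<Union>w\<in>I. B w) M) = (\<Prod>w\<in>I. \<integral>\<^sup>+y. f w y \<partial>PiM (B w) M)"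
  using assms
proof (induction I)
  case empty
  then show ?case by (simp add: space_PiM)
next
  case (insert u I)
  let ?R = "\<Union>w\<in>I. B w"
  have dis: "B u \<inter> ?R = {}" "disjoint_family_on B I"
    using insert.prems(2) insert.hyps by (auto simp: disjoint_family_on_def)
  have fin: "finite (B u)" "finite ?R" using insert.prems(1) insert.hyps by auto
  have m: "(\<lambda>y. f w (restrict y (B w))) \<in> borel_measurable (PiM J M)"
    if "w \<in> insert u I" "B w \<subseteq> J" for w J
    by (rule measurable_compose[OF measurable_restrict_subset[OF that(2)] insert.prems(3)[OF that(1)]])
  have mI: "(\<lambda>y. \<Prod>w\<in>I. f w (restrict y (B w))) \<in> borel_measurable (PiM ?R M)"
    by (intro borel_measurable_prod_ennreal m) auto
  have "(\<integral>\<^sup>+y. (\<Prod>w\<in>insert u I. f w (restrict y (B w))) \<partial>PiM (B u \<union> ?R) M) =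
      (\<integral>\<^sup>+x. (\<integral>\<^sup>+y. (\<Prod>w\<in>insert u I. f w (restrict (merge (B u) ?R (x, y)) (B w))) \<partial>PiM ?R M) \<partial>PiM (B u) M)"
    by (rule product_nn_integral_fold[OF dis(1) fin]) (intro borel_measurable_prod_ennreal m, auto)
  also have "\<dots> = (\<integral>\<^sup>+x. (\<integral>\<^sup>+y. f u x * (\<Prod>w\<in>I. f w (restrict y (B w))) \<partial>PiM ?R M) \<partial>PiM (B u) M)"
  proof (intro nn_integral_cong)
    fix x y assume x: "x \<in> space (PiM (B u) M)" and "y \<in> space (PiM ?R M)"
    have "restrict (merge (B u) ?R (x, y)) (B u) = x"
      using x by (auto simp: space_PiM PiE_def extensional_def merge_def fun_eq_iff)
    moreover have "restrict (merge (B u) ?R (x, y)) (B w) = restrict y (B w)" if "w \<in> I" for w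
      using that dis by (auto simp: merge_def fun_eq_iff)
    ultimately show "(\<Prod>w\<in>insert u I. f w (restrict (merge (B u) ?R (x, y)) (B w))) = f u x * (\<Prod>w\<in>I. f w (restrict y (B w)))"
      using insert.hyps by (simp cong: prod.cong)
  qed
  also have "\<dots> = (\<integral>\<^sup>+x. f u x * (\<Prod>w\<in>I. \<integral>\<^sup>+y. f w y \<partial>PiM (B w) M) \<partial>PiM (B u) M)"
    by (intro nn_integral_cong, subst nn_integral_cmult[OF mI], subst insert.IH[OF insert.prems(1) dis(2) insert.prems(3)]) auto
  also have "\<dots> = (\<Prod>w\<in>insert u I. \<integral>\<^sup>+y. f w y \<partial>PiM (B w) M)"
    using insert.hyps insert.prems(3)[of u] by (subst nn_integral_multc) simp_all
  finally show ?case by (simp only: UN_insert)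
qed


section \<open>The joint density of the tree marks\<close>

definition offspring_law :: "nat pmf \<Rightarrow> nat list \<Rightarrow> nat pmf" where
  "offspring_law P w = (if w = [] then P else map_pmf (\<lambda>k. k - 1) P)"

definition shape_event :: "nat \<Rightarrow> (nat list \<Rightarrow> nat) \<Rightarrow> (nat list \<Rightarrow> node_data) set" where
  "shape_event T m = {\<omega>. \<forall>w\<in>inner_nodes T m. ewt_n \<omega> w = m w}"

definition tree_marks :: "nat \<Rightarrow> (nat list \<Rightarrow> nat) \<Rightarrow> (nat list \<Rightarrow> node_data) \<Rightarrow> nat list \<Rightarrow> real" where
  "tree_marks T m \<omega> = (\<lambda>x\<in>explored T m.
     if last x = 0 then ewt_v \<omega> (butlast x) else ewt_cost \<omega> (butlast x) (last x))"

text \<open>The constant in the joint density, not yet a probability: \<open>mark_density\<close>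
  integrates to \<Prod> m!, and multiplying by this gives the probability that the backbone has
  shape \<open>m\<close> down to depth \<open>T\<close>.\<close>

definition shape_prob :: "nat pmf \<Rightarrow> nat \<Rightarrow> (nat list \<Rightarrow> nat) \<Rightarrow> real" where
  "shape_prob P T m = (\<Prod>w\<in>inner_nodes T m. pmf (offspring_law P w) (m w) / fact (m w))"

lemma ewt_data_law_eq: "ewt_data_law P = PiM indices (\<lambda>w. node_law (offspring_law P w))"
  unfolding ewt_data_law_def offspring_law_def by (intro PiM_cong) auto

lemma sets_ewt_data_law [measurable_cong]: "sets (ewt_data_law P) = sets data_space"
  unfolding ewt_data_law_eq by (rule sets_PiM_cong) (simp_all add: sets_node_law)

lemma prob_space_ewt_data_law: "prob_space (ewt_data_law P)"
  unfolding ewt_data_law_eq by (intro prob_space_PiM prob_space_node_law)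

lemma inner_subset_indices: "inner_nodes T m \<subseteq> indices"
  using nodes_subset_indices by (auto simp: inner_nodes_def)

lemma measurable_tree_marks:
  "tree_marks T m \<in> measurable data_space (mark_space T m)"
  unfolding tree_marks_def by (rule measurable_restrict) simp

lemma shape_event_sets: "{\<omega> \<in> space data_space. \<omega> \<in> shape_event T m}
    \<in> sets data_space"
proof -
  have "Measurable.pred data_space (\<lambda>\<omega>. \<forall>w\<in>inner_nodes T m. ewt_n \<omega> w = m w)"
    by (intro pred_intros_finite finite_inner) measurable
  then show ?thesis by (simp add: shape_event_def pred_def)
qed

lemma explored_blocks: "explored T m = (\<Union>w\<in>inner_nodes T m. (\<lambda>j. w @ [j]) ` {..m w})"
  by (auto simp: explored_def)

text \<open>The exponential and the constraints of \<open>tree_box\<close> couple only a threshold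
  and the costs at the same node, so on a box the density is a product over blocks.\<close>

lemma emeasure_mark_density_box:
  assumes A: "\<And>x. x \<in> explored T m \<Longrightarrow> A x \<in> sets borel"
  shows "(\<integral>\<^sup>+y. ennreal (mark_density T m y) * indicator (PiE (explored T m) A) y \<partial>mark_lborel T m) =
    (\<Prod>w\<in>inner_nodes T m. node_mass (m w) (\<lambda>j. A (w @ [j])))"
proof -
  let ?E = "explored T m" and ?I = "inner_nodes T m"
  interpret L: product_sigma_finite "\<lambda>_. lborel :: real measure" ..
  define B where "B w = (\<lambda>j. w @ [j]) ` {..m w}" for w :: "nat list"
  define f where "f w y = ennreal (exp (- y (w @ [0]))) * indicator ({0..} \<inter> A (w @ [0])) (y (w @ [0])) *
      (\<Prod>j\<in>{1..m w}. indicator {p. 0 \<le> snd p \<and> snd p < fst p} (y (w @ [0]), y (w @ [j])) *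
        indicator (A (w @ [j])) (y (w @ [j])))" for w and y :: "nat list \<Rightarrow> real"
  have EB: "?E = (\<Union>w\<in>?I. B w)" unfolding explored_blocks B_def ..
  have disB: "disjoint_family_on B ?I" by (auto simp: disjoint_family_on_def B_def)
  have AB: "A (w @ [j]) \<in> sets borel" if "w \<in> ?I" "j \<le> m w" for w j
    using A[of "w @ [j]"] that by (simp add: explored_snoc)
  have halfplane [measurable]: "{p :: real \<times> real. 0 \<le> snd p \<and> snd p < fst p} \<in> sets (borel \<Otimes>\<^sub>M borel)"
  proof -
    have "{p \<in> space (borel \<Otimes>\<^sub>M borel). 0 \<le> (snd p :: real) \<and> snd p < fst p} \<in> sets (borel \<Otimes>\<^sub>M borel)" by measurable
    then show ?thesis by (simp add: space_pair_measure)
  qed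
  have f_meas: "f w \<in> borel_measurable (PiM (B w) (\<lambda>_. lborel))" if w: "w \<in> ?I" for w
  proof -
    have c: "(\<lambda>y. y (w @ [j])) \<in> borel_measurable (PiM (B w) (\<lambda>_. borel :: real measure))" if "j \<le> m w" for j
      by (rule measurable_component_singleton) (use that in \<open>auto simp: B_def\<close>)
    have c0: "(\<lambda>y. y (w @ [0])) \<in> borel_measurable (PiM (B w) (\<lambda>_. borel :: real measure))" by (rule c) simp
    have A0: "A (w @ [0]) \<in> sets borel" using AB[OF w, of 0] by simp
    have e: "(\<lambda>y. ennreal (exp (- y (w @ [0])))) \<in> borel_measurable (PiM (B w) (\<lambda>_. borel :: real measure))"
      by (rule measurable_compose[OF c0, where g = "\<lambda>v. ennreal (exp (- v))"]) simp
    have i: "(\<lambda>y. indicator ({0..} \<inter> A (w @ [0])) (y (w @ [0])) :: ennreal) \<in> borel_measurable (PiM (B w) (\<lambda>_. borel :: real measure))"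
      by (rule measurable_compose[OF c0]) (use A0 in simp)
    have j: "(\<lambda>y. indicator {p. 0 \<le> snd p \<and> snd p < fst p} (y (w @ [0]), y (w @ [j])) *
        indicator (A (w @ [j])) (y (w @ [j])) :: ennreal) \<in> borel_measurable (PiM (B w) (\<lambda>_. borel :: real measure))"
      if "j \<in> {1..m w}" for j
    proof -
      note c0 [measurable]
      have [measurable]: "(\<lambda>y. y (w @ [j])) \<in> borel_measurable (PiM (B w) (\<lambda>_. borel :: real measure))"
        "A (w @ [j]) \<in> sets borel"
        using c[of j] AB[OF w, of j] that by auto
      show ?thesis by measurable
    qed
    show ?thesis unfolding measurable_PiM_lborel_cong f_def[abs_def]
      by (intro borel_measurable_times_ennreal borel_measurable_prod_ennreal e i j)
  qed
  have block: "(\<integral>\<^sup>+y. f w y \<partial>PiM (B w) (\<lambda>_. lborel)) = node_mass (m w) (\<lambda>j. A (w @ [j]))" if w: "w \<in> ?I" for w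
  proof -
    define D where "D = (\<lambda>j. w @ [j]) ` {1..m w}"
    have Bw: "B w = insert (w @ [0]) D"
    proof -
      have "{..m w} = insert 0 {1..m w}" by auto
      then show ?thesis by (simp add: B_def D_def)
    qed
    have D: "finite D" "w @ [0] \<notin> D" by (auto simp: D_def)
    have prodD: "(\<Prod>j\<in>{1..m w}. g (w @ [j])) = (\<Prod>x\<in>D. g x)" for g :: "nat list \<Rightarrow> ennreal"
      unfolding D_def by (subst prod.reindex) (auto simp: inj_on_def)
    have AD: "x \<in> D \<Longrightarrow> A x \<in> sets borel" for x using AB[OF w] by (auto simp: D_def)
    have "(\<integral>\<^sup>+y. f w y \<partial>PiM (B w) (\<lambda>_. lborel)) =
        (\<integral>\<^sup>+v. (\<integral>\<^sup>+x. f w (x(w @ [0] := v)) \<partial>PiM D (\<lambda>_. lborel)) \<partial>lborel)"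
      unfolding Bw by (rule L.product_nn_integral_insert_rev[OF D]) (use f_meas[OF w] in \<open>simp add: Bw\<close>)
    also have "\<dots> = (\<integral>\<^sup>+v. ennreal (exp (- v)) * indicator ({0..} \<inter> A (w @ [0])) v *
      (\<Prod>j\<in>{1..m w}. emeasure lborel ({0..v} \<inter> A (w @ [j]))) \<partial>lborel)"
    proof (rule nn_integral_cong)
      fix v :: real
      have "(\<integral>\<^sup>+x. f w (x(w @ [0] := v)) \<partial>PiM D (\<lambda>_. lborel)) =
          (\<integral>\<^sup>+x. ennreal (exp (- v)) * indicator ({0..} \<inter> A (w @ [0])) v *
            (\<Prod>z\<in>D. indicator ({0..<v} \<inter> A z) (x z)) \<partial>PiM D (\<lambda>_. lborel))"
        unfolding prodD[symmetric] f_def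
        by (intro nn_integral_cong arg_cong2[of _ _ _ _ "(*)"] prod.cong) (auto simp: indicator_def)
      also have "\<dots> = ennreal (exp (- v)) * indicator ({0..} \<inter> A (w @ [0])) v *
          (\<integral>\<^sup>+x. (\<Prod>z\<in>D. indicator ({0..<v} \<inter> A z) (x z)) \<partial>PiM D (\<lambda>_. lborel))"
      proof (rule nn_integral_cmult)
        have "(\<lambda>x. indicator ({0..<v} \<inter> A z) (x z) :: ennreal) \<in> borel_measurable (PiM D (\<lambda>_. borel :: real measure))"
          if "z \<in> D" for z
          by (rule measurable_compose[OF measurable_component_singleton[OF that]]) (use AD[OF that] in simp)
        then show "(\<lambda>x. \<Prod>z\<in>D. indicator ({0..<v} \<inter> A z) (x z) :: ennreal) \<in> borel_measurable (PiM D (\<lambda>_. lborel))"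
          unfolding measurable_PiM_lborel_cong by (rule borel_measurable_prod_ennreal)
      qed
      also have "(\<integral>\<^sup>+x. (\<Prod>z\<in>D. indicator ({0..<v} \<inter> A z) (x z)) \<partial>PiM D (\<lambda>_. lborel)) =
          (\<Prod>z\<in>D. \<integral>\<^sup>+c. indicator ({0..<v} \<inter> A z) c \<partial>lborel)"
        by (rule L.product_nn_integral_prod[OF D(1)]) (use AD in simp)
      \<comment> \<open>The strict bound in \<open>tree_box\<close> and the closed interval of the
        uniform law differ by a single point.\<close>
      also have "\<dots> = (\<Prod>z\<in>D. emeasure lborel ({0..v} \<inter> A z))"
      proof (rule prod.cong[OF refl])
        fix z assume "z \<in> D"
        then have [measurable]: "A z \<in> sets borel" by (rule AD)
        have "(\<integral>\<^sup>+c. indicator ({0..<v} \<inter> A z) c \<partial>lborel) = (\<integral>\<^sup>+c. indicator ({0..v} \<inter> A z) c \<partial>lborel)"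
          by (rule nn_integral_cong_AE)
            (use AE_lborel_singleton[of v] in eventually_elim, auto simp: indicator_def)
        then show "(\<integral>\<^sup>+c. indicator ({0..<v} \<inter> A z) c \<partial>lborel) = emeasure lborel ({0..v} \<inter> A z)"
          by simp
      qed
      finally show "(\<integral>\<^sup>+x. f w (x(w @ [0] := v)) \<partial>PiM D (\<lambda>_. lborel)) =
          ennreal (exp (- v)) * indicator ({0..} \<inter> A (w @ [0])) v *
          (\<Prod>j\<in>{1..m w}. emeasure lborel ({0..v} \<inter> A (w @ [j])))"
        using prodD[of "\<lambda>x. emeasure lborel ({0..v} \<inter> A x)"] by (simp only:)
    qed
    finally show ?thesis by (simp only: node_mass_def)
  qed
  have "(\<integral>\<^sup>+y. ennreal (mark_density T m y) * indicator (PiE ?E A) y \<partial>mark_lborel T m) =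
      (\<integral>\<^sup>+y. (\<Prod>w\<in>?I. f w (restrict y (B w))) \<partial>mark_lborel T m)"
  proof (rule nn_integral_cong)
    fix y assume y: "y \<in> space (mark_lborel T m)"
    have fr: "f w (restrict y (B w)) = f w y" for w
      unfolding f_def by (intro arg_cong2[of _ _ _ _ "(*)"] prod.cong refl) (auto simp: B_def)
    show "ennreal (mark_density T m y) * indicator (PiE ?E A) y = (\<Prod>w\<in>?I. f w (restrict y (B w)))"
    proof (cases "tree_box T m y \<and> (\<forall>x\<in>?E. y x \<in> A x)")
      case True
      then have "f w y = ennreal (exp (- y (w @ [0])))" if w: "w \<in> ?I" for w
      proof -
        have "(\<Prod>j\<in>{1..m w}. indicator {p. 0 \<le> snd p \<and> snd p < fst p} (y (w @ [0]), y (w @ [j])) *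
            indicator (A (w @ [j])) (y (w @ [j]))) = (1 :: ennreal)"
          by (rule prod.neutral) (use True w in \<open>auto simp: tree_box_def explored_snoc\<close>)
        moreover have "0 \<le> y (w @ [0])" "y (w @ [0]) \<in> A (w @ [0])"
          using True w by (auto simp: tree_box_def explored_snoc)
        ultimately show ?thesis by (simp add: f_def)
      qed
      then have "(\<Prod>w\<in>?I. f w y) = ennreal (\<Prod>w\<in>?I. exp (- y (w @ [0])))" by (simp add: prod_ennreal)
      moreover have "y \<in> PiE ?E A" using True y by (auto simp: space_PiM PiE_iff)
      ultimately show ?thesis
        using True by (simp add: fr mark_density_def exp_sum[OF finite_inner, symmetric] sum_negf)
    next
      case False
      have "\<exists>w\<in>?I. f w y = 0"
      proof (cases "tree_box T m y")
        case True
        with False obtain x where "x \<in> ?E" "y x \<notin> A x" by blast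
        then obtain w j where w: "w \<in> ?I" "j \<le> m w" "y (w @ [j]) \<notin> A (w @ [j])" by (auto simp: explored_def)
        have "f w y = 0"
        proof (cases "j = 0")
          case False
          then have "(\<Prod>j\<in>{1..m w}. indicator {p. 0 \<le> snd p \<and> snd p < fst p} (y (w @ [0]), y (w @ [j])) *
            indicator (A (w @ [j])) (y (w @ [j]))) = (0 :: ennreal)"
            using w by (intro prod_zero bexI[of _ j]) auto
          then show ?thesis unfolding f_def by (simp only: mult_zero_right)
        qed (use w in \<open>simp add: f_def\<close>)
        with w show ?thesis by blast
      next
        case False
        then obtain w where w: "w \<in> ?I" "\<not> (0 \<le> y (w @ [0]) \<and> (\<forall>j\<in>{1..m w}. 0 \<le> y (w @ [j]) \<and> y (w @ [j]) < y (w @ [0])))"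
          by (auto simp: tree_box_def)
        have "f w y = 0"
        proof (cases "0 \<le> y (w @ [0])")
          case True
          with w obtain j where "j \<in> {1..m w}" "\<not> (0 \<le> y (w @ [j]) \<and> y (w @ [j]) < y (w @ [0]))" by blast
          then have "(\<Prod>j\<in>{1..m w}. indicator {p. 0 \<le> snd p \<and> snd p < fst p} (y (w @ [0]), y (w @ [j])) *
            indicator (A (w @ [j])) (y (w @ [j]))) = (0 :: ennreal)"
            by (intro prod_zero bexI[of _ j]) auto
          then show ?thesis unfolding f_def by (simp only: mult_zero_right)
        qed (simp add: f_def)
        with w show ?thesis by blast
      qed
      then have "(\<Prod>w\<in>?I. f w (restrict y (B w))) = 0"
        unfolding fr using finite_inner by (intro prod_zero) auto
      moreover have "ennreal (mark_density T m y) * indicator (PiE ?E A) y = 0"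
        using False by (auto simp: mark_density_def indicator_def PiE_iff)
      ultimately show ?thesis by (simp only:)
    qed
  qed
  also have "\<dots> = (\<Prod>w\<in>?I. \<integral>\<^sup>+y. f w y \<partial>PiM (B w) (\<lambda>_. lborel))"
    unfolding EB by (rule L.nn_integral_PiM_blocks[OF finite_inner _ disB f_meas]) (auto simp: B_def)
  also have "\<dots> = (\<Prod>w\<in>?I. node_mass (m w) (\<lambda>j. A (w @ [j])))"
    by (rule prod.cong[OF refl]) (rule block)
  finally show ?thesis .
qed

text \<open>Both sides integrate \<open>h\<close> against measures that agree on boxes: on the event
  that the shape is \<open>m\<close>, a box of marks prescribes one \<open>node_box\<close> at each
  inner node, and the nodes are independent.\<close>

lemma nn_integral_tree_marks:
  assumes h [measurable]: "h \<in> borel_measurable (mark_space T m)"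
  shows "(\<integral>\<^sup>+\<omega>. h (tree_marks T m \<omega>) * indicator (shape_event T m) \<omega> \<partial>ewt_data_law P) =
    ennreal (shape_prob P T m) * (\<integral>\<^sup>+y. h y * ennreal (mark_density T m y) \<partial>mark_lborel T m)"
proof -
  let ?E = "explored T m" and ?I = "inner_nodes T m"
  let ?S = "data_space"
  interpret P: prob_space "ewt_data_law P" by (rule prob_space_ewt_data_law)
  interpret N: product_prob_space "\<lambda>w. node_law (offspring_law P w)" indices
    by (rule product_prob_spaceI) (rule prob_space_node_law)
  have sp: "space (ewt_data_law P) = space ?S" by (rule sets_eq_imp_space_eq[OF sets_ewt_data_law])
  have mc: "measurable (ewt_data_law P) X = measurable ?S X" for X :: "'x measure"
    by (rule measurable_cong_sets[OF sets_ewt_data_law refl])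
  have tm [measurable]: "tree_marks T m \<in> measurable (ewt_data_law P) (mark_space T m)"
    unfolding mc by (rule measurable_tree_marks)
  have ind [measurable]: "indicator (shape_event T m) \<in> borel_measurable (ewt_data_law P)"
    unfolding mc by (intro borel_measurable_indicator') (use shape_event_sets in simp)
  define M1 where "M1 = distr (density (ewt_data_law P) (indicator (shape_event T m))) (mark_space T m) (tree_marks T m)"
  define M2 where "M2 = density (mark_lborel T m) (\<lambda>y. ennreal (shape_prob P T m) * ennreal (mark_density T m y))"
  have dm: "(\<lambda>y. ennreal (mark_density T m y)) \<in> borel_measurable (mark_lborel T m)"
    unfolding measurable_PiM_lborel_cong by simp
  have tmd: "tree_marks T m \<in> measurable (density (ewt_data_law P) (indicator (shape_event T m))) (mark_space T m)"
    using tm by simp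
  have "M1 = M2"
  proof (rule measure_eqI_PiM_finite[OF finite_explored])
    show "sets M1 = sets (mark_space T m)" "sets M2 = sets (mark_space T m)"
      by (simp_all add: M1_def M2_def cong: sets_PiM_cong)
    show "range (\<lambda>_ :: nat. PiE ?E (\<lambda>_. UNIV)) \<subseteq> prod_algebra ?E (\<lambda>_. borel :: real measure)"
      by (auto intro!: prod_algebraI_finite finite_explored)
    show "(\<Union>i :: nat. PiE ?E (\<lambda>_. UNIV)) = space (mark_space T m)" by (simp add: space_PiM)
    have U: "PiE ?E (\<lambda>_. UNIV) \<in> sets (mark_space T m)"
      by (intro sets_PiM_I_finite finite_explored) auto
    have "emeasure M1 (PiE ?E (\<lambda>_. UNIV)) = (\<integral>\<^sup>+\<omega>. indicator (shape_event T m) \<omega> *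
        indicator (tree_marks T m -` PiE ?E (\<lambda>_. UNIV) \<inter> space (ewt_data_law P)) \<omega> \<partial>ewt_data_law P)"
      unfolding M1_def emeasure_distr[OF tmd U] space_density
      by (rule emeasure_density[OF ind measurable_sets[OF tm U]])
    also have "\<dots> \<le> (\<integral>\<^sup>+\<omega>. 1 \<partial>ewt_data_law P)" by (intro nn_integral_mono) (auto simp: indicator_def)
    also have "\<dots> = 1" by (simp add: P.emeasure_space_1)
    finally have "emeasure M1 (PiE ?E (\<lambda>_. UNIV)) \<le> 1" .
    then show "emeasure M1 (PiE ?E (\<lambda>_. UNIV)) \<noteq> \<infinity>" by (auto simp: top_unique)
  next
    fix A :: "nat list \<Rightarrow> real set" assume A: "\<And>x. x \<in> ?E \<Longrightarrow> A x \<in> sets borel"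
    have AB: "A (w @ [j]) \<in> sets borel" if "w \<in> ?I" "j \<le> m w" for w j
      using A[of "w @ [j]"] that by (simp add: explored_snoc)
    define S where "S w = node_box (m w) (\<lambda>j. A (w @ [j]))" for w
    have S: "S w \<in> sets (node_law (offspring_law P w))" if "w \<in> ?I" for w
      unfolding S_def sets_node_law by (rule node_box_sets) (rule AB[OF that])
    have tmA: "tree_marks T m \<omega> \<in> PiE ?E A \<and> \<omega> \<in> shape_event T m \<longleftrightarrow> (\<forall>w\<in>?I. \<omega> w \<in> S w)" for \<omega>
    proof -
      have "tree_marks T m \<omega> \<in> PiE ?E A \<longleftrightarrow> (\<forall>w\<in>?I. \<forall>j\<le>m w. (if j = 0 then ewt_v \<omega> w else ewt_cost \<omega> w j) \<in> A (w @ [j]))"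
        unfolding tree_marks_def restrict_PiE_iff explored_def by fastforce
      also have "\<dots> \<longleftrightarrow> (\<forall>w\<in>?I. ewt_v \<omega> w \<in> A (w @ [0]) \<and> (\<forall>j\<in>{1..m w}. ewt_cost \<omega> w j \<in> A (w @ [j])))"
        by (intro ball_cong refl) (auto split: if_splits)
      finally have *: "tree_marks T m \<omega> \<in> PiE ?E A \<longleftrightarrow>
          (\<forall>w\<in>?I. ewt_v \<omega> w \<in> A (w @ [0]) \<and> (\<forall>j\<in>{1..m w}. ewt_cost \<omega> w j \<in> A (w @ [j])))" .
      have **: "\<omega> w \<in> S w \<longleftrightarrow> ewt_n \<omega> w = m w \<and> ewt_v \<omega> w \<in> A (w @ [0]) \<and>
          (\<forall>j\<in>{1..m w}. ewt_cost \<omega> w j \<in> A (w @ [j]))" for w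
        by (cases "\<omega> w") (simp add: S_def node_box_def ewt_n_def ewt_v_def ewt_cost_def)
      show ?thesis unfolding * ** shape_event_def mem_Collect_eq by blast
    qed
    have PA: "PiE ?E A \<in> sets (mark_space T m)" using A finite_explored by (intro sets_PiM_I_finite) auto
    have "emeasure M1 (PiE ?E A) =
        emeasure (density (ewt_data_law P) (indicator (shape_event T m))) (tree_marks T m -` PiE ?E A \<inter> space (ewt_data_law P))"
      unfolding M1_def by (subst emeasure_distr[OF tmd PA]) simp
    also have "\<dots> = (\<integral>\<^sup>+\<omega>. indicator (shape_event T m) \<omega> * indicator (tree_marks T m -` PiE ?E A \<inter> space (ewt_data_law P)) \<omega> \<partial>ewt_data_law P)"
      by (rule emeasure_density[OF ind measurable_sets[OF tm PA]])
    also have "\<dots> = (\<integral>\<^sup>+\<omega>. indicator {\<omega> \<in> space (ewt_data_law P). \<forall>w\<in>?I. \<omega> w \<in> S w} \<omega> \<partial>ewt_data_law P)"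
      unfolding tmA[symmetric] by (intro nn_integral_cong) (auto simp: indicator_def)
    also have "\<dots> = emeasure (ewt_data_law P) {\<omega> \<in> space (ewt_data_law P). \<forall>w\<in>?I. \<omega> w \<in> S w}"
    proof (rule nn_integral_indicator)
      have "{\<omega> \<in> space (ewt_data_law P). \<forall>w\<in>?I. \<omega> w \<in> S w} = space (ewt_data_law P) \<inter> (tree_marks T m -` PiE ?E A \<inter> space (ewt_data_law P))
          \<inter> {\<omega> \<in> space ?S. \<omega> \<in> shape_event T m}"
        unfolding tmA[symmetric] sp by auto
      then show "{\<omega> \<in> space (ewt_data_law P). \<forall>w\<in>?I. \<omega> w \<in> S w} \<in> sets (ewt_data_law P)"
        using measurable_sets[OF tm PA] shape_event_sets[of T m] by (auto simp: sets_ewt_data_law)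
    qed
    also have "\<dots> = (\<Prod>w\<in>?I. emeasure (node_law (offspring_law P w)) (S w))"
      unfolding ewt_data_law_eq by (rule N.emeasure_PiM_Collect[OF inner_subset_indices finite_inner S])
    also have "\<dots> = (\<Prod>w\<in>?I. ennreal (pmf (offspring_law P w) (m w) / fact (m w)) *
        node_mass (m w) (\<lambda>j. A (w @ [j])))"
      unfolding S_def by (intro prod.cong refl emeasure_node_law_box AB) auto
    also have "\<dots> = ennreal (shape_prob P T m) * (\<integral>\<^sup>+y. ennreal (mark_density T m y) * indicator (PiE ?E A) y \<partial>mark_lborel T m)"
      by (simp add: prod.distrib emeasure_mark_density_box A shape_prob_def prod_ennreal)
    also have "\<dots> = (\<integral>\<^sup>+y. ennreal (shape_prob P T m) * (ennreal (mark_density T m y) * indicator (PiE ?E A) y) \<partial>mark_lborel T m)"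
    proof (rule nn_integral_cmult[symmetric])
      have "indicator (PiE ?E A) \<in> borel_measurable (mark_lborel T m)"
        unfolding measurable_PiM_lborel_cong using PA by simp
      then show "(\<lambda>y. ennreal (mark_density T m y) * indicator (PiE ?E A) y) \<in> borel_measurable (mark_lborel T m)"
        by (rule borel_measurable_times_ennreal[OF dm])
    qed
    also have "\<dots> = emeasure M2 (PiE ?E A)"
      unfolding M2_def using dm PA
      by (subst emeasure_density) (auto simp: mult.assoc cong: sets_PiM_cong)
    finally show "emeasure M1 (PiE ?E A) = emeasure M2 (PiE ?E A)" .
  qed
  have hl: "h \<in> borel_measurable (mark_lborel T m)" unfolding measurable_PiM_lborel_cong by (rule h)
  have "(\<integral>\<^sup>+\<omega>. h (tree_marks T m \<omega>) * indicator (shape_event T m) \<omega> \<partial>ewt_data_law P) =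
      (\<integral>\<^sup>+\<omega>. indicator (shape_event T m) \<omega> * h (tree_marks T m \<omega>) \<partial>ewt_data_law P)"
    by (simp add: mult.commute)
  also have "\<dots> = (\<integral>\<^sup>+\<omega>. h (tree_marks T m \<omega>) \<partial>density (ewt_data_law P) (indicator (shape_event T m)))"
    by (rule nn_integral_density[symmetric, OF ind measurable_compose[OF tm h]])
  also have "\<dots> = (\<integral>\<^sup>+y. h y \<partial>M1)"
    unfolding M1_def by (rule nn_integral_distr[symmetric, OF tmd]) (simp add: h)
  also have "\<dots> = (\<integral>\<^sup>+y. h y \<partial>M2)" by (simp only: \<open>M1 = M2\<close>)
  also have "\<dots> = (\<integral>\<^sup>+y. ennreal (shape_prob P T m) * ennreal (mark_density T m y) * h y \<partial>mark_lborel T m)"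
    unfolding M2_def using dm by (intro nn_integral_density hl) simp
  also have "\<dots> = (\<integral>\<^sup>+y. ennreal (shape_prob P T m) * (h y * ennreal (mark_density T m y)) \<partial>mark_lborel T m)"
    by (simp add: mult_ac)
  also have "\<dots> = ennreal (shape_prob P T m) * (\<integral>\<^sup>+y. h y * ennreal (mark_density T m y) \<partial>mark_lborel T m)"
    by (rule nn_integral_cmult[OF borel_measurable_times_ennreal[OF hl dm]])
  finally show ?thesis .
qed

section \<open>Comparing the two models\<close>

definition shape_of :: "nat \<Rightarrow> (nat list \<Rightarrow> node_data) \<Rightarrow> nat list \<Rightarrow> nat" where
  "shape_of T \<omega> = (\<lambda>w. if w \<in> inner_nodes T (ewt_n \<omega>) then ewt_n \<omega> w else 0)"

lemma inner_shape_of: "inner_nodes T (shape_of T \<omega>) = inner_nodes T (ewt_n \<omega>)"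
  by (rule prune_nodes(2)[OF shape_of_def])

lemma shape_of_shapes: "shape_of T \<omega> \<in> shapes T"
  unfolding shapes_def by (simp add: inner_shape_of) (simp add: shape_of_def)

lemma shape_of_event: "\<omega> \<in> shape_event T (shape_of T \<omega>)"
  unfolding shape_event_def by (simp add: inner_shape_of) (simp add: shape_of_def)

text \<open>A shape has finite support and is determined by the finite graph of its non-zero values.
  Countability allows almost sure statements for all shapes at once.\<close>

lemma countable_shapes: "countable (shapes T)"
proof -
  define f where "f m = (\<lambda>w. (w, m w)) ` {w. m w \<noteq> 0}" for m :: "nat list \<Rightarrow> nat"
  have "f ` shapes T \<subseteq> Collect finite"
  proof (intro image_subsetI CollectI)
    fix m assume "m \<in> shapes T"
    then have "{w. m w \<noteq> 0} \<subseteq> inner_nodes T m" by (auto simp: shapes_def)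
    then show "finite (f m)" unfolding f_def by (intro finite_imageI finite_subset[OF _ finite_inner])
  qed
  then have c: "countable (f ` shapes T)"
    by (rule countable_subset) (rule countable_Collect_finite)
  have "m = l" if eq: "f m = f l" for m l
  proof
    fix w
    have *: "(w, k) \<in> f m \<longleftrightarrow> k = m w \<and> m w \<noteq> 0" for k m unfolding f_def by auto
    show "m w = l w" using *[of "m w" m] *[of "m w" l] *[of "l w" l] *[of "l w" m] eq by metis
  qed
  then have "inj_on f (shapes T)" by (auto intro: inj_onI)
  then show ?thesis using c by (rule countable_image_inj_on[rotated])
qed

lemma tree_marks_simps:
  assumes "w \<in> inner_nodes T m"
  shows "tree_marks T m \<omega> (w @ [0]) = ewt_v \<omega> w"
    and "j \<in> {1..m w} \<Longrightarrow> tree_marks T m \<omega> (w @ [j]) = ewt_cost \<omega> w j"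
  using assms by (simp_all add: tree_marks_def explored_snoc)

lemma indicator_shape_event_measurable:
  "(indicator (shape_event T m) :: _ \<Rightarrow> ennreal) \<in> borel_measurable (ewt_data_law P)"
  unfolding measurable_cong_sets[OF sets_ewt_data_law refl]
  by (intro borel_measurable_indicator') (use shape_event_sets in simp)

lemma tree_marks_measurable_ewt:
  "tree_marks T m \<in> measurable (ewt_data_law P) (mark_space T m)"
  unfolding measurable_cong_sets[OF sets_ewt_data_law refl] by (rule measurable_tree_marks)

text \<open>The indicator of the bad marks is integrated against \<open>mark_density\<close>, which
  vanishes there; a root without children has \<open>shape_prob\<close> 0, since \<open>P\<close>
  does not charge 0.\<close>

lemma AE_shape_event:
  assumes P: "0 \<notin> set_pmf P"
  shows "AE \<omega> in ewt_data_law P. \<omega> \<in> shape_event T m \<longrightarrow>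
    tree_box T m (tree_marks T m \<omega>) \<and> (0 < T \<longrightarrow> 1 \<le> m [])"
proof -
  let ?h = "indicator {y. \<not> (tree_box T m y \<and> (0 < T \<longrightarrow> 1 \<le> m []))} :: (nat list \<Rightarrow> real) \<Rightarrow> ennreal"
  have h: "?h \<in> borel_measurable (mark_space T m)"
    using pred_tree_box[of T m] by (intro borel_measurable_indicator') (simp add: pred_def[symmetric])
  have "(\<integral>\<^sup>+\<omega>. ?h (tree_marks T m \<omega>) * indicator (shape_event T m) \<omega> \<partial>ewt_data_law P) = 0"
  proof (cases "0 < T \<longrightarrow> 1 \<le> m []")
    case True
    then have "?h y * ennreal (mark_density T m y) = 0" for y
      by (auto simp: mark_density_def indicator_def)
    then show ?thesis unfolding nn_integral_tree_marks[OF h]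
      by (simp only: nn_integral_const mult_zero_left mult_zero_right)
  next
    case False
    then have "m [] = 0" by simp
    then have "pmf (offspring_law P []) (m []) = 0" using P by (simp add: offspring_law_def pmf_eq_0_set_pmf)
    then have "shape_prob P T m = 0"
      unfolding shape_prob_def using False finite_inner Nil_inner[of T] by (intro prod_zero) auto
    then show ?thesis unfolding nn_integral_tree_marks[OF h] by simp
  qed
  then have "AE \<omega> in ewt_data_law P. ?h (tree_marks T m \<omega>) * indicator (shape_event T m) \<omega> = 0"
    by (subst (asm) nn_integral_0_iff_AE)
      (intro borel_measurable_times_ennreal indicator_shape_event_measurable
        measurable_compose[OF tree_marks_measurable_ewt h], auto)
  then show ?thesis by eventually_elim (auto simp: indicator_def split: if_splits)
qed

text \<open>At every depth an outcome lies in the event of its own truncated shape, so the sign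
  conditions at a node can be read off from an exploration that reaches just past it.\<close>

lemma AE_clf_ewt:
  assumes P: "0 \<notin> set_pmf P"
  shows "AE \<omega> in ewt_data_law P. clf_network (ewt \<omega>)"
proof -
  have "AE \<omega> in ewt_data_law P. \<forall>T. \<forall>m\<in>shapes T. \<omega> \<in> shape_event T m \<longrightarrow>
    tree_box T m (tree_marks T m \<omega>) \<and> (0 < T \<longrightarrow> 1 \<le> m [])"
    unfolding AE_all_countable AE_ball_countable[OF countable_shapes] using AE_shape_event[OF P] by blast
  then show ?thesis
  proof eventually_elim
    case (elim \<omega>)
    have b: "tree_box T (shape_of T \<omega>) (tree_marks T (shape_of T \<omega>) \<omega>)" "0 < T \<Longrightarrow> 1 \<le> shape_of T \<omega> []" for T
      using elim shape_of_shapes shape_of_event by blast+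
    have node: "0 \<le> ewt_v \<omega> w \<and> (\<forall>j\<in>{1..ewt_n \<omega> w}. 0 \<le> ewt_cost \<omega> w j)" if "w \<in> kept \<omega>" for w
    proof -
      let ?T = "Suc (length w)" let ?m = "shape_of ?T \<omega>"
      have "w \<in> inner_nodes ?T (ewt_n \<omega>)" using that kept_subset_nodes by (auto simp: inner_nodes_def)
      then have w: "w \<in> inner_nodes ?T ?m" and m: "?m w = ewt_n \<omega> w"
        by (simp_all add: inner_shape_of) (simp add: shape_of_def)
      show ?thesis using b(1)[of ?T] w tree_marks_simps[OF w, where \<omega> = \<omega>] m by (auto simp: tree_box_def)
    qed
    have "[] \<in> inner_nodes 1 (ewt_n \<omega>)" by (rule Nil_inner) simp
    then have "1 \<le> ewt_n \<omega> []" using b(2)[of 1] by (simp add: shape_of_def)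
    then show ?case unfolding clf_ewt_iff using node by (auto simp: kept_snoc)
  qed
qed

lemma Er_borel_prob: "Er P \<in> borel_prob"
proof -
  interpret prob_space "ewt_data_law P" by (rule prob_space_ewt_data_law)
  have "(\<lambda>\<omega>. gclass (ewt \<omega>)) \<in> borel_measurable (ewt_data_law P)"
    unfolding measurable_cong_sets[OF sets_ewt_data_law refl] by (rule measurable_gclass_ewt)
  then show ?thesis unfolding borel_prob_def Er_def by (auto intro: prob_space_distr)
qed

section \<open>Test functions of finitely many marks\<close>

text \<open>Rebuilds a point of the data space from finitely many marks. Unexplored nodes get no
  children and threshold 1, so they end the tree and satisfy the sign conditions.\<close>

definition tree_data :: "nat \<Rightarrow> (nat list \<Rightarrow> nat) \<Rightarrow> (nat list \<Rightarrow> real) \<Rightarrow> nat list \<Rightarrow> node_data" where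
  "tree_data T m y = (\<lambda>w\<in>indices. if w \<in> inner_nodes T m
     then (m w, y (w @ [0]), \<lambda>j. if j \<in> {1..m w} then y (w @ [j]) else 0) else (0, 1, \<lambda>_. 0))"

lemma tree_data_inner:
  assumes "w \<in> inner_nodes T m"
  shows "ewt_n (tree_data T m y) w = m w" "ewt_v (tree_data T m y) w = y (w @ [0])"
    "j \<in> {1..m w} \<Longrightarrow> ewt_cost (tree_data T m y) w j = y (w @ [j])"
  using assms inner_subset_indices[of T m]
  by (auto simp: tree_data_def ewt_n_def ewt_v_def ewt_cost_def)

lemma tree_data_outer:
  assumes "w \<in> indices" "w \<notin> inner_nodes T m"
  shows "ewt_n (tree_data T m y) w = 0" "ewt_v (tree_data T m y) w = 1"
  using assms by (auto simp: tree_data_def ewt_n_def ewt_v_def)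

lemma clf_tree_data:
  assumes "0 < T" "1 \<le> m []" and b: "tree_box T m y"
  shows "clf_network (ewt (tree_data T m y))"
proof -
  let ?\<omega> = "tree_data T m y"
  have ind: "w \<in> kept ?\<omega> \<Longrightarrow> w \<in> indices" for w
    using kept_subset_nodes nodes_subset_indices by blast
  have "0 \<le> ewt_v ?\<omega> w" if "w \<in> kept ?\<omega>" for w
    using ind[OF that] b by (cases "w \<in> inner_nodes T m") (auto simp: tree_data_inner tree_data_outer tree_box_def)
  moreover have "0 \<le> ewt_cost ?\<omega> w j" if k: "w @ [j] \<in> kept ?\<omega>" for w j
  proof -
    have w: "w \<in> kept ?\<omega>" "j \<in> {1..ewt_n ?\<omega> w}" using k by (auto simp: kept_snoc)
    then have wi: "w \<in> inner_nodes T m" using ind[OF w(1)] tree_data_outer(1)[of w T m y] by (cases "w \<in> inner_nodes T m") auto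
    with w(2) b show ?thesis by (auto simp: tree_data_inner tree_box_def)
  qed
  moreover have "1 \<le> ewt_n ?\<omega> []" using tree_data_inner(1)[OF Nil_inner[OF assms(1)], where y = y] assms(2) by simp
  ultimately show ?thesis unfolding clf_ewt_iff by auto
qed

lemma measurable_tree_data:
  "tree_data T m \<in> measurable (mark_space T m) data_space"
  unfolding tree_data_def[abs_def]
proof (rule measurable_restrict)
  fix w assume "w \<in> indices"
  let ?E = "mark_space T m"
  show "(\<lambda>y. if w \<in> inner_nodes T m then (m w, y (w @ [0]), \<lambda>j. if j \<in> {1..m w} then y (w @ [j]) else 0) else (0, 1, \<lambda>_. 0))
      \<in> measurable ?E node_space"
  proof (cases "w \<in> inner_nodes T m")
    case True
    have c: "(\<lambda>y. y (w @ [j])) \<in> borel_measurable ?E" if "j \<le> m w" for j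
      by (rule measurable_component_singleton) (use True that in \<open>simp add: explored_snoc\<close>)
    have "(\<lambda>y. if j \<in> {1..m w} then y (w @ [j]) else 0) \<in> borel_measurable ?E" for j
      using c[of j] by (cases "j \<in> {1..m w}") auto
    then have "(\<lambda>y j. if j \<in> {1..m w} then y (w @ [j]) else 0) \<in> measurable ?E (PiM UNIV (\<lambda>_. borel))"
      by (intro measurable_PiM_single') (auto simp: space_PiM)
    then show ?thesis using True c[of 0] unfolding node_space_def by (auto intro!: measurable_Pair)
  next
    case False
    then show ?thesis
      by (auto intro!: measurable_const simp: node_space_def space_pair_measure space_PiM)
  qed
qed

text \<open>A function of finitely many marks that can be evaluated in both models. Subtracting
  \<open>\<delta>\<close> pays for the part of the network that these marks do not determine, which
  makes it a minorant of \<open>f\<close> on the finite side; the maximum keeps it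
  non-negative.\<close>

definition tree_test :: "(gstar \<Rightarrow> real) \<Rightarrow> real \<Rightarrow> nat \<Rightarrow> (nat list \<Rightarrow> nat) \<Rightarrow> (nat list \<Rightarrow> real) \<Rightarrow> real" where
  "tree_test f \<delta> T m y = max 0 (f (gclass (ewt (tree_data T m y))) - \<delta>)"

lemma measurable_tree_test:
  assumes "f \<in> borel_measurable borel"
  shows "(\<lambda>y. ennreal (tree_test f \<delta> T m y)) \<in> borel_measurable (mark_space T m)"
proof -
  have "(\<lambda>y. f (gclass (ewt (tree_data T m y)))) \<in> borel_measurable (mark_space T m)"
    by (rule measurable_compose[OF measurable_compose[OF measurable_tree_data measurable_gclass_ewt] assms])
  then show ?thesis unfolding tree_test_def by measurable
qed

text \<open>One \<open>\<delta>\<close> pays for truncating the tree at depth \<open>T\<close>, the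
  other is the one subtracted in \<open>tree_test\<close>.\<close>

lemma tree_test_ewt:
  assumes lip: "\<And>x y. \<bar>f x - f y\<bar> \<le> L * dist x y" and L: "0 \<le> L" "L / (1 + real t) \<le> \<delta>"
    and T: "T = Suc (Suc t)" and \<omega>: "\<omega> \<in> shape_event T m" "clf_network (ewt \<omega>)"
    and b: "tree_box T m (tree_marks T m \<omega>)" "1 \<le> m []"
  shows "f (gclass (ewt \<omega>)) - 2 * \<delta> \<le> tree_test f \<delta> T m (tree_marks T m \<omega>)"
proof -
  let ?\<omega> = "tree_data T m (tree_marks T m \<omega>)"
  have c: "clf_network (ewt ?\<omega>)" using clf_tree_data[of T m "tree_marks T m \<omega>"] b T by simp
  have "agree (real t) (ewt \<omega>) (ewt ?\<omega>)"
  proof (rule ewt_agree[OF \<omega>(2) c])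
    fix w assume w: "w \<in> nodes (ewt_n \<omega>)" "length w \<le> Suc t"
    have "w \<in> nodes (ewt_n \<omega>) \<longleftrightarrow> w \<in> nodes m"
      by (rule nodes_cong[of m T]) (use \<omega>(1) w(2) T in \<open>auto simp: shape_event_def inner_nodes_def\<close>)
    then have wi: "w \<in> inner_nodes T m" using w T by (auto simp: inner_nodes_def)
    have n: "ewt_n \<omega> w = m w" using \<omega>(1) wi by (simp add: shape_event_def)
    show "ewt_n ?\<omega> w = ewt_n \<omega> w \<and> ewt_v ?\<omega> w = ewt_v \<omega> w \<and>
      (\<forall>j. 1 \<le> j \<longrightarrow> j \<le> ewt_n \<omega> w \<longrightarrow> ewt_cost ?\<omega> w j = ewt_cost \<omega> w j)"
      unfolding n using tree_data_inner[OF wi] tree_marks_simps[OF wi, where \<omega> = \<omega>] by auto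
  qed
  then have "dist (gclass (ewt \<omega>)) (gclass (ewt ?\<omega>)) \<le> 1 / (1 + real t)"
    by (rule dist_gclass_le[OF \<omega>(2) c]) simp
  then have "L * dist (gclass (ewt \<omega>)) (gclass (ewt ?\<omega>)) \<le> L * (1 / (1 + real t))"
    using L(1) by (rule mult_left_mono)
  with lip[of "gclass (ewt \<omega>)" "gclass (ewt ?\<omega>)"] L(2)
  have "f (gclass (ewt \<omega>)) - f (gclass (ewt ?\<omega>)) \<le> \<delta>" by simp
  then show ?thesis by (simp add: tree_test_def)
qed

lemma clf_component_finite_model:
  assumes d: "\<And>i. i \<in> {1..n} \<Longrightarrow> 1 \<le> d i \<and> d i < n - 1" and C: "\<And>e. e \<in> pairs n \<Longrightarrow> 0 \<le> C e"
    and r: "r \<in> {1..n}"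
  shows "clf_network (component (finite_model n d C) r)"
proof -
  have rv: "v \<in> {1..n}" if "(r, v) \<in> (adj (finite_model n d C))\<^sup>*" for v
    using that by (induction rule: rtrancl_induct) (use r in \<open>auto simp: adj_finite_model\<close>)
  have "0 \<le> threshold n d C v" if v: "v \<in> {1..n}" for v
  proof (rule ccontr)
    assume neg: "\<not> 0 \<le> threshold n d C v"
    have "0 \<le> C {v, j}" if "j \<in> {1..n}" "j \<noteq> v" for j using C[of "{v, j}"] v that by (simp add: pairs_iff)
    then have "{j \<in> {1..n}. j \<noteq> v \<and> C {v, j} \<le> threshold n d C v} = {}" using neg by force
    moreover have "d v < card {j \<in> {1..n}. j \<noteq> v \<and> C {v, j} \<le> threshold n d C v}"
      using threshold_le_iff[where n = n and d = d and i = v and C = C and a = "threshold n d C v"] v d[OF v] by blast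
    ultimately show False by (simp only: card.empty)
  qed
  moreover have "0 \<le> C {u, v}" if "(u, v) \<in> adj (finite_model n d C)" for u v
    using that C[of "{u, v}"] unfolding adj_finite_model pairs_iff by (auto simp: potential_nbrs_def)
  ultimately show ?thesis
    unfolding clf_component_finite_model_iff[OF r] using rv d by blast
qed

text \<open>The marks of a successful exploration rebuild a tree that agrees with the component up
  to radius \<open>t\<close> (\<open>explores_agree\<close>), so the values of \<open>f\<close>
  differ by at most the subtracted \<open>\<delta>\<close>.\<close>

lemma tree_test_finite_model:
  assumes lip: "\<And>x y. \<bar>f x - f y\<bar> \<le> L * dist x y" and L: "0 \<le> L" "L / (1 + real t) \<le> \<delta>" and f0: "\<And>x. 0 \<le> f x"
    and T: "T = Suc (Suc t)" and d: "\<And>i. i \<in> {1..n} \<Longrightarrow> 1 \<le> d i \<and> d i < n - 1"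
    and C: "\<And>e. e \<in> pairs n \<Longrightarrow> 0 \<le> C e"
    and \<phi>: "\<phi> \<in> labellings n d T m" "explores n C T m \<phi>"
  shows "tree_test f \<delta> T m (\<lambda>x\<in>explored T m. C (parent_edge \<phi> x)) \<le>
    f (gclass (component (finite_model n d C) (\<phi> [])))"
proof -
  define y where "y = (\<lambda>x\<in>explored T m. C (parent_edge \<phi> x))"
  let ?\<omega> = "tree_data T m y" and ?N = "component (finite_model n d C) (\<phi> [])"
  have yw: "y (w @ [j]) = C {\<phi> w, \<phi> (w @ [j])}" if "w \<in> inner_nodes T m" "j \<le> m w" for w j
    using that by (simp add: y_def explored_snoc)
  have y0: "0 \<le> y x" if "x \<in> explored T m" for x
    using that parent_edge_pairs[OF \<phi>(1)] C by (auto simp: y_def)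
  have b: "tree_box T m y" unfolding tree_box_def
  proof (intro ballI conjI)
    fix w assume w: "w \<in> inner_nodes T m"
    show "0 \<le> y (w @ [0])" using w by (intro y0) (simp add: explored_snoc)
    fix j assume j: "j \<in> {1..m w}"
    show "0 \<le> y (w @ [j])" using w j by (intro y0) (simp add: explored_snoc)
    show "y (w @ [j]) < y (w @ [0])" using \<phi>(2) w j by (simp add: yw explores_def)
  qed
  have r: "\<phi> [] \<in> {1..n}" using labellingsD(2)[OF \<phi>(1), of "[]"] by simp
  have "d (\<phi> []) = m []" using labellingsD(3)[OF \<phi>(1) Nil_inner] T by simp
  then have "1 \<le> m []" using d[OF r] by simp
  then have c: "clf_network (ewt ?\<omega>)" using clf_tree_data b T by simp
  have c': "clf_network ?N" by (rule clf_component_finite_model[OF d C r])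
  have "agree (real t) (ewt ?\<omega>) ?N"
    by (rule explores_agree[OF _ \<phi> T c c']) (use d in \<open>auto simp: tree_data_inner yw\<close>)
  then have "dist (gclass (ewt ?\<omega>)) (gclass ?N) \<le> 1 / (1 + real t)"
    by (rule dist_gclass_le[OF c c']) simp
  then have "L * dist (gclass (ewt ?\<omega>)) (gclass ?N) \<le> L * (1 / (1 + real t))"
    using L(1) by (rule mult_left_mono)
  with lip[of "gclass (ewt ?\<omega>)" "gclass ?N"] L(2)
  have "f (gclass (ewt ?\<omega>)) - f (gclass ?N) \<le> \<delta>" by simp
  then show ?thesis using f0[of "gclass ?N"] by (simp add: tree_test_def y_def[symmetric] del: restrict_apply)
qed

section \<open>Counting labellings\<close>

text \<open>Greedy choice: with values assigned one at a time, at most \<open>N\<close> earlier ones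
  are forbidden. Truncated subtraction keeps the bound valid when a set is too small.\<close>

lemma card_injections_ge:
  assumes "finite V" "card V \<le> N" "\<And>x. x \<in> V \<Longrightarrow> finite (S x)"
  shows "(\<Prod>x\<in>V. card (S x) - N) \<le> card {\<phi> \<in> PiE V S. inj_on \<phi> V}"
  using assms
proof (induction V)
  case (insert x V)
  let ?A = "{\<phi> \<in> PiE V S. inj_on \<phi> V}" and ?B = "{\<phi> \<in> PiE (insert x V) S. inj_on \<phi> (insert x V)}"
  let ?g = "\<lambda>(\<phi>, s). \<phi>(x := s)"
  have finA: "finite ?A" using insert by (intro finite_subset[of ?A "PiE V S"] finite_PiE) auto
  have finB: "finite ?B" using insert by (intro finite_subset[of ?B "PiE (insert x V) S"] finite_PiE) auto
  have "(\<Prod>x\<in>insert x V. card (S x) - N) = (\<Prod>x\<in>V. card (S x) - N) * (card (S x) - N)"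
    using insert.hyps by (simp add: mult.commute)
  also have "\<dots> \<le> card ?A * (card (S x) - N)" using insert by (intro mult_right_mono insert.IH) auto
  also have "\<dots> = (\<Sum>\<phi>\<in>?A. card (S x) - N)" by simp
  also have "\<dots> \<le> (\<Sum>\<phi>\<in>?A. card (S x - \<phi> ` V))"
  proof (rule sum_mono)
    fix \<phi> assume "\<phi> \<in> ?A"
    have "card (\<phi> ` V) \<le> N" using card_image_le[OF insert.hyps(1), of \<phi>] insert by simp
    then show "card (S x) - N \<le> card (S x - \<phi> ` V)"
      using diff_card_le_card_Diff[of "\<phi> ` V" "S x"] insert.hyps(1) by simp
  qed
  also have "\<dots> = card (SIGMA \<phi>:?A. S x - \<phi> ` V)"
    using finA insert.prems by (intro card_SigmaI[symmetric]) auto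
  also have "\<dots> = card (?g ` (SIGMA \<phi>:?A. S x - \<phi> ` V))"
  proof (rule card_image[symmetric], rule inj_onI)
    fix p q assume pq: "p \<in> (SIGMA \<phi>:?A. S x - \<phi> ` V)" "q \<in> (SIGMA \<phi>:?A. S x - \<phi> ` V)" "?g p = ?g q"
    obtain \<phi> s \<psi> t where [simp]: "p = (\<phi>, s)" "q = (\<psi>, t)" by (cases p; cases q)
    have "\<phi> \<in> extensional V" "\<psi> \<in> extensional V" using pq(1,2) by (auto simp: PiE_def)
    then have "\<phi> x = \<psi> x" using insert.hyps(2) by (simp add: extensional_def)
    moreover have "\<phi>(x := s) = \<psi>(x := t)" using pq(3) by simp
    ultimately show "p = q" by (metis (no_types, lifting) \<open>p = (\<phi>, s)\<close> \<open>q = (\<psi>, t)\<close> fun_upd_eqD fun_upd_triv fun_upd_upd)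
  qed
  also have "\<dots> \<le> card ?B"
  proof (rule card_mono[OF finB], rule image_subsetI)
    fix p assume "p \<in> (SIGMA \<phi>:?A. S x - \<phi> ` V)"
    then obtain \<phi> s where p: "p = (\<phi>, s)" "\<phi> \<in> PiE V S" "inj_on \<phi> V" "s \<in> S x" "s \<notin> \<phi> ` V" by auto
    have im: "(\<phi>(x := s)) ` V = \<phi> ` V" using insert.hyps(2) by auto
    have "inj_on (\<phi>(x := s)) V" using p(3) insert.hyps(2) by (auto simp: inj_on_def)
    then have "inj_on (\<phi>(x := s)) (insert x V)" using p(5) insert.hyps(2) im by (auto simp: inj_on_insert)
    then show "?g p \<in> ?B" using PiE_fun_upd[OF p(4,2)] p(1) by simp
  qed
  finally show ?case .
qed simp

lemma finite_labellings: "finite (labellings n d T m)"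
  by (rule finite_subset[of _ "tree_verts T m \<rightarrow>\<^sub>E {1..n}"])
    (auto simp: labellings_def intro!: finite_PiE finite_explored)

lemma card_labellings_ge:
  fixes T :: nat and m :: "nat list \<Rightarrow> nat" and d :: "nat \<Rightarrow> nat"
  defines "V \<equiv> tree_verts T m"
  shows "(\<Prod>x\<in>V. card (if x \<in> inner_nodes T m then {i \<in> {1..n}. d i = (if x = [] then m x else m x + 1)} else {1..n}) - card V)
    \<le> card (labellings n d T m)" (is "(\<Prod>x\<in>V. card (?S x) - _) \<le> _")
proof -
  have "(\<Prod>x\<in>V. card (?S x) - card V) \<le> card {\<phi> \<in> PiE V ?S. inj_on \<phi> V}"
    by (rule card_injections_ge) (auto simp: V_def finite_explored)
  also have "\<dots> \<le> card (labellings n d T m)"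
  proof (rule card_mono[OF finite_labellings], rule subsetI)
    fix \<phi> assume "\<phi> \<in> {\<phi> \<in> PiE V ?S. inj_on \<phi> V}"
    then have \<phi>: "\<phi> \<in> PiE V ?S" "inj_on \<phi> V" by auto
    have "\<phi> x \<in> {1..n}" if "x \<in> V" for x
      using PiE_mem[OF \<phi>(1) that] by (cases "x \<in> inner_nodes T m") auto
    moreover have "d (\<phi> w) = (if w = [] then m w else m w + 1)" if "w \<in> inner_nodes T m" for w
      using PiE_mem[OF \<phi>(1), of w] that inner_subset[of T m] by (auto simp: V_def)
    ultimately show "\<phi> \<in> labellings n d T m"
      using \<phi> unfolding labellings_def V_def by (auto simp: PiE_iff)
  qed
  finally show ?thesis .
qed

lemma pmf_empirical: "0 < n \<Longrightarrow> pmf (empirical n d) k = real (card {i \<in> {1..n}. d i = k}) / real n"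
  by (auto simp: empirical_def pmf_map measure_pmf_of_set Int_def vimage_def)

lemma pmf_empirical_tendsto:
  assumes "weakly_converges (\<lambda>n. measure_pmf (empirical n (d n))) (measure_pmf P)"
  shows "(\<lambda>n. pmf (empirical n (d n)) k) \<longlonglongrightarrow> pmf P k"
proof -
  let ?f = "indicator {k} :: nat \<Rightarrow> real"
  have "continuous_on UNIV ?f" by simp
  moreover have "bounded (range ?f)" by (rule boundedI[where B = 1]) (auto simp: indicator_def)
  ultimately have "(\<lambda>n. integral\<^sup>L (measure_pmf (empirical n (d n))) ?f) \<longlonglongrightarrow> integral\<^sup>L (measure_pmf P) ?f"
    using assms unfolding weakly_converges_def by blast
  then show ?thesis by (simp add: measure_pmf_single)
qed

lemma truncated_ratio_tendsto:
  fixes a :: "nat \<Rightarrow> nat"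
  assumes "(\<lambda>n. real (a n) / real n) \<longlonglongrightarrow> q"
  shows "(\<lambda>n. real (a n - N) / real n) \<longlonglongrightarrow> q"
proof (rule tendsto_sandwich[OF always_eventually always_eventually _ assms])
  show "\<forall>n. real (a n) / real n - real N / real n \<le> real (a n - N) / real n"
    unfolding diff_divide_distrib[symmetric] by (intro allI divide_right_mono) auto
  show "\<forall>n. real (a n - N) / real n \<le> real (a n) / real n"
    by (intro allI divide_right_mono) auto
  have "(\<lambda>n. real N / real n) \<longlonglongrightarrow> 0" by (rule lim_const_over_n)
  from tendsto_diff[OF assms this] show "(\<lambda>n. real (a n) / real n - real N / real n) \<longlonglongrightarrow> q" by simp
qed

text \<open>The exponent counts tree vertices: one factor \<open>1 / n\<close> per explored edge
  comes from the cost density, and one more from the uniform root.\<close>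

definition labelling_density :: "nat \<Rightarrow> (nat \<Rightarrow> nat) \<Rightarrow> nat \<Rightarrow> (nat list \<Rightarrow> nat) \<Rightarrow> real" where
  "labelling_density n d T m =
     tree_weight T m * real (card (labellings n d T m)) / real n ^ card (tree_verts T m)"

text \<open>An inner node contributes the frequency of its degree, which tends to a mass of
  \<open>P\<close>; the other vertices contribute 1. Forbidding boundedly many labels changes each
  ratio by O(1/n).\<close>

lemma labelling_density_lower:
  assumes P: "0 \<notin> set_pmf P" and w: "weakly_converges (\<lambda>n. measure_pmf (empirical n (d n))) (measure_pmf P)"
  shows "\<exists>b. b \<longlonglongrightarrow> shape_prob P T m \<and> (\<forall>n. b n \<le> labelling_density n (d n) T m)"
proof -
  let ?V = "tree_verts T m"
  define k where "k x = (if x = [] then m x else m x + 1)" for x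
  define S where "S n x = (if x \<in> inner_nodes T m then {i \<in> {1..n}. d n i = k x} else {1..n})" for n x
  define q where "q x = (if x \<in> inner_nodes T m then pmf P (k x) else 1)" for x
  define b where "b n = tree_weight T m * (\<Prod>x\<in>?V. real (card (S n x) - card ?V) / real n)" for n
  have "(\<lambda>n. real (card (S n x)) / real n) \<longlonglongrightarrow> q x" for x
  proof (cases "x \<in> inner_nodes T m")
    case True
    have "\<forall>\<^sub>F n in sequentially. pmf (empirical n (d n)) (k x) = real (card (S n x)) / real n"
      using eventually_gt_at_top[of 0] by eventually_elim (use True in \<open>simp add: pmf_empirical S_def\<close>)
    from Lim_transform_eventually[OF pmf_empirical_tendsto[OF w] this] True show ?thesis by (simp add: q_def)
  next
    case False
    have "\<forall>\<^sub>F n in sequentially. 1 = real (card (S n x)) / real n"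
      using eventually_gt_at_top[of 0] by eventually_elim (use False in \<open>simp add: S_def\<close>)
    from Lim_transform_eventually[OF tendsto_const this] False show ?thesis by (simp add: q_def)
  qed
  then have "b \<longlonglongrightarrow> tree_weight T m * (\<Prod>x\<in>?V. q x)"
    unfolding b_def by (intro tendsto_mult tendsto_const tendsto_prod truncated_ratio_tendsto)
  also have "(\<Prod>x\<in>?V. q x) = (\<Prod>x\<in>inner_nodes T m. q x)"
    by (rule prod.mono_neutral_right) (use inner_subset[of T m] finite_explored[of T m] in \<open>auto simp: q_def\<close>)
  also have "tree_weight T m * (\<Prod>x\<in>inner_nodes T m. q x) = (\<Prod>x\<in>inner_nodes T m. 1 / fact (m x) * q x)"
    unfolding tree_weight_def by (rule prod.distrib[symmetric])
  also have "\<dots> = shape_prob P T m" unfolding shape_prob_def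
  proof (rule prod.cong[OF refl])
    fix x assume x: "x \<in> inner_nodes T m"
    have "pmf (offspring_law P x) (m x) = pmf P (k x)"
    proof (cases "x = []")
      case False
      have "pmf (map_pmf (\<lambda>k. k - 1) P) (m x) = measure P {j. j - 1 = m x}"
        by (simp add: pmf_map vimage_def)
      also have "\<dots> = measure P {m x + 1}"
      proof (rule measure_pmf.finite_measure_eq_AE)
        \<comment> \<open>For \<open>m x = 0\<close> the truncated predecessor also sends 0 to 0;
          \<open>P\<close> gives that point no mass.\<close>
        have "j \<noteq> 0" if "j \<in> set_pmf P" for j using P that by metis
        then show "AE j in P. j \<in> {j. j - 1 = m x} \<longleftrightarrow> j \<in> {m x + 1}"
          by (fastforce simp: AE_measure_pmf_iff)
      qed simp_all
      finally show ?thesis using False by (simp add: offspring_law_def k_def measure_pmf_single)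
    qed (simp add: offspring_law_def k_def)
    then show "1 / fact (m x) * q x = pmf (offspring_law P x) (m x) / fact (m x)"
      using x by (simp add: q_def)
  qed
  finally have lim: "b \<longlonglongrightarrow> shape_prob P T m" .
  have "b n \<le> labelling_density n (d n) T m" for n
  proof -
    have "(\<Prod>x\<in>?V. card (S n x) - card ?V) \<le> card (labellings n (d n) T m)"
      unfolding S_def k_def by (rule card_labellings_ge)
    then have "(\<Prod>x\<in>?V. real (card (S n x) - card ?V)) \<le> real (card (labellings n (d n) T m))"
      unfolding of_nat_prod[symmetric] of_nat_le_iff .
    then have "tree_weight T m * ((\<Prod>x\<in>?V. real (card (S n x) - card ?V)) / real n ^ card ?V) \<le>
        tree_weight T m * (real (card (labellings n (d n) T m)) / real n ^ card ?V)"
      by (intro mult_left_mono divide_right_mono) (auto simp: tree_weight_def intro!: prod_nonneg)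
    then show ?thesis by (simp add: b_def labelling_density_def prod_dividef)
  qed
  with lim show ?thesis by blast
qed

lemma sets_cost_law [measurable_cong]: "sets (cost_law n) = sets (cost_space n)"
  unfolding cost_law_def by (rule sets_PiM_cong) auto

lemma prob_space_cost_law: "0 < n \<Longrightarrow> prob_space (cost_law n)"
  unfolding cost_law_def by (intro prob_space_PiM prob_space_exp_law)

lemma AE_cost_law_nonneg: "0 < n \<Longrightarrow> AE C in cost_law n. \<forall>e\<in>pairs n. 0 \<le> C e"
proof (rule AE_finite_allI[OF finite_pairs])
  fix e assume n: "0 < n" and e: "e \<in> pairs n"
  have "AE x in exp_law n. 0 \<le> x" by (subst AE_density) (auto simp: exponential_density_def)
  then show "AE C in cost_law n. 0 \<le> C e"
    unfolding cost_law_def using prob_space_exp_law[OF n] e by (intro AE_PiM_component) auto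
qed

section \<open>The lower bound in the finite model\<close>

context
  fixes n :: nat and d :: "nat \<Rightarrow> nat"
  assumes n: "0 < n" and d: "\<And>i. i \<in> {1..n} \<Longrightarrow> 1 \<le> d i \<and> d i < n - 1"
begin

private abbreviation X :: "(nat set \<Rightarrow> real) \<Rightarrow> nat \<Rightarrow> gstar" where
  "X C r \<equiv> gclass (component (finite_model n d C) r)"

private lemma X: "r \<in> {1..n} \<Longrightarrow> (\<lambda>C. X C r) \<in> borel_measurable (cost_law n)"
  unfolding measurable_cong_sets[OF sets_cost_law refl]
  by (rule measurable_gclass_finite_model) (use d in auto)

private lemma nn_integral_U_measure:
  assumes "f \<in> borel_measurable borel"
  shows "(\<integral>\<^sup>+x. f x \<partial>U_measure n (finite_model n d C)) = (\<Sum>r\<in>{1..n}. f (X C r)) / ennreal (real n)"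
proof -
  have "(\<integral>\<^sup>+x. f x \<partial>U_measure n (finite_model n d C)) = (\<integral>\<^sup>+r. f (X C r) \<partial>measure_pmf (pmf_of_set {1..n}))"
    unfolding U_measure_def by (rule nn_integral_distr) (use assms in auto)
  then show ?thesis using n by (subst (asm) nn_integral_pmf_of_set) (auto simp: ennreal_of_nat_eq_real_of_nat)
qed

private lemma kernel: "(\<lambda>C. U_measure n (finite_model n d C)) \<in> measurable (cost_law n) (subprob_algebra borel)"
proof (rule measurable_subprob_algebra)
  fix C
  show "subprob_space (U_measure n (finite_model n d C))"
    unfolding U_measure_def by (intro prob_space_imp_subprob_space measure_pmf.prob_space_distr) simp
  show "sets (U_measure n (finite_model n d C)) = sets borel" by (simp add: U_measure_def)
next
  fix A :: "gstar set" assume A: "A \<in> sets borel"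
  have "emeasure (U_measure n (finite_model n d C)) A = (\<Sum>r\<in>{1..n}. indicator A (X C r)) / ennreal (real n)" for C
  proof -
    have "emeasure (U_measure n (finite_model n d C)) A = (\<integral>\<^sup>+x. indicator A x \<partial>U_measure n (finite_model n d C))"
      using A by (simp add: U_measure_def)
    also have "\<dots> = (\<Sum>r\<in>{1..n}. indicator A (X C r)) / ennreal (real n)"
      by (rule nn_integral_U_measure) (use A in simp)
    finally show ?thesis .
  qed
  moreover have "(\<lambda>C. (\<Sum>r\<in>{1..n}. indicator A (X C r)) / ennreal (real n)) \<in> borel_measurable (cost_law n)"
    by (intro borel_measurable_divide_ennreal borel_measurable_sum borel_measurable_const
        measurable_compose[OF X]) (use A in auto)
  ultimately show "(\<lambda>C. emeasure (U_measure n (finite_model n d C)) A) \<in> borel_measurable (cost_law n)"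
    by (simp only:)
qed

lemma expected_U_borel_prob: "expected_U n d \<in> borel_prob"
proof -
  interpret prob_space "cost_law n" by (rule prob_space_cost_law[OF n])
  have "prob_space (expected_U n d)" unfolding expected_U_def
    by (rule prob_space_bind[OF _ kernel])
      (simp add: U_measure_def measure_pmf.prob_space_distr)
  moreover have "sets (expected_U n d) = sets borel" unfolding expected_U_def
    by (rule sets_bind[OF sets_kernel[OF kernel]]) (auto simp: not_empty)
  ultimately show ?thesis by (simp add: borel_prob_def)
qed

lemma nn_integral_expected_U:
  assumes "f \<in> borel_measurable borel"
  shows "(\<integral>\<^sup>+x. f x \<partial>expected_U n d) = (\<integral>\<^sup>+C. (\<Sum>r\<in>{1..n}. f (X C r)) / ennreal (real n) \<partial>cost_law n)"
  unfolding expected_U_def nn_integral_bind[OF assms kernel] nn_integral_U_measure[OF assms] ..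

text \<open>The weighted tests of all successful explorations are summed. For fixed non-negative
  costs, those starting at \<open>r\<close> contribute at most \<open>f (X C r)\<close>, by
  \<open>explorations_weight_le_1\<close>; in expectation each labelling contributes at least the
  bound of \<open>nn_integral_explores_ge\<close>.\<close>

lemma expected_U_ge:
  assumes lip: "\<And>x y. \<bar>f x - f y\<bar> \<le> L * dist x y" and L: "0 \<le> L" "L / (1 + real t) \<le> \<delta>" and f0: "\<And>x. 0 \<le> f x"
    and f: "f \<in> borel_measurable borel" and T: "T = Suc (Suc t)"
    and M: "finite M" "M \<subseteq> shapes T"
  shows "(\<Sum>m\<in>M. ennreal (labelling_density n d T m) *
      (\<integral>\<^sup>+y. ennreal (tree_test f \<delta> T m y) * ennreal (mark_density T m y) \<partial>mark_lborel T m))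
    \<le> (\<integral>\<^sup>+x. ennreal (f x) \<partial>expected_U n d)"
proof -
  define \<iota> where "\<iota> m = (\<integral>\<^sup>+y. ennreal (tree_test f \<delta> T m y) * ennreal (mark_density T m y) \<partial>mark_lborel T m)" for m
  define A where "A = (SIGMA m:M. labellings n d T m)"
  define test where "test C z = tree_test f \<delta> T (fst z) (\<lambda>x\<in>explored T (fst z). C (parent_edge (snd z) x))"
    for C :: "nat set \<Rightarrow> real" and z
  define val where "val C z = tree_weight T (fst z) * (test C z * indicator {C. explores n C T (fst z) (snd z)} C)" for C z
  have finA: "finite A" unfolding A_def using M(1) by (intro finite_SigmaI finite_labellings)
  have w0: "0 \<le> tree_weight T m" for m by (auto simp: tree_weight_def intro!: prod_nonneg)
  have test0: "0 \<le> test C z" for C z by (simp add: test_def tree_test_def)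
  have val0: "0 \<le> val C z" for C z by (simp add: val_def w0 test0)
  have pointwise: "(\<Sum>z\<in>A. val C z) \<le> (\<Sum>r\<in>{1..n}. f (X C r))" if C: "\<forall>e\<in>pairs n. 0 \<le> C e" for C
  proof -
    have "(\<Sum>z\<in>A. val C z) = (\<Sum>r\<in>{1..n}. \<Sum>z\<in>{z \<in> A. snd z [] = r}. val C z)"
    proof (rule sum.group[symmetric, OF finA])
      show "(\<lambda>z. snd z []) ` A \<subseteq> {1..n}"
        using labellingsD(2)[of _ n d T _ "[]"] unfolding A_def by fastforce
    qed simp
    also have "\<dots> \<le> (\<Sum>r\<in>{1..n}. f (X C r))"
    proof (rule sum_mono)
      fix r assume "r \<in> {1..n}"
      have "(\<Sum>z\<in>{z \<in> A. snd z [] = r}. val C z) = (\<Sum>z\<in>{z \<in> A. snd z [] = r \<and> explores n C T (fst z) (snd z)}. val C z)"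
        by (rule sum.mono_neutral_right) (use finA in \<open>auto simp: val_def\<close>)
      also have "\<dots> \<le> (\<Sum>z\<in>{z \<in> A. snd z [] = r \<and> explores n C T (fst z) (snd z)}. tree_weight T (fst z) * f (X C r))"
      proof (rule sum_mono)
        fix z assume z: "z \<in> {z \<in> A. snd z [] = r \<and> explores n C T (fst z) (snd z)}"
        then have "test C z \<le> f (X C (snd z []))" unfolding test_def
          by (intro tree_test_finite_model[OF lip L f0 T d]) (use C in \<open>auto simp: A_def\<close>)
        then show "val C z \<le> tree_weight T (fst z) * f (X C r)"
          using z w0 by (auto simp: val_def intro!: mult_left_mono)
      qed
      \<comment> \<open>The sum is enlarged from the shapes in \<open>M\<close> to all explorations
        from \<open>r\<close>, so that the weight bound applies; the added terms are
        non-negative.\<close>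
      also have "\<dots> \<le> (\<Sum>z\<in>explorations n d C r T. tree_weight T (fst z) * f (X C r))"
        by (rule sum_mono2) (use explorations_weight_le_1[of n d C r T] M(2) w0 f0 in \<open>auto simp: A_def explorations_def\<close>)
      also have "\<dots> = (\<Sum>z\<in>explorations n d C r T. tree_weight T (fst z)) * f (X C r)" by (simp add: sum_distrib_right)
      also have "\<dots> \<le> 1 * f (X C r)"
        using explorations_weight_le_1[of n d C r T] f0 by (intro mult_right_mono) auto
      finally show "(\<Sum>z\<in>{z \<in> A. snd z [] = r}. val C z) \<le> f (X C r)" by simp
    qed
    finally show ?thesis .
  qed
  have meas: "(\<lambda>C. ennreal (test C z)) \<in> borel_measurable (cost_law n)"
    "(indicator {C. explores n C T (fst z) (snd z)} :: _ \<Rightarrow> ennreal) \<in> borel_measurable (cost_law n)" if z: "z \<in> A" for z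
  proof -
    have "(\<lambda>C. \<lambda>x\<in>explored T (fst z). C (parent_edge (snd z) x)) \<in> measurable (cost_space n) (PiM (explored T (fst z)) (\<lambda>_. borel :: real measure))"
      by (rule measurable_restrict) simp
    from measurable_compose[OF this measurable_tree_test[OF f]]
    show "(\<lambda>C. ennreal (test C z)) \<in> borel_measurable (cost_law n)"
      unfolding test_def measurable_cong_sets[OF sets_cost_law refl] .
    show "(indicator {C. explores n C T (fst z) (snd z)} :: _ \<Rightarrow> ennreal) \<in> borel_measurable (cost_law n)"
      unfolding measurable_cong_sets[OF sets_cost_law refl]
      by (intro borel_measurable_indicator') (use pred_explores[of "snd z" n d T "fst z"] z in \<open>auto simp: pred_def[symmetric] A_def\<close>)
  qed
  have int: "ennreal (tree_weight T (fst z) * (1 / real n) ^ card (explored T (fst z))) * \<iota> (fst z)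
      \<le> (\<integral>\<^sup>+C. ennreal (val C z) \<partial>cost_law n)" if z: "z \<in> A" for z
  proof -
    have \<phi>: "snd z \<in> labellings n d T (fst z)" using z by (auto simp: A_def)
    have "ennreal (tree_weight T (fst z) * (1 / real n) ^ card (explored T (fst z))) * \<iota> (fst z) =
        ennreal (tree_weight T (fst z)) * (ennreal ((1 / real n) ^ card (explored T (fst z))) * \<iota> (fst z))"
      by (subst ennreal_mult) (auto simp: w0 mult.assoc)
    also have "\<dots> \<le> ennreal (tree_weight T (fst z)) *
        (\<integral>\<^sup>+C. ennreal (test C z) * indicator {C. explores n C T (fst z) (snd z)} C \<partial>cost_law n)"
      unfolding \<iota>_def test_def
      by (intro mult_left_mono nn_integral_explores_ge[OF \<phi> measurable_tree_test[OF f]]) simp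
    also have "\<dots> = (\<integral>\<^sup>+C. ennreal (tree_weight T (fst z)) *
        (ennreal (test C z) * indicator {C. explores n C T (fst z) (snd z)} C) \<partial>cost_law n)"
      by (rule nn_integral_cmult[symmetric]) (intro borel_measurable_times_ennreal meas[OF z])
    also have "\<dots> = (\<integral>\<^sup>+C. ennreal (val C z) \<partial>cost_law n)"
      by (intro nn_integral_cong) (auto simp: val_def ennreal_mult w0 test0 indicator_def)
    finally show ?thesis .
  qed
  have valm: "(\<lambda>C. ennreal (val C z)) \<in> borel_measurable (cost_law n)" if z: "z \<in> A" for z
  proof -
    have "ennreal (val C z) = ennreal (tree_weight T (fst z)) *
        (ennreal (test C z) * indicator {C. explores n C T (fst z) (snd z)} C)" for C
      by (auto simp: val_def ennreal_mult w0 test0 indicator_def)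
    then show ?thesis by (simp only:) (intro borel_measurable_times_ennreal borel_measurable_const meas[OF z])
  qed
  have "(\<Sum>m\<in>M. ennreal (labelling_density n d T m) * \<iota> m) =
      (\<Sum>z\<in>A. ennreal (tree_weight T (fst z) * (1 / real n) ^ card (explored T (fst z))) * \<iota> (fst z)) / ennreal (real n)"
  proof -
    have "(\<Sum>z\<in>A. ennreal (tree_weight T (fst z) * (1 / real n) ^ card (explored T (fst z))) * \<iota> (fst z)) / ennreal (real n)
      = (\<Sum>m\<in>M. \<Sum>\<phi>\<in>labellings n d T m. ennreal (tree_weight T m * (1 / real n) ^ card (explored T m)) * \<iota> m) / ennreal (real n)"
      unfolding A_def by (subst sum.Sigma[OF M(1)]) (auto simp: finite_labellings split_beta')
    also have "\<dots> = (\<Sum>m\<in>M. of_nat (card (labellings n d T m)) * (ennreal (tree_weight T m * (1 / real n) ^ card (explored T m)) * \<iota> m) / ennreal (real n))"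
      by (simp add: divide_ennreal_def sum_distrib_right)
    also have "\<dots> = (\<Sum>m\<in>M. ennreal (labelling_density n d T m) * \<iota> m)"
    proof (rule sum.cong[OF refl])
      fix m
      \<comment> \<open>The tree has one vertex more than revealed edges; the matching extra
        \<open>1 / n\<close> is the probability of the root label.\<close>
      have "[] \<notin> explored T m" by (auto simp: explored_def)
      then have "labelling_density n d T m = real (card (labellings n d T m)) *
          (tree_weight T m * (1 / real n) ^ card (explored T m)) * (1 / real n)"
        using n by (simp add: labelling_density_def finite_explored power_divide mult_ac)
      then have "ennreal (labelling_density n d T m) = of_nat (card (labellings n d T m)) *
          ennreal (tree_weight T m * (1 / real n) ^ card (explored T m)) * ennreal (1 / real n)"
      proof -
        have *: "ennreal (x * a * c) = ennreal x * ennreal a * ennreal c" if "0 \<le> x" "0 \<le> a" "0 \<le> c" for x a c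
          using that by (simp add: ennreal_mult)
        show ?thesis unfolding \<open>labelling_density n d T m = _\<close> ennreal_of_nat_eq_real_of_nat
          by (rule *) (simp_all add: w0)
      qed
      moreover have "ennreal (1 / real n) = 1 / ennreal (real n)"
        using n by (simp add: divide_ennreal[symmetric])
      ultimately show "of_nat (card (labellings n d T m)) * (ennreal (tree_weight T m * (1 / real n) ^ card (explored T m)) * \<iota> m) / ennreal (real n)
          = ennreal (labelling_density n d T m) * \<iota> m"
        by (simp add: divide_ennreal_def mult_ac)
    qed
    finally show ?thesis by simp
  qed
  also have "\<dots> \<le> (\<Sum>z\<in>A. \<integral>\<^sup>+C. ennreal (val C z) \<partial>cost_law n) / ennreal (real n)"
    by (intro divide_right_mono_ennreal sum_mono int)
  also have "(\<Sum>z\<in>A. \<integral>\<^sup>+C. ennreal (val C z) \<partial>cost_law n) = (\<integral>\<^sup>+C. (\<Sum>z\<in>A. ennreal (val C z)) \<partial>cost_law n)"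
    by (rule nn_integral_sum[symmetric]) (rule valm)
  also have "\<dots> / ennreal (real n) = (\<integral>\<^sup>+C. (\<Sum>z\<in>A. ennreal (val C z)) / ennreal (real n) \<partial>cost_law n)"
    by (rule nn_integral_divide[symmetric]) (intro borel_measurable_sum valm)
  also have "\<dots> \<le> (\<integral>\<^sup>+C. (\<Sum>r\<in>{1..n}. ennreal (f (X C r))) / ennreal (real n) \<partial>cost_law n)"
  proof (rule nn_integral_mono_AE)
    show "AE C in cost_law n. (\<Sum>z\<in>A. ennreal (val C z)) / ennreal (real n) \<le> (\<Sum>r\<in>{1..n}. ennreal (f (X C r))) / ennreal (real n)"
      using AE_cost_law_nonneg[OF n]
    proof eventually_elim
      case (elim C)
      from pointwise[OF elim] have "ennreal (\<Sum>z\<in>A. val C z) \<le> ennreal (\<Sum>r\<in>{1..n}. f (X C r))" by (rule ennreal_leI)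
      then have "(\<Sum>z\<in>A. ennreal (val C z)) \<le> (\<Sum>r\<in>{1..n}. ennreal (f (X C r)))"
        by (simp only: sum_ennreal[OF val0] sum_ennreal[OF f0])
      then show ?case by (rule divide_right_mono_ennreal)
    qed
  qed
  also have "\<dots> = (\<integral>\<^sup>+x. ennreal (f x) \<partial>expected_U n d)"
    by (rule nn_integral_expected_U[symmetric]) (use f in simp)
  finally show ?thesis unfolding \<iota>_def .
qed

end

section \<open>Approximation of the limit and conclusion\<close>

text \<open>This is the tightness of the limit law: the countably many shape events cover the whole
  space, so continuity from above makes the remainder small.\<close>

lemma shape_events_cover:
  assumes \<eta>: "0 < \<eta>"
  shows "\<exists>M. finite M \<and> M \<subseteq> shapes T \<and>
    emeasure (ewt_data_law P) {\<omega> \<in> space (ewt_data_law P). \<forall>m\<in>M. \<omega> \<notin> shape_event T m} < ennreal \<eta>"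
proof -
  interpret prob_space "ewt_data_law P" by (rule prob_space_ewt_data_law)
  have ne: "shapes T \<noteq> {}" using shape_of_shapes by blast
  define s where "s = from_nat_into (shapes T)"
  have rs: "range s = shapes T" unfolding s_def by (rule range_from_nat_into[OF ne countable_shapes])
  define N where "N k = {\<omega> \<in> space (ewt_data_law P). \<forall>m\<in>s ` {..<k}. \<omega> \<notin> shape_event T m}" for k
  have ev: "{\<omega> \<in> space (ewt_data_law P). \<omega> \<in> shape_event T m} \<in> events" for m
    using shape_event_sets[of T m] by (simp add: sets_ewt_data_law sets_eq_imp_space_eq[OF sets_ewt_data_law])
  have Nev: "N k \<in> events" for k
  proof -
    have "N k = space (ewt_data_law P) - (\<Union>m\<in>s ` {..<k}. {\<omega> \<in> space (ewt_data_law P). \<omega> \<in> shape_event T m})"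
      by (auto simp: N_def)
    also have "\<dots> \<in> events" by (intro sets.Diff sets.top sets.finite_UN ev) simp
    finally show ?thesis .
  qed
  have "(\<Inter>k. N k) = {}"
  proof -
    have False if "\<omega> \<in> (\<Inter>k. N k)" for \<omega>
    proof -
      obtain j where "s j = shape_of T \<omega>" using rs shape_of_shapes[of T \<omega>] by (metis imageE)
      then have "shape_of T \<omega> \<in> s ` {..<Suc j}" by (metis imageI lessI lessThan_iff)
      then have "\<omega> \<notin> N (Suc j)" using shape_of_event[of \<omega> T] by (auto simp: N_def)
      with that show False by blast
    qed
    then show ?thesis by blast
  qed
  moreover have "decseq N" by (rule decseq_SucI) (auto simp: N_def)
  ultimately have "(\<lambda>k. prob (N k)) \<longlonglongrightarrow> 0"
    using finite_Lim_measure_decseq[of N] Nev by (simp add: image_subset_iff)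
  then obtain k where "prob (N k) < \<eta>"
    using order_tendstoD(2)[of _ 0 sequentially \<eta>] \<eta> by (metis eventually_happens' sequentially_bot)
  then have "emeasure (ewt_data_law P) (N k) < ennreal \<eta>"
    by (simp add: emeasure_eq_measure ennreal_lessI \<eta>)
  then show ?thesis unfolding N_def
    by (intro exI[of _ "s ` {..<k}"]) (use rs in auto)
qed

text \<open>Outside a small event, which costs at most \<open>B * \<eta>\<close>, some shape in
  \<open>M\<close> occurs and \<open>f\<close> exceeds its test by at most
  \<open>2 * \<delta>\<close>. That test is in turn at most the sum over \<open>M\<close>, and each
  summand is integrated by \<open>nn_integral_tree_marks\<close>.\<close>

lemma integral_Er_le:
  assumes P: "0 \<notin> set_pmf P"
    and lip: "\<And>x y. \<bar>f x - f y\<bar> \<le> L * dist x y" and L: "0 \<le> L" "L / (1 + real t) \<le> \<delta>"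
    and f: "f \<in> borel_measurable borel" "\<And>x. f x \<le> B" "0 \<le> B" and T: "T = Suc (Suc t)" and \<eta>: "0 < \<eta>" "0 \<le> \<delta>"
  shows "\<exists>M. finite M \<and> M \<subseteq> shapes T \<and> (\<integral>\<^sup>+x. ennreal (f x) \<partial>Er P) \<le> ennreal (2 * \<delta>) + ennreal B * ennreal \<eta> +
    (\<Sum>m\<in>M. ennreal (shape_prob P T m) *
      (\<integral>\<^sup>+y. ennreal (tree_test f \<delta> T m y) * ennreal (mark_density T m y) \<partial>mark_lborel T m))"
proof -
  let ?E = "ewt_data_law P"
  interpret prob_space ?E by (rule prob_space_ewt_data_law)
  obtain M where M: "finite M" "M \<subseteq> shapes T"
    and small: "emeasure ?E {\<omega> \<in> space ?E. \<forall>m\<in>M. \<omega> \<notin> shape_event T m} < ennreal \<eta>"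
    using shape_events_cover[OF \<eta>(1)] by blast
  define N where "N = {\<omega> \<in> space ?E. \<forall>m\<in>M. \<omega> \<notin> shape_event T m}"
  define h where "h m y = ennreal (tree_test f \<delta> T m y)" for m y
  have h: "h m \<in> borel_measurable (mark_space T m)" for m
    unfolding h_def by (rule measurable_tree_test[OF f(1)])
  have hm: "(\<lambda>\<omega>. h m (tree_marks T m \<omega>) * indicator (shape_event T m) \<omega>) \<in> borel_measurable ?E" for m
    by (intro borel_measurable_times_ennreal indicator_shape_event_measurable measurable_compose[OF tree_marks_measurable_ewt h])
  have ev: "{\<omega> \<in> space ?E. \<omega> \<in> shape_event T m} \<in> events" for m
    using shape_event_sets[of T m] by (simp add: sets_ewt_data_law sets_eq_imp_space_eq[OF sets_ewt_data_law])
  have N [measurable]: "N \<in> events"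
  proof -
    have "N = space ?E - (\<Union>m\<in>M. {\<omega> \<in> space ?E. \<omega> \<in> shape_event T m})" by (auto simp: N_def)
    also have "\<dots> \<in> events" by (intro sets.Diff sets.top sets.finite_UN ev M)
    finally show ?thesis .
  qed
  have "AE \<omega> in ?E. \<forall>m\<in>M. \<omega> \<in> shape_event T m \<longrightarrow> tree_box T m (tree_marks T m \<omega>) \<and> (0 < T \<longrightarrow> 1 \<le> m [])"
    by (rule AE_finite_allI[OF M(1)]) (rule AE_shape_event[OF P])
  then have ae: "AE \<omega> in ?E. ennreal (f (gclass (ewt \<omega>))) \<le> ennreal (2 * \<delta>) + ennreal B * indicator N \<omega> +
      (\<Sum>m\<in>M. h m (tree_marks T m \<omega>) * indicator (shape_event T m) \<omega>)"
    using AE_clf_ewt[OF P] AE_space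
  proof eventually_elim
    case (elim \<omega>)
    show ?case
    proof (cases "\<omega> \<in> N")
      case True
      then have "ennreal (f (gclass (ewt \<omega>))) \<le> ennreal B * indicator N \<omega>" by (simp add: f ennreal_leI)
      also have "\<dots> \<le> ennreal (2 * \<delta>) + ennreal B * indicator N \<omega> + (\<Sum>m\<in>M. h m (tree_marks T m \<omega>) * indicator (shape_event T m) \<omega>)"
        by (simp add: add_increasing add_increasing2)
      finally show ?thesis .
    next
      case False
      then obtain m where m: "m \<in> M" "\<omega> \<in> shape_event T m" using elim(3) by (auto simp: N_def)
      then have "f (gclass (ewt \<omega>)) - 2 * \<delta> \<le> tree_test f \<delta> T m (tree_marks T m \<omega>)"
        using elim T by (intro tree_test_ewt[OF lip L T]) auto
      then have "ennreal (f (gclass (ewt \<omega>))) \<le> ennreal (2 * \<delta> + tree_test f \<delta> T m (tree_marks T m \<omega>))"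
        by (intro ennreal_leI) simp
      also have "\<dots> = ennreal (2 * \<delta>) + h m (tree_marks T m \<omega>) * indicator (shape_event T m) \<omega>"
        using m \<eta>(2) by (simp add: h_def tree_test_def)
      also have "\<dots> \<le> ennreal (2 * \<delta>) + (\<Sum>m\<in>M. h m (tree_marks T m \<omega>) * indicator (shape_event T m) \<omega>)"
        by (intro add_left_mono member_le_sum m M) auto
      finally show ?thesis using False by simp
    qed
  qed
  have "(\<integral>\<^sup>+x. ennreal (f x) \<partial>Er P) = (\<integral>\<^sup>+\<omega>. ennreal (f (gclass (ewt \<omega>))) \<partial>?E)"
    unfolding Er_def
  proof (rule nn_integral_distr)
    show "(\<lambda>\<omega>. gclass (ewt \<omega>)) \<in> borel_measurable ?E"
      unfolding measurable_cong_sets[OF sets_ewt_data_law refl] by (rule measurable_gclass_ewt)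
  qed (use f in simp)
  also have "\<dots> \<le> (\<integral>\<^sup>+\<omega>. ennreal (2 * \<delta>) + ennreal B * indicator N \<omega> +
      (\<Sum>m\<in>M. h m (tree_marks T m \<omega>) * indicator (shape_event T m) \<omega>) \<partial>?E)"
    by (rule nn_integral_mono_AE[OF ae])
  also have "\<dots> = ennreal (2 * \<delta>) + ennreal B * emeasure ?E N +
      (\<Sum>m\<in>M. \<integral>\<^sup>+\<omega>. h m (tree_marks T m \<omega>) * indicator (shape_event T m) \<omega> \<partial>?E)"
    using hm by (simp add: nn_integral_add nn_integral_sum nn_integral_cmult_indicator emeasure_space_1 borel_measurable_sum)
  also have "\<dots> = ennreal (2 * \<delta>) + ennreal B * emeasure ?E N +
      (\<Sum>m\<in>M. ennreal (shape_prob P T m) * (\<integral>\<^sup>+y. h m y * ennreal (mark_density T m y) \<partial>mark_lborel T m))"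
    by (simp only: nn_integral_tree_marks[OF h])
  also have "\<dots> \<le> ennreal (2 * \<delta>) + ennreal B * ennreal \<eta> +
      (\<Sum>m\<in>M. ennreal (shape_prob P T m) * (\<integral>\<^sup>+y. h m y * ennreal (mark_density T m y) \<partial>mark_lborel T m))"
    using small by (intro add_mono mult_left_mono order_refl) (auto simp: N_def)
  finally show ?thesis using M unfolding h_def by blast
qed

theorem theorem2p1:
  fixes P :: "nat pmf" and d :: "nat \<Rightarrow> nat \<Rightarrow> nat"
  assumes "0 \<notin> set_pmf P"
    and "integrable (measure_pmf P) real"
    and "pmf P 1 < 1"
    and "\<And>n i. n \<ge> 3 \<Longrightarrow> i \<in> {1..n} \<Longrightarrow> 1 \<le> d n i \<and> d n i \<le> n - 2"
    and "weakly_converges (\<lambda>n. measure_pmf (empirical n (d n))) (measure_pmf P)"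
  shows "weakly_converges (\<lambda>n. expected_U n (d n)) (Er P)"
proof (rule weakly_converges_lipschitz_lower[OF Er_borel_prob])
  \<comment> \<open>Degrees between 1 and \<open>n - 2\<close> exist only for
    \<open>n \<ge> 3\<close>; smaller \<open>n\<close> do not affect the limit.\<close>
  have d: "1 \<le> d n i \<and> d n i < n - 1" if "n \<ge> 3" "i \<in> {1..n}" for n i
    using assms(4)[OF that] that by linarith
  show U: "\<forall>\<^sub>F n in sequentially. expected_U n (d n) \<in> borel_prob"
    using eventually_ge_at_top[of 3]
    by eventually_elim (rule expected_U_borel_prob, use d in auto)
  fix f :: "gstar \<Rightarrow> real" and L B e :: real
  assume lip0: "\<And>x y. \<bar>f x - f y\<bar> \<le> L * dist x y" and f0: "\<And>x. 0 \<le> f x" and fB: "\<And>x. f x \<le> B" and e: "0 < e"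
  have lip: "\<bar>f x - f y\<bar> \<le> \<bar>L\<bar> * dist x y" for x y
    using lip0[of x y] by (rule order_trans) (simp add: mult_right_mono)
  have B: "0 \<le> B" using f0 fB order_trans by blast
  have "continuous_on UNIV f"
    by (rule lipschitz_on_continuous_on[of "\<bar>L\<bar>"], rule lipschitz_onI) (use lip in \<open>auto simp: dist_real_def\<close>)
  then have fm: "f \<in> borel_measurable borel" by (rule borel_measurable_continuous_onI)
  have int: "integrable \<mu> f" "ennreal (integral\<^sup>L \<mu> f) = (\<integral>\<^sup>+x. ennreal (f x) \<partial>\<mu>)" "0 \<le> integral\<^sup>L \<mu> f"
    if "\<mu> \<in> borel_prob" for \<mu>
  proof -
    interpret prob_space \<mu> using that by (simp add: borel_prob_def)
    have "f \<in> borel_measurable \<mu>" using fm that measurable_cong_sets[of \<mu> borel] by (auto simp: borel_prob_def)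
    then show i: "integrable \<mu> f" by (rule integrable_const_bound[where B = B, rotated]) (use f0 fB in simp)
    show "ennreal (integral\<^sup>L \<mu> f) = (\<integral>\<^sup>+x. ennreal (f x) \<partial>\<mu>)"
      by (rule nn_integral_eq_integral[symmetric, OF i]) (simp add: f0)
    show "0 \<le> integral\<^sup>L \<mu> f" by (simp add: f0)
  qed
  \<comment> \<open>Half of \<open>e\<close> is spent on the tree side:
    \<open>2 * \<delta> = e / 4\<close> for truncation and \<open>B * \<eta> \<le> e / 4\<close> for
    missed shapes. The other half absorbs the convergence in \<open>n\<close>.\<close>
  define \<delta> where "\<delta> = e / 8"
  define \<eta> where "\<eta> = e / (4 * (B + 1))"
  have \<delta>: "0 < \<delta>" and \<eta>: "0 < \<eta>" "B * \<eta> \<le> e / 4"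
    using e B by (auto simp: \<delta>_def \<eta>_def field_simps)
  obtain t :: nat where "\<bar>L\<bar> / \<delta> < real t" using reals_Archimedean2 by blast
  then have t: "\<bar>L\<bar> / (1 + real t) \<le> \<delta>" using \<delta> by (simp add: field_simps)
  define T where "T = Suc (Suc t)"
  define \<iota> where "\<iota> m = (\<integral>\<^sup>+y. ennreal (tree_test f \<delta> T m y) * ennreal (mark_density T m y) \<partial>mark_lborel T m)" for m
  obtain M where M: "finite M" "M \<subseteq> shapes T"
    and Er_le: "(\<integral>\<^sup>+x. ennreal (f x) \<partial>Er P) \<le> ennreal (2 * \<delta>) + ennreal B * ennreal \<eta> + (\<Sum>m\<in>M. ennreal (shape_prob P T m) * \<iota> m)"
    using integral_Er_le[OF assms(1) lip _ t fm fB B T_def \<eta>(1)] \<delta> unfolding \<iota>_def by auto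
  have sp0: "0 \<le> shape_prob P T m" for m unfolding shape_prob_def by (auto intro!: prod_nonneg)
  \<comment> \<open>Where \<open>shape_prob\<close> is positive, the integral
    \<open>\<iota> m\<close> is finite, being a bounded expectation divided by that constant; so the
    sum can be handled in the reals. The other shapes contribute 0.\<close>
  define M' where "M' = {m \<in> M. 0 < shape_prob P T m}"
  have finM': "finite M'" using M by (simp add: M'_def)
  have \<iota>fin: "\<iota> m < \<infinity>" if "m \<in> M'" for m
  proof -
    interpret E: prob_space "ewt_data_law P" by (rule prob_space_ewt_data_law)
    have test_le: "tree_test f \<delta> T m y \<le> B" for y
      using fB[of "gclass (ewt (tree_data T m y))"] \<delta> B by (simp add: tree_test_def)
    have "ennreal (shape_prob P T m) * \<iota> m =
        (\<integral>\<^sup>+\<omega>. ennreal (tree_test f \<delta> T m (tree_marks T m \<omega>)) * indicator (shape_event T m) \<omega> \<partial>ewt_data_law P)"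
      unfolding \<iota>_def by (rule nn_integral_tree_marks[symmetric]) (rule measurable_tree_test[OF fm])
    also have "\<dots> \<le> (\<integral>\<^sup>+\<omega>. ennreal B \<partial>ewt_data_law P)"
      by (intro nn_integral_mono) (auto simp: indicator_def test_le ennreal_leI)
    also have "\<dots> < \<infinity>" by (simp add: E.emeasure_space_1)
    finally have "ennreal (shape_prob P T m) * \<iota> m < \<infinity>" .
    then show ?thesis using that by (auto simp: M'_def ennreal_mult_less_top)
  qed
  define i where "i m = enn2real (\<iota> m)" for m
  have i: "\<iota> m = ennreal (i m)" "0 \<le> i m" if "m \<in> M'" for m
    using \<iota>fin[OF that] by (auto simp: i_def less_top)
  have sumM': "(\<Sum>m\<in>M. ennreal (shape_prob P T m) * \<iota> m) = ennreal (\<Sum>m\<in>M'. shape_prob P T m * i m)"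
  proof -
    have "(\<Sum>m\<in>M. ennreal (shape_prob P T m) * \<iota> m) = (\<Sum>m\<in>M'. ennreal (shape_prob P T m) * \<iota> m)"
      by (rule sum.mono_neutral_right) (use M sp0 in \<open>auto simp: M'_def not_less antisym\<close>)
    also have "\<dots> = (\<Sum>m\<in>M'. ennreal (shape_prob P T m * i m))"
      by (rule sum.cong) (auto simp: i ennreal_mult sp0)
    also have "\<dots> = ennreal (\<Sum>m\<in>M'. shape_prob P T m * i m)"
      by (rule sum_ennreal) (auto simp: i sp0)
    finally show ?thesis .
  qed
  have Er: "integral\<^sup>L (Er P) f \<le> e / 2 + (\<Sum>m\<in>M'. shape_prob P T m * i m)"
  proof -
    have s0: "0 \<le> (\<Sum>m\<in>M'. shape_prob P T m * i m)" by (intro sum_nonneg) (auto simp: i sp0)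
    have "ennreal (integral\<^sup>L (Er P) f) \<le> ennreal (2 * \<delta> + B * \<eta> + (\<Sum>m\<in>M'. shape_prob P T m * i m))"
      using Er_le B \<delta> \<eta>(1) s0 unfolding sumM' int(2)[OF Er_borel_prob] by (simp add: ennreal_mult)
    then have "integral\<^sup>L (Er P) f \<le> 2 * \<delta> + B * \<eta> + (\<Sum>m\<in>M'. shape_prob P T m * i m)"
      using B \<delta> \<eta>(1) s0 by (subst (asm) ennreal_le_iff) auto
    then show ?thesis using \<eta>(2) by (simp add: \<delta>_def)
  qed
  obtain b where b: "\<And>m. b m \<longlonglongrightarrow> shape_prob P T m" "\<And>m n. b m n \<le> labelling_density n (d n) T m"
    using labelling_density_lower[OF assms(1,5), of T] by metis
  \<comment> \<open>Only finitely many shapes remain, so their lower bounds may be summed in the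
    limit.\<close>
  have "(\<lambda>n. \<Sum>m\<in>M'. b m n * i m) \<longlonglongrightarrow> (\<Sum>m\<in>M'. shape_prob P T m * i m)"
    by (intro tendsto_sum tendsto_mult b tendsto_const)
  then have "\<forall>\<^sub>F n in sequentially. (\<Sum>m\<in>M'. shape_prob P T m * i m) - e / 2 < (\<Sum>m\<in>M'. b m n * i m)"
    by (rule order_tendstoD) (use e in simp)
  then show "\<forall>\<^sub>F n in sequentially. integral\<^sup>L (Er P) f - e \<le> integral\<^sup>L (expected_U n (d n)) f"
    using U eventually_ge_at_top[of 3]
  proof eventually_elim
    case (elim n)
    have ld0: "0 \<le> labelling_density n (d n) T m" for m
      unfolding labelling_density_def tree_weight_def
      by (intro divide_nonneg_nonneg mult_nonneg_nonneg prod_nonneg) auto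
    have "ennreal (\<Sum>m\<in>M'. labelling_density n (d n) T m * i m) = (\<Sum>m\<in>M'. ennreal (labelling_density n (d n) T m) * \<iota> m)"
      by (subst sum_ennreal[symmetric]) (auto simp: i ld0 ennreal_mult intro!: sum.cong)
    also have "\<dots> \<le> (\<integral>\<^sup>+x. ennreal (f x) \<partial>expected_U n (d n))" unfolding \<iota>_def
      by (rule expected_U_ge[OF _ d lip _ t f0 fm T_def finM']) (use elim(3) M in \<open>auto simp: M'_def\<close>)
    finally have "(\<Sum>m\<in>M'. labelling_density n (d n) T m * i m) \<le> integral\<^sup>L (expected_U n (d n)) f"
      unfolding int(2)[OF elim(2), symmetric] using int(3)[OF elim(2)] by (simp add: ennreal_le_iff)
    moreover have "(\<Sum>m\<in>M'. b m n * i m) \<le> (\<Sum>m\<in>M'. labelling_density n (d n) T m * i m)"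
      by (intro sum_mono mult_right_mono b) (simp add: i)
    ultimately show ?case using Er elim(1) by linarith
  qed
qed

end
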